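(* Let $\{H_\omega\}_{\omega\in\Omega}$ be the family of selfadjoint operators in $L_2(a,b)$ generated (as described in the context) by $$-\frac{d^2}{dx^2}+v(x)+\sum_{n\in I}\omega(n)f_n(x).$$ For a given interval $[c,d]\subset(a,b)$, $c<d$, assume there is $n_0\in I$ such that $f_{n_0}(x)>0$ for almost all $x\in(c,d)$ and $f_{n_0}(x)=0$ if $x\notin(c,d)$. Suppose that the probability distribution $p_{n_0}$ of $\omega(n_0)$ is continuous, i.e. $p_{n_0}(\{r\})=0$ for every $r\in\mathbb{R}$. Let $r_i:\Omega\to\mathbb{R}$, $i=1,2,\dots$, be a (finite or infinite) sequence of measurable functions which do not depend on $\omega(n_0)$ (i.e. $r_i(\omega)=r_i(\omega')$ whenever $\omega(n)=\omega'(n)$ for all $n\in I\setminus\{n_0\}$). Then $$\mathbb{P}\Bigl(\Bigl\{\omega\in\Omega:\ \bigcup_i\{r_i(\omega)\}\cap\sigma_p(H_\omega)\neq\emptyset\Bigr\}\Bigr)=0.$$ In particular, if $r:\Omega\to\mathbb{R}$ is a single measurable function that does not depend on $\omega(n_0)$, then for almost every $\omega$ the number $r(\omega)$ is not an eigenvalue of $H_\omega$.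
   Context: Let $-\infty\le a<b\le\infty$. Probability space: fix $n_1<n_2$ in $\mathbb{Z}\cup\{\pm\infty\}$ and let $I=\{n\in\mathbb{Z}:n_1<n<n_2\}$. Let $\{p_n\}_{n\in I}$ be arbitrary Borel probability measures on $\mathbb{R}$, and let $\Omega=(\mathbb{R}^I,\mathcal{F},\mathbb{P})$, where $\mathbb{R}^I$ is the space of real sequences $\omega=\{\omega(n)\}_{n\in I}$, $\mathcal{F}$ is the product $\sigma$-algebra generated by the cylinder sets $\{\omega:\omega(i_1)\in A_1,\dots,\omega(i_k)\in A_k\}$ with $i_1,\dots,i_k\in I$ and $A_1,\dots,A_k\subset\mathbb{R}$ Borel, and $\mathbb{P}=\times_{n\in I}p_n$ is the product measure. The operators $H_\omega$: let $v$ and $f_n$ ($n\in I$) be real valued, measurable, locally $L_1$ functions on $(a,b)$, and put $q_\omega(x)=v(x)+\sum_{n\in I}\omega(n)f_n(x)$; it is assumed that for every $\omega$ this is a well defined real valued locally integrable function on $(a,b)$. Let $\tau_\omega u=-u''+q_\omega u$. It is assumed that, at each of the endpoints $a$ and $b$, $\tau_\omega$ is either regular or in the limit point case. Let $D_{\tau_\omega}$ be the set of $u\in L_2(a,b)$ with $u,u'$ absolutely continuous in $(a,b)$ (locally) and $\tau_\omega u\in L_2(a,b)$. For fixed real angles $\alpha,\beta$ not depending on $\omega$, $H_\omega u=\tau_\omega u$ with domain the set of $u\in D_{\tau_\omega}$ satisfying $u(a)\cos\alpha+u'(a)\sin\alpha=0$ if $\tau_\omega$ is regular at $a$, and $u(b)\cos\beta+u'(b)\sin\beta=0$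 if $\tau_\omega$ is regular at $b$ (no condition at a limit point endpoint). It is assumed that $H_\omega$ is selfadjoint for all $\omega\in\Omega$. For an operator $H$, $\sigma_p(H)=\{r\in\mathbb{R}:H\varphi=r\varphi\text{ for some }\varphi\not\equiv0\}$ denotes its set of eigenvalues. *)

theory Defs
  imports "HOL-Probability.Probability" "HOL-Library.Extended"
begin

no_notation Pinf ("\<infinity>")
no_notation Minf ("-\<infinity>")

definition index_set :: "int extended \<Rightarrow> int extended \<Rightarrow> int set" where
  "index_set n1 n2 = {n. n1 < Fin n \<and> Fin n < n2}"

section \<open>Function spaces on an open interval\<close>

definition locally_L1 :: "ereal \<Rightarrow> ereal \<Rightarrow> (real \<Rightarrow> real) \<Rightarrow> bool" where
  "locally_L1 a b g \<longleftrightarrow>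
     g \<in> borel_measurable (lebesgue_on (einterval a b)) \<and>
     (\<forall>K. compact K \<and> K \<subseteq> einterval a b \<longrightarrow> g absolutely_integrable_on K)"

text \<open>Elements of the Hilbert space are represented by functions; only their values on the
  interval matter, and equality in the Hilbert space is equality almost everywhere there.\<close>

definition L2 :: "ereal \<Rightarrow> ereal \<Rightarrow> (real \<Rightarrow> complex) set" where
  "L2 a b = {u. u \<in> borel_measurable (lebesgue_on (einterval a b)) \<and>
                integrable (lebesgue_on (einterval a b)) (\<lambda>x. (norm (u x))\<^sup>2)}"

definition L2_inner :: "ereal \<Rightarrow> ereal \<Rightarrow> (real \<Rightarrow> complex) \<Rightarrow> (real \<Rightarrow> complex) \<Rightarrow> complex" where
  "L2_inner a b u w = (LINT x|lebesgue_on (einterval a b). u x * cnj (w x))"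

definition L2_dist :: "ereal \<Rightarrow> ereal \<Rightarrow> (real \<Rightarrow> complex) \<Rightarrow> (real \<Rightarrow> complex) \<Rightarrow> real" where
  "L2_dist a b u w = sqrt (LINT x|lebesgue_on (einterval a b). (norm (u x - w x))\<^sup>2)"

text \<open>Finite families of non-overlapping subintervals are represented by the set of their
  pairs of endpoints.\<close>

definition abs_cont_on :: "real \<Rightarrow> real \<Rightarrow> (real \<Rightarrow> complex) \<Rightarrow> bool" where
  "abs_cont_on s t u \<longleftrightarrow>
     (\<forall>\<epsilon>>0. \<exists>\<delta>>0. \<forall>P. finite P \<and> (\<forall>(x, y)\<in>P. s \<le> x \<and> x \<le> y \<and> y \<le> t) \<and>
        disjoint_family_on (\<lambda>(x, y). {x<..<y}) P \<and> (\<Sum>(x, y)\<in>P. y - x) < \<delta>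
        \<longrightarrow> (\<Sum>(x, y)\<in>P. norm (u y - u x)) < \<epsilon>)"

definition locally_abs_cont :: "ereal \<Rightarrow> ereal \<Rightarrow> (real \<Rightarrow> complex) \<Rightarrow> bool" where
  "locally_abs_cont a b u \<longleftrightarrow> (\<forall>s t. {s..t} \<subseteq> einterval a b \<longrightarrow> abs_cont_on s t u)"

section \<open>The differential expression\<close>

text \<open>The functions \<open>u\<close> and \<open>u'\<close> are locally absolutely continuous on the interval, \<open>u'\<close> is the
  derivative of \<open>u\<close>, and \<open>-u'' + q u = g\<close> almost everywhere. The second derivative of such a
  function exists almost everywhere, so requiring its existence in the last clause is no
  restriction.\<close>

definition sl_eq ::
  "ereal \<Rightarrow> ereal \<Rightarrow> (real \<Rightarrow> real) \<Rightarrow> (real \<Rightarrow> complex) \<Rightarrow> (real \<Rightarrow> complex) \<Rightarrow> (real \<Rightarrow> complex) \<Rightarrow> bool"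
where
  "sl_eq a b q u u' g \<longleftrightarrow>
     locally_abs_cont a b u \<and> locally_abs_cont a b u' \<and>
     (\<forall>x\<in>einterval a b. (u has_vector_derivative u' x) (at x)) \<and>
     (AE x in lebesgue_on (einterval a b).
        \<exists>u''. (u' has_vector_derivative u'') (at x) \<and> - u'' + of_real (q x) * u x = g x)"

definition regular_left :: "ereal \<Rightarrow> ereal \<Rightarrow> (real \<Rightarrow> real) \<Rightarrow> bool" where
  "regular_left a b q \<longleftrightarrow>
     a \<noteq> -\<infinity> \<and> (\<exists>s\<in>einterval a b. q absolutely_integrable_on einterval a (ereal s))"

definition regular_right :: "ereal \<Rightarrow> ereal \<Rightarrow> (real \<Rightarrow> real) \<Rightarrow> bool" where
  "regular_right a b q \<longleftrightarrow>
     b \<noteq> \<infinity> \<and> (\<exists>s\<in>einterval a b. q absolutely_integrable_on einterval (ereal s) b)"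

text \<open>Limit point case in the sense of Weyl: for every complex \<open>z\<close> some solution of
  \<open>-u'' + q u = z u\<close> fails to be square integrable near the endpoint.\<close>

definition limit_point_left :: "ereal \<Rightarrow> ereal \<Rightarrow> (real \<Rightarrow> real) \<Rightarrow> bool" where
  "limit_point_left a b q \<longleftrightarrow>
     (\<forall>z. \<exists>u u'. sl_eq a b q u u' (\<lambda>x. z * u x) \<and> (\<forall>s\<in>einterval a b. u \<notin> L2 a (ereal s)))"

definition limit_point_right :: "ereal \<Rightarrow> ereal \<Rightarrow> (real \<Rightarrow> real) \<Rightarrow> bool" where
  "limit_point_right a b q \<longleftrightarrow>
     (\<forall>z. \<exists>u u'. sl_eq a b q u u' (\<lambda>x. z * u x) \<and> (\<forall>s\<in>einterval a b. u \<notin> L2 (ereal s) b))"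

text \<open>At a regular endpoint the values of \<open>u\<close> and \<open>u'\<close> are their one-sided limits.\<close>

definition bc_left :: "ereal \<Rightarrow> real \<Rightarrow> (real \<Rightarrow> complex) \<Rightarrow> (real \<Rightarrow> complex) \<Rightarrow> bool" where
  "bc_left a \<alpha> u u' \<longleftrightarrow>
     (\<exists>ua ua'. (u \<longlongrightarrow> ua) (at_right (real_of_ereal a)) \<and>
               (u' \<longlongrightarrow> ua') (at_right (real_of_ereal a)) \<and>
               ua * of_real (cos \<alpha>) + ua' * of_real (sin \<alpha>) = 0)"

definition bc_right :: "ereal \<Rightarrow> real \<Rightarrow> (real \<Rightarrow> complex) \<Rightarrow> (real \<Rightarrow> complex) \<Rightarrow> bool" where
  "bc_right b \<beta> u u' \<longleftrightarrow>
     (\<exists>ub ub'. (u \<longlongrightarrow> ub) (at_left (real_of_ereal b)) \<and>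
               (u' \<longlongrightarrow> ub') (at_left (real_of_ereal b)) \<and>
               ub * of_real (cos \<beta>) + ub' * of_real (sin \<beta>) = 0)"

section \<open>Operators in the Hilbert space\<close>

text \<open>An operator is given by its graph, a set of pairs of square integrable functions that is
  invariant under changing either component on a null set.\<close>

type_synonym L2_op = "((real \<Rightarrow> complex) \<times> (real \<Rightarrow> complex)) set"

definition sl_operator :: "ereal \<Rightarrow> ereal \<Rightarrow> real \<Rightarrow> real \<Rightarrow> (real \<Rightarrow> real) \<Rightarrow> L2_op" where
  "sl_operator a b \<alpha> \<beta> q =
     {(\<phi>, g). \<phi> \<in> L2 a b \<and> g \<in> L2 a b \<and>
        (\<exists>u u'. (AE x in lebesgue_on (einterval a b). \<phi> x = u x) \<and>
           sl_eq a b q u u' g \<and>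
           (regular_left a b q \<longrightarrow> bc_left a \<alpha> u u') \<and>
           (regular_right a b q \<longrightarrow> bc_right b \<beta> u u'))}"

definition densely_defined :: "ereal \<Rightarrow> ereal \<Rightarrow> L2_op \<Rightarrow> bool" where
  "densely_defined a b H \<longleftrightarrow> (\<forall>w\<in>L2 a b. \<forall>\<epsilon>>0. \<exists>u\<in>Domain H. L2_dist a b w u < \<epsilon>)"

definition adjoint_op :: "ereal \<Rightarrow> ereal \<Rightarrow> L2_op \<Rightarrow> L2_op" where
  "adjoint_op a b H =
     {(w, h). w \<in> L2 a b \<and> h \<in> L2 a b \<and>
        (\<forall>(u, g)\<in>H. L2_inner a b g w = L2_inner a b u h)}"

definition selfadjoint_op :: "ereal \<Rightarrow> ereal \<Rightarrow> L2_op \<Rightarrow> bool" where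
  "selfadjoint_op a b H \<longleftrightarrow> densely_defined a b H \<and> adjoint_op a b H = H"

definition point_spectrum :: "ereal \<Rightarrow> ereal \<Rightarrow> L2_op \<Rightarrow> real set" where
  "point_spectrum a b H =
     {r. \<exists>\<phi>. (\<phi>, \<lambda>x. of_real r * \<phi> x) \<in> H \<and> \<not> (AE x in lebesgue_on (einterval a b). \<phi> x = 0)}"

section \<open>The random operators\<close>

definition random_potential ::
  "int set \<Rightarrow> (real \<Rightarrow> real) \<Rightarrow> (int \<Rightarrow> real \<Rightarrow> real) \<Rightarrow> (int \<Rightarrow> real) \<Rightarrow> real \<Rightarrow> real" where
  "random_potential I v f \<omega> x = v x + (\<Sum>\<^sub>\<infinity>n\<in>I. \<omega> n * f n x)"

definition indep_of_coord :: "int set \<Rightarrow> int \<Rightarrow> ((int \<Rightarrow> real) \<Rightarrow> real) \<Rightarrow> bool" where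
  "indep_of_coord I n0 r \<longleftrightarrow>
     (\<forall>\<omega>\<in>(\<Pi>\<^sub>E n\<in>I. UNIV). \<forall>\<omega>'\<in>(\<Pi>\<^sub>E n\<in>I. UNIV).
        (\<forall>n\<in>I - {n0}. \<omega> n = \<omega>' n) \<longrightarrow> r \<omega> = r \<omega>')"

end

(* Fix all coordinates except t = omega(n0), so that r is a fixed number. Real eigenfunctions u_s, u_t
   belonging to the same r and to parameters s, t differ in their equations only by the term
   (t - s) f on (c,d), so the integral of (t - s) f u_s u_t over (c,d) is a difference of two Wronskians,
   and these vanish by the boundary conditions or by the limit point property. Eigenfunctions are
   therefore orthogonal with respect to the weight f, and by separability only countably many t
   can occur. As the distribution of t has no atoms, Fubini gives probability zero.

   Measurability of the event is not automatic, since P is not complete. The fundamental solutions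
   are limits of Picard iterates and hence jointly measurable in (omega, x), and the existence of an
   eigenfunction amounts to boundedness of an increasing sequence of binary quadratic forms in some
   direction, which is decided by their coefficients. *)

theory Submission
  imports Defs
begin

section \<open>Absolutely continuous functions and indefinite integrals\<close>

text \<open>Eigenfunctions are given by epsilon-delta absolute continuity of complex functions,
  whereas the argument needs integrals. \<open>abs_cont_FTC\<close> and its converse therefore
  translate the equation into the integrated system \<open>weak_sol\<close> for real and imaginary
  parts. In this form Wronskians are handled by integration by parts alone, although second
  derivatives exist only almost everywhere, and uniqueness follows from the constancy of Wronskians
  instead of a Gronwall estimate. Regular endpoints are adjoined to the interval, which turns a
  boundary condition into a linear equation in the Cauchy data at an interior point. An
  eigenfunction is then encoded by a point (A, B) of the unit circle. The boundary conditions enter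
  the increasing quadratic forms as squares multiplied by n; these stay bounded only if they vanish,
  so square integrability and boundary conditions become one boundedness statement. As f vanishes
  off (c,d), the potentials for different values of the random coordinate agree near both endpoints,
  and the Wronskian of two eigenfunctions is constant on each side of (c,d).\<close>

lemma real_interval_eq_Inf_Sup:
  fixes K :: "real set"
  assumes "p tagged_division_of {s..t}" "(x, K) \<in> p"
  shows "K = {Inf K..Sup K}" "Inf K \<le> x" "x \<le> Sup K" "s \<le> Inf K" "Sup K \<le> t"
    "measure lborel K = Sup K - Inf K"
proof -
  from assms obtain l r where K: "K = cbox l r" "x \<in> K" "K \<subseteq> {s..t}"
    by (metis tagged_division_ofD(2,3,4))
  then have lr: "l \<le> r" by auto
  with K show "K = {Inf K..Sup K}" "Inf K \<le> x" "x \<le> Sup K" "s \<le> Inf K" "Sup K \<le> t"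
    "measure lborel K = Sup K - Inf K"
    by auto
qed

text \<open>The tag x lies between l and r, so the errors of the linear approximation on its two
  sides, e * (r - x) and e * (x - l), add up to e * (r - l).\<close>

lemma has_vector_derivative_straddle:
  fixes u :: "real \<Rightarrow> 'a::real_normed_vector"
  assumes "(u has_vector_derivative D) (at x within {s..t})" "e > 0"
  shows "\<exists>d>0. \<forall>l r. l \<in> {s..t} \<longrightarrow> r \<in> {s..t} \<longrightarrow> l \<le> x \<longrightarrow> x \<le> r \<longrightarrow> {l..r} \<subseteq> ball x d \<longrightarrow>
     norm ((r - l) *\<^sub>R D - (u r - u l)) \<le> e * (r - l)"
proof -
  from assms obtain d where d: "d > 0"
    and *: "\<And>y. y \<in> {s..t} \<Longrightarrow> norm (y - x) < d \<Longrightarrow> norm (u y - u x - (y - x) *\<^sub>R D) \<le> e * norm (y - x)"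
    unfolding has_vector_derivative_def has_derivative_within_alt by blast
  show ?thesis
  proof (intro exI[of _ d] conjI allI impI d)
    fix l r assume h: "l \<in> {s..t}" "r \<in> {s..t}" "l \<le> x" "x \<le> r" "{l..r} \<subseteq> ball x d"
    then have "l \<in> ball x d" "r \<in> ball x d" using atLeastAtMost_iff[of _ l r] by (meson order.trans order.refl subsetD)+
    then have "norm (u r - u x - (r - x) *\<^sub>R D) \<le> e * (r - x)"
       "norm (u l - u x - (l - x) *\<^sub>R D) \<le> e * (x - l)"
      using *[of r] *[of l] h by (auto simp: dist_real_def abs_minus_commute)
    moreover have "(r - l) *\<^sub>R D - (u r - u l) = (u l - u x - (l - x) *\<^sub>R D) - (u r - u x - (r - x) *\<^sub>R D)"
      by (simp add: algebra_simps)
    ultimately show "norm ((r - l) *\<^sub>R D - (u r - u l)) \<le> e * (r - l)"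
      using norm_triangle_ineq4[of "u l - u x - (l - x) *\<^sub>R D" "u r - u x - (r - x) *\<^sub>R D"]
      by (simp add: algebra_simps)
  qed
qed

text \<open>Turns the part of a tagged division with tags in a null set into a family to which
  \<open>abs_cont_on\<close> applies. Nonempty interiors prevent one interval from occurring with
  two tags, so nothing is lost when the tags are forgotten, and the total length is bounded by the
  measure of U.\<close>

lemma sum_content_fine_less:
  fixes U :: "real set"
  assumes "p tagged_division_of {s..t}" "p' \<subseteq> p" "\<And>x K. (x, K) \<in> p' \<Longrightarrow> K \<subseteq> U \<and> interior K \<noteq> {}"
    "open U" "emeasure lebesgue U < ennreal \<delta>" "\<delta> > 0"
  defines "P \<equiv> (\<lambda>(x, K). (Inf K, Sup K)) ` p'"
  shows "inj_on (\<lambda>(x, K). (Inf K, Sup K :: real)) p'" "disjoint_family_on (\<lambda>(x, y). {x<..<y}) P"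
    "(\<Sum>(x, y)\<in>P. y - x) < \<delta>"
proof -
  note pD = tagged_division_ofD[OF assms(1)]
  note K = real_interval_eq_Inf_Sup[OF assms(1)]
  have fin: "finite p'" using pD(1) assms(2) finite_subset by blast
  have int: "interior K = {Inf K<..<Sup K}" if "(x, K) \<in> p'" for x K
    using K(1)[of x K] that assms(2) by (metis interior_atLeastAtMost_real subsetD)
  show inj: "inj_on (\<lambda>(x, K). (Inf K, Sup K)) p'"
  proof (rule inj_onI, clarsimp)
    fix x1 K1 x2 K2 assume h: "(x1, K1) \<in> p'" "(x2, K2) \<in> p'" "Inf K1 = Inf K2" "Sup K1 = Sup K2"
    then have "K1 = K2" using K(1)[of x1 K1] K(1)[of x2 K2] assms(2) by (metis subsetD)
    moreover have "x1 = x2"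
    proof (rule ccontr)
      assume "x1 \<noteq> x2"
      then have "interior K1 \<inter> interior K2 = {}"
        using h assms(2) by (intro pD(5)[of x1 K1 x2 K2]) auto
      then show False using assms(3)[OF h(1)] \<open>K1 = K2\<close> by simp
    qed
    ultimately show "x1 = x2 \<and> K1 = K2" by simp
  qed
  show disj: "disjoint_family_on (\<lambda>(x, y). {x<..<y}) P"
  proof -
    have "{Inf K1<..<Sup K1} \<inter> {Inf K2<..<Sup K2} = {}"
      if "(x1, K1) \<in> p'" "(x2, K2) \<in> p'" "(Inf K1, Sup K1) \<noteq> (Inf K2, Sup K2)" for x1 K1 x2 K2
    proof -
      have "interior K1 \<inter> interior K2 = {}"
        using that assms(2) by (intro pD(5)[of x1 K1 x2 K2]) auto
      then show ?thesis using int that by simp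
    qed
    then show ?thesis unfolding disjoint_family_on_def P_def by (clarsimp simp: image_iff split: prod.splits)
  qed
  have le: "x \<le> y" "{x<..<y} \<subseteq> U" if "(x, y) \<in> P" for x y
  proof -
    from that obtain z K where "(z, K) \<in> p'" "x = Inf K" "y = Sup K" unfolding P_def by auto
    then have "x \<le> y \<and> {x<..<y} \<subseteq> U"
      using K(2,3)[of z K] assms(2) assms(3)[of z K] int[of z K] interior_subset[of K]
      by (auto intro: order_trans)
    then show "x \<le> y" "{x<..<y} \<subseteq> U" by auto
  qed
  have "(\<Sum>i\<in>P. emeasure lebesgue ((\<lambda>(x, y). {x<..<y}) i)) = emeasure lebesgue (\<Union>i\<in>P. (\<lambda>(x, y). {x<..<y}) i)"
    using fin disj unfolding P_def[symmetric] by (intro sum_emeasure) (auto simp: P_def)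
  also have "\<dots> \<le> emeasure lebesgue U"
    using le(2) assms(4) by (intro emeasure_mono) (auto intro!: lebesgue_openin)
  also have "(\<Sum>i\<in>P. emeasure lebesgue ((\<lambda>(x, y). {x<..<y}) i)) = (\<Sum>i\<in>P. ennreal ((\<lambda>(x, y). y - x) i))"
    using le(1) by (intro sum.cong) auto
  also have "\<dots> = ennreal (\<Sum>i\<in>P. ((\<lambda>(x, y). y - x) i))"
    using le(1) by (intro sum_ennreal) auto
  finally have "ennreal (\<Sum>i\<in>P. ((\<lambda>(x, y). y - x) i)) < ennreal \<delta>"
    using assms(5) by (rule order_le_less_trans)
  then show "(\<Sum>(x, y)\<in>P. y - x) < \<delta>"
    using assms(6) by (simp add: ennreal_less_iff[OF sum_nonneg] ennreal_less_iff not_le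
      flip: linorder_not_less) (meson ennreal_leI linorder_not_less)
qed

text \<open>A Henstock-Kurzweil argument: the gauge forces the straddle estimate at tags outside N,
  and at tags in N it forces the intervals into an open set whose measure is below the \<delta> of
  absolute continuity. Integrability of g is a result, not an assumption.\<close>

theorem abs_cont_FTC:
  fixes u :: "real \<Rightarrow> complex"
  assumes ac: "abs_cont_on s t u" and st: "s \<le> t" and N: "negligible N"
    and der: "\<And>x. x \<in> {s..t} - N \<Longrightarrow> (u has_vector_derivative g x) (at x within {s..t})"
  shows "(g has_integral u t - u s) {s..t}"
proof (cases "s = t")
  case True then show ?thesis by (simp add: has_integral_refl)
next
  case False
  with st have st: "s < t" by simp
  \<comment> \<open>With the integrand 0 on N, the terms with tags in N reduce to increments of u;
    the values on N are restored at the end, N being negligible.\<close>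
  define g' where "g' x = (if x \<in> N then 0 else g x)" for x
  have "(g' has_integral u t - u s) {s..t}"
    unfolding has_integral_real
  proof (intro allI impI)
    fix e :: real assume e: "e > 0"
    \<comment> \<open>Half of e is spent on the tags outside N, whose intervals have total length at
      most t - s, and the other half on the tags in N.\<close>
    define \<eta> where "\<eta> = e / (2 * (t - s))"
    have \<eta>: "\<eta> > 0" using e st by (simp add: \<eta>_def)
    obtain \<delta> where \<delta>: "\<delta> > 0" and ac': "\<And>P. finite P \<Longrightarrow> (\<And>x y. (x, y)\<in>P \<Longrightarrow> s \<le> x \<and> x \<le> y \<and> y \<le> t) \<Longrightarrow>
        disjoint_family_on (\<lambda>(x, y). {x<..<y}) P \<Longrightarrow> (\<Sum>(x, y)\<in>P. y - x) < \<delta>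
        \<Longrightarrow> (\<Sum>(x, y)\<in>P. norm (u y - u x)) < e/2"
    proof -
      from ac[unfolded abs_cont_on_def, rule_format, of "e/2"] e obtain \<delta> where \<delta>: "\<delta> > 0"
        "\<forall>P. finite P \<and> (\<forall>(x, y)\<in>P. s \<le> x \<and> x \<le> y \<and> y \<le> t) \<and>
        disjoint_family_on (\<lambda>(x, y). {x<..<y}) P \<and> (\<Sum>(x, y)\<in>P. y - x) < \<delta>
        \<longrightarrow> (\<Sum>(x, y)\<in>P. norm (u y - u x)) < e/2" by auto
      show ?thesis
        by (rule that[OF \<delta>(1)], rule \<delta>(2)[rule_format]) auto
    qed
    obtain U where U: "open U" "N \<subseteq> U" "emeasure lebesgue U < ennreal \<delta>"
    proof -
      obtain T where T: "open T" "N \<subseteq> T" "(T - N) \<in> lmeasurable" "emeasure lebesgue (T - N) < ennreal \<delta>"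
        using sets_lebesgue_outer_open[of N \<delta>] N \<delta> negligible_imp_sets by blast
      have "N \<in> null_sets lebesgue" using N negligible_iff_null_sets by blast
      then have "emeasure lebesgue T = emeasure lebesgue (T - N)"
        using T by (metis emeasure_Diff_null_set lebesgue_openin openin_subtopology_self sets_completionI_sets sets_lborel borel_open)
      then show ?thesis using T that by auto
    qed
    have "\<forall>x. \<exists>d>0. x \<in> {s..t} - N \<longrightarrow> (\<forall>l r. l \<in> {s..t} \<longrightarrow> r \<in> {s..t} \<longrightarrow> l \<le> x \<longrightarrow> x \<le> r \<longrightarrow> {l..r} \<subseteq> ball x d \<longrightarrow>
       norm ((r - l) *\<^sub>R g x - (u r - u l)) \<le> \<eta> * (r - l))"
      using has_vector_derivative_straddle[OF der \<eta>] zero_less_one by blast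
    then obtain d where d: "\<And>x. d x > 0" and dd: "\<And>x l r. x \<in> {s..t} - N \<Longrightarrow> l \<in> {s..t} \<Longrightarrow> r \<in> {s..t} \<Longrightarrow> l \<le> x \<Longrightarrow> x \<le> r \<Longrightarrow> {l..r} \<subseteq> ball x (d x) \<Longrightarrow>
       norm ((r - l) *\<^sub>R g x - (u r - u l)) \<le> \<eta> * (r - l)" by metis
    define \<gamma> where "\<gamma> x = (if x \<in> N then U else ball x (d x))" for x
    have "gauge \<gamma>" unfolding gauge_def \<gamma>_def using U d by auto
    moreover have "norm ((\<Sum>(x, K)\<in>p. measure lborel K *\<^sub>R g' x) - (u t - u s)) < e"
      if p: "p tagged_division_of {s..t}" and fine: "\<gamma> fine p" for p
    proof -
      note pD = tagged_division_ofD[OF p]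
      note K = real_interval_eq_Inf_Sup[OF p]
      define h where "h = (\<lambda>(x, K). measure lborel K *\<^sub>R g' x - (u (Sup K) - u (Inf K)))"
      \<comment> \<open>Degenerate intervals contribute 0 and are left to the other sum, so that
        \<open>p1\<close> meets the nondegeneracy condition of
        \<open>sum_content_fine_less\<close>.\<close>
      define p1 where "p1 = {(x, K) \<in> p. x \<in> N \<and> interior K \<noteq> {}}"
      have p1: "p1 \<subseteq> p" "finite p1" "finite p" using pD(1) by (auto simp: p1_def intro: finite_subset[OF _ pD(1)])
      have sub: "K \<subseteq> \<gamma> x" if "(x, K) \<in> p" for x K using fine that by (auto simp: fine_def)
      have "(\<Sum>(x, K)\<in>p. measure lborel K *\<^sub>R g' x) - (u t - u s) = sum h p"
        using additive_tagged_division_1[OF less_imp_le[OF st] p, of u]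
        by (simp add: h_def case_prod_unfold sum_subtractf)
      also have "norm \<dots> \<le> (\<Sum>z\<in>p. norm (h z))" by (rule norm_sum)
      also have "\<dots> = (\<Sum>z\<in>p1. norm (h z)) + (\<Sum>z\<in>p - p1. norm (h z))"
        using p1 by (simp add: sum.subset_diff)
      also have "(\<Sum>z\<in>p - p1. norm (h z)) \<le> (\<Sum>(x, K)\<in>p - p1. \<eta> * measure lborel K)"
      proof (rule sum_mono, clarsimp simp: h_def)
        fix x K assume xK: "(x, K) \<in> p" "(x, K) \<notin> p1"
        note KK = K[OF xK(1)]
        show "norm (measure lborel K *\<^sub>R g' x - (u (Sup K) - u (Inf K))) \<le> \<eta> * measure lborel K"
        proof (cases "x \<in> N")
          case True
          then have "interior K = {}" using xK by (auto simp: p1_def)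
          then have "Sup K = Inf K" using KK(1,2,3)
            by (metis antisym interior_atLeastAtMost_real greaterThanLessThan_empty_iff order_trans)
          then show ?thesis using KK(6) by simp
        next
          case False
          have "{Inf K..Sup K} \<subseteq> ball x (d x)" using sub[OF xK(1)] False KK(1) by (simp add: \<gamma>_def)
          then show ?thesis using dd[of x "Inf K" "Sup K"] False KK g'_def by auto
        qed
      qed
      also have "\<dots> \<le> (\<Sum>(x, K)\<in>p. \<eta> * measure lborel K)"
        using p1 \<eta> by (intro sum_mono2) auto
      also have "\<dots> = \<eta> * (t - s)"
        using additive_content_tagged_division[of p s t] p st by (simp add: sum_distrib_left[symmetric] case_prod_unfold)
      also have "\<dots> = e / 2" using st by (simp add: \<eta>_def field_simps)
      also have "(\<Sum>z\<in>p1. norm (h z)) < e / 2"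
      proof -
        define P where "P = (\<lambda>(x, K). (Inf K, Sup K)) ` p1"
        have "K \<subseteq> U \<and> interior K \<noteq> {}" if "(x, K) \<in> p1" for x K
          using sub[of x K] that by (auto simp: p1_def \<gamma>_def)
        note S = sum_content_fine_less[OF p p1(1) this U(1,3) \<delta>, folded P_def]
        have "(\<Sum>z\<in>p1. norm (h z)) = (\<Sum>(x, K)\<in>p1. norm (u (Sup K) - u (Inf K)))"
          by (intro sum.cong) (auto simp: h_def p1_def g'_def norm_minus_commute)
        also have "\<dots> = (\<Sum>(x, y)\<in>P. norm (u y - u x))"
          unfolding P_def by (subst sum.reindex) (use S(1) in \<open>auto simp: case_prod_unfold\<close>)
        also have "\<dots> < e / 2"
        proof (rule ac')
          show "finite P" using p1 by (simp add: P_def)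
          show "s \<le> x \<and> x \<le> y \<and> y \<le> t" if "(x, y) \<in> P" for x y
            using that K p1(1) unfolding P_def by clarsimp (meson order_trans subsetD)
        qed (use S in auto)
        finally show ?thesis .
      qed
      finally show ?thesis by simp
    qed
    ultimately show "\<exists>\<gamma>. gauge \<gamma> \<and> (\<forall>\<D>. \<D> tagged_division_of {s..t} \<and> \<gamma> fine \<D> \<longrightarrow>
        norm ((\<Sum>(x, K)\<in>\<D>. measure lborel K *\<^sub>R g' x) - (u t - u s)) < e)" by (intro exI[of _ \<gamma>] conjI allI impI) (auto simp del: has_integral_real)
  qed
  then show ?thesis
    by (rule has_integral_spike[OF N, rotated]) (simp add: g'_def)
qed

section \<open>Absolute continuity and almost everywhere differentiability of indefinite
  integrals\<close>

text \<open>Truncating the norm of h at a height n changes the integral by less than e/2, and the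
  truncated function contributes at most n times the measure of the set.\<close>

lemma integrable_small_on_small_sets:
  fixes h :: "'a \<Rightarrow> 'b::{banach, second_countable_topology}"
  assumes h: "integrable M h" and e: "e > 0"
  obtains \<delta> where "\<delta> > 0"
    "\<And>A. A \<in> sets M \<Longrightarrow> emeasure M A < ennreal \<delta> \<Longrightarrow> (LINT x:A|M. norm (h x)) < e"
proof -
  have [measurable]: "h \<in> borel_measurable M" using h by auto
  have "(\<lambda>n. LINT x|M. min (norm (h x)) (real n)) \<longlonglongrightarrow> (LINT x|M. norm (h x))"
  proof (rule integral_dominated_convergence[where w="\<lambda>x. norm (h x)"])
    show "AE x in M. (\<lambda>n. min (norm (h x)) (real n)) \<longlonglongrightarrow> norm (h x)"
    proof (intro AE_I2 tendsto_eventually)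
      fix x
      obtain N where "norm (h x) \<le> real N" using real_arch_simple by blast
      then show "\<forall>\<^sub>F n in sequentially. min (norm (h x)) (real n) = norm (h x)"
        by (auto simp: eventually_sequentially intro!: exI[of _ N])
    qed
  qed (use h in auto)
  then have "\<forall>\<^sub>F n in sequentially. dist (LINT x|M. min (norm (h x)) (real n)) (LINT x|M. norm (h x)) < e / 2"
    using e unfolding tendsto_iff by (meson half_gt_zero)
  then obtain n where n: "dist (LINT x|M. min (norm (h x)) (real n)) (LINT x|M. norm (h x)) < e / 2"
    by (auto simp: eventually_sequentially)
  have im: "integrable M (\<lambda>x. min (norm (h x)) (real n))"
    by (rule Bochner_Integration.integrable_bound[OF h]) auto
  show ?thesis
  \<comment> \<open>The summand 1 keeps the bound positive when n = 0.\<close>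
  proof (rule that[of "e / (2 * (real n + 1))"])
    show "e / (2 * (real n + 1)) > 0" using e by simp
    fix A assume A: "A \<in> sets M" "emeasure M A < ennreal (e / (2 * (real n + 1)))"
    have fA: "emeasure M A < \<infinity>" using order_less_trans[OF A(2) ennreal_less_top] by simp
    then have iA: "integrable M (indicat_real A)" using A by (intro integrable_real_indicator)
    have "emeasure M A = ennreal (measure M A)" using fA by (intro emeasure_eq_ennreal_measure) auto
    then have "measure M A \<le> e / (2 * (real n + 1))"
      using A e by (simp add: ennreal_less_iff)
    then have "real n * measure M A \<le> real n * (e / (2 * (real n + 1)))"
      by (rule mult_left_mono) simp
    also have "\<dots> \<le> e / 2" using e by (simp add: field_simps)
    finally have mA: "real n * measure M A \<le> e / 2" .
    have "(LINT x:A|M. norm (h x)) = (LINT x|M. indicator A x * norm (h x))"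
      by (simp add: set_lebesgue_integral_def)
    also have "\<dots> \<le> (LINT x|M. (norm (h x) - min (norm (h x)) (real n)) + real n * indicator A x)"
    proof (rule integral_mono)
      show "integrable M (\<lambda>x. indicat_real A x * norm (h x))"
        using integrable_mult_indicator[OF A(1) integrable_norm[OF h]] by simp
      show "integrable M (\<lambda>x. (norm (h x) - min (norm (h x)) (real n)) + real n * indicator A x)"
        using h im iA by (intro Bochner_Integration.integrable_add Bochner_Integration.integrable_diff
           integrable_mult_right integrable_norm)
    qed (auto simp: indicator_def)
    also have "\<dots> = (LINT x|M. norm (h x)) - (LINT x|M. min (norm (h x)) (real n)) + real n * measure M A"
      using h im iA A by simp
    also have "\<dots> < e" using n mA unfolding dist_real_def by linarith
    finally show "(LINT x:A|M. norm (h x)) < e" .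
  qed
qed

text \<open>Converse of \<open>abs_cont_FTC\<close>: the increments over disjoint intervals are
  bounded by the integral of the norm of h over their union, which is small with the total
  length.\<close>

lemma abs_cont_on_indefinite_integral:
  fixes u h :: "real \<Rightarrow> complex"
  assumes h: "h absolutely_integrable_on {s..t}"
    and u: "\<And>x y. s \<le> x \<Longrightarrow> x \<le> y \<Longrightarrow> y \<le> t \<Longrightarrow> (h has_integral u y - u x) {x..y}"
  shows "abs_cont_on s t u"
  unfolding abs_cont_on_def
proof (intro allI impI)
  fix e :: real assume e: "e > 0"
  define g where "g x = indicator {s..t} x *\<^sub>R h x" for x
  have g: "integrable lebesgue g" using h by (simp add: g_def[abs_def] set_integrable_def)
  obtain \<delta> where \<delta>: "\<delta> > 0"
    "\<And>A. A \<in> sets lebesgue \<Longrightarrow> emeasure lebesgue A < ennreal \<delta> \<Longrightarrow> (LINT x:A|lebesgue. norm (g x)) < e"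
    using integrable_small_on_small_sets[OF g e] by blast
  show "\<exists>\<delta>>0. \<forall>P. finite P \<and> (\<forall>(x, y)\<in>P. s \<le> x \<and> x \<le> y \<and> y \<le> t) \<and>
        disjoint_family_on (\<lambda>(x, y). {x<..<y}) P \<and> (\<Sum>(x, y)\<in>P. y - x) < \<delta>
        \<longrightarrow> (\<Sum>(x, y)\<in>P. norm (u y - u x)) < e"
  proof (intro exI[of _ \<delta>] conjI allI impI \<delta>(1), elim conjE)
    fix P :: "(real \<times> real) set"
    assume P: "finite P" "\<forall>(x, y)\<in>P. s \<le> x \<and> x \<le> y \<and> y \<le> t"
       "disjoint_family_on (\<lambda>(x, y). {x<..<y}) P" "(\<Sum>(x, y)\<in>P. y - x) < \<delta>"
    define A where "A = (\<Union>i\<in>P. (\<lambda>(x, y). {x<..<y}) i)"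
    have A: "A \<in> sets lebesgue" unfolding A_def using P(1) by (auto intro!: sets.finite_UN)
    have "emeasure lebesgue A = (\<Sum>i\<in>P. emeasure lebesgue ((\<lambda>(x, y). {x<..<y}) i))"
      unfolding A_def using P by (intro sum_emeasure[symmetric]) auto
    also have "\<dots> = (\<Sum>i\<in>P. ennreal ((\<lambda>(x, y). y - x) i))"
      using P(2) by (intro sum.cong) auto
    also have "\<dots> = ennreal (\<Sum>i\<in>P. ((\<lambda>(x, y). y - x) i))"
      using P(2) by (intro sum_ennreal) auto
    finally have "emeasure lebesgue A < ennreal \<delta>" using P(4) \<delta>(1) by (simp add: ennreal_lessI)
    from \<delta>(2)[OF A this] have *: "(LINT x:A|lebesgue. norm (g x)) < e" .
    have gi: "set_integrable lebesgue B (\<lambda>x. norm (g x))" if "B \<in> sets lebesgue" for B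
      using integrable_norm[OF g] that unfolding set_integrable_def by (rule integrable_mult_indicator[rotated])
    have "(\<Sum>(x, y)\<in>P. norm (u y - u x)) \<le> (\<Sum>i\<in>P. (LINT z:(\<lambda>(x, y). {x<..<y}) i|lebesgue. norm (g z)))"
    proof (rule sum_mono)
      fix i assume i: "i \<in> P"
      obtain x y where ixy: "i = (x, y)" by (cases i)
      then have xy: "s \<le> x" "x \<le> y" "y \<le> t" using P(2) i by auto
      have ig: "g absolutely_integrable_on {x<..<y}"
        using g unfolding set_integrable_def by (intro integrable_mult_indicator) auto
      have "(h has_integral u y - u x) {x<..<y}"
        using u[OF xy] by (simp add: has_integral_Icc_iff_Ioo)
      then have "(g has_integral u y - u x) {x<..<y}"
        by (rule has_integral_eq[rotated]) (use xy in \<open>auto simp: g_def\<close>)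
      then have "u y - u x = (LINT z:{x<..<y}|lebesgue. g z)"
        using ig by (simp add: set_lebesgue_integral_eq_integral(2) integral_unique)
      also have "norm \<dots> \<le> (LINT z:{x<..<y}|lebesgue. norm (g z))"
        using ig by (rule set_integral_norm_bound)
      finally show "(case i of (x, y) \<Rightarrow> norm (u y - u x)) \<le> (LINT z:(\<lambda>(x, y). {x<..<y}) i|lebesgue. norm (g z))"
        by (simp add: ixy)
    qed
    also have "\<dots> = (LINT z:A|lebesgue. norm (g z))"
      unfolding A_def using P(1,3) gi
      by (intro set_integral_finite_Union[symmetric])
        (auto simp: disjoint_family_on_def pairwise_def disjnt_def split: prod.splits)
    finally show "(\<Sum>(x, y)\<in>P. norm (u y - u x)) < e" using * by simp
  qed
qed

text \<open>\<open>integrable_ccontinuous_explicit\<close> controls difference quotients to the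
  right; applied to the reflected function it controls those to the left. The exceptional set is
  therefore N1 together with the reflection of N2, and it is independent of the starting point
  s.\<close>

lemma AE_derivative_indefinite_integral:
  fixes f :: "real \<Rightarrow> 'b::euclidean_space"
  assumes f: "\<And>a b. f integrable_on {a..b}"
  obtains N where "negligible N"
    "\<And>s x. x \<notin> N \<Longrightarrow> s < x \<Longrightarrow> ((\<lambda>y. integral {s..y} f) has_vector_derivative f x) (at x)"
proof -
  have fr: "(\<lambda>x. f (- x)) integrable_on {a..b}" for a b
    using f[of "- b" "- a"] Henstock_Kurzweil_Integration.integrable_reflect_real[of f "- a" "- b"] by simp
  obtain N1 where N1: "negligible N1" and right: "\<And>x e. \<lbrakk>x \<notin> N1; 0 < e\<rbrakk> \<Longrightarrow>
      \<exists>d>0. \<forall>h. 0 < h \<and> h < d \<longrightarrow> norm (integral {x..x + h} f /\<^sub>R h - f x) < e"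
    using integrable_ccontinuous_explicit[of f] f by (auto simp: cbox_interval)
  obtain N2 where N2: "negligible N2" and left: "\<And>x e. \<lbrakk>x \<notin> N2; 0 < e\<rbrakk> \<Longrightarrow>
      \<exists>d>0. \<forall>h. 0 < h \<and> h < d \<longrightarrow> norm (integral {x..x + h} (\<lambda>y. f (- y)) /\<^sub>R h - f (- x)) < e"
    using integrable_ccontinuous_explicit[of "\<lambda>x. f (- x)"] fr by (auto simp: cbox_interval)
  have scale: "norm (I - h *\<^sub>R D) \<le> e * h" if "norm (I /\<^sub>R h - D) < e" "h > 0" for I D :: 'b and h e :: real
  proof -
    have "I - h *\<^sub>R D = h *\<^sub>R (I /\<^sub>R h - D)" using that by (simp add: algebra_simps)
    then have "norm (I - h *\<^sub>R D) = h * norm (I /\<^sub>R h - D)" using that by simp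
    then show ?thesis using that by (simp add: mult.commute)
  qed
  show ?thesis
  proof (rule that[of "N1 \<union> uminus ` N2"])
    have "negligible (uminus ` N2)"
      using N2 by (intro negligible_differentiable_image_negligible) (auto intro!: derivative_intros differentiable_at_imp_differentiable_on)
    then show "negligible (N1 \<union> uminus ` N2)" using N1 by simp
    fix s x assume x: "x \<notin> N1 \<union> uminus ` N2" "s < x"
    then have x1: "x \<notin> N1" and x2: "- x \<notin> N2" by (auto simp: image_iff)
    show "((\<lambda>y. integral {s..y} f) has_vector_derivative f x) (at x)"
      unfolding has_vector_derivative_def has_derivative_at_alt
    proof (intro conjI allI impI)
      show "bounded_linear (\<lambda>h. h *\<^sub>R f x)" by (rule bounded_linear_scaleR_left)
      fix e :: real assume e: "e > 0"
      obtain d1 where d1: "d1 > 0" "\<And>h. 0 < h \<Longrightarrow> h < d1 \<Longrightarrow> norm (integral {x..x + h} f /\<^sub>R h - f x) < e"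
        using right[OF x1 e] by blast
      obtain d2 where d2: "d2 > 0" "\<And>h. 0 < h \<Longrightarrow> h < d2 \<Longrightarrow> norm (integral {-x..-x + h} (\<lambda>y. f (- y)) /\<^sub>R h - f (- (- x))) < e"
        using left[OF x2 e] by blast
      show "\<exists>d>0. \<forall>y. norm (y - x) < d \<longrightarrow> norm (integral {s..y} f - integral {s..x} f - (y - x) *\<^sub>R f x) \<le> e * norm (y - x)"
      proof (intro exI[of _ "min (x - s) (min d1 d2)"] conjI allI impI)
        show "min (x - s) (min d1 d2) > 0" using d1 d2 x by simp
        fix y assume y: "norm (y - x) < min (x - s) (min d1 d2)"
        consider "y = x" | "y > x" | "y < x" by linarith
        then show "norm (integral {s..y} f - integral {s..x} f - (y - x) *\<^sub>R f x) \<le> e * norm (y - x)"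
        proof cases
          case 2
          have "integral {s..y} f - integral {s..x} f = integral {x..x + (y - x)} f"
            using Henstock_Kurzweil_Integration.integral_combine[of s x y f] f x 2 by (simp add: algebra_simps)
          then show ?thesis using scale[OF d1(2)[of "y - x"]] 2 y by simp
        next
          case 3
          have "integral {s..x} f - integral {s..y} f = integral {y..x} f"
            using Henstock_Kurzweil_Integration.integral_combine[of s y x f] f y 3 by (simp add: algebra_simps)
          moreover have "integral {y..x} f = integral {-x..-x + (x - y)} (\<lambda>y. f (- y))"
            using Henstock_Kurzweil_Integration.integral_reflect_real[of x y "\<lambda>y. f (- y)"]
            by (simp add: Henstock_Kurzweil_Integration.integral_reflect_real)
          moreover have "norm (integral {-x..-x + (x - y)} (\<lambda>y. f (- y)) - (x - y) *\<^sub>R f x) \<le> e * (x - y)"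
            using scale[OF d2(2)[of "x - y"]] 3 y by simp
          moreover have "norm (integral {s..y} f - integral {s..x} f - (y - x) *\<^sub>R f x) =
              norm (integral {s..x} f - integral {s..y} f - (x - y) *\<^sub>R f x)"
            by (subst norm_minus_cancel[symmetric]) (simp add: algebra_simps)
          moreover have "norm (y - x) = x - y" using 3 by simp
          ultimately show ?thesis by presburger
        qed simp
      qed
    qed
  qed
qed

section \<open>Integration by parts for indefinite integrals\<close>

lemma abs_cont_on_mult:
  assumes F: "abs_cont_on s t F" and G: "abs_cont_on s t G"
    and M: "\<And>x. x \<in> {s..t} \<Longrightarrow> norm (F x) \<le> M" "\<And>x. x \<in> {s..t} \<Longrightarrow> norm (G x) \<le> M"
  shows "abs_cont_on s t (\<lambda>x. F x * G x)"
  unfolding abs_cont_on_def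
proof (intro allI impI)
  fix e :: real assume e: "e > 0"
  \<comment> \<open>M may be 0, for instance for zero functions; the maximum with 1 allows
    division.\<close>
  define M' where "M' = max M 1"
  have M': "M' > 0" by (simp add: M'_def)
  have e': "e / (2 * M') > 0" using e M' by simp
  let ?Q = "\<lambda>P \<delta>. finite P \<and> (\<forall>(x, y)\<in>P. s \<le> x \<and> x \<le> y \<and> y \<le> t) \<and>
        disjoint_family_on (\<lambda>(x, y). {x<..<y}) P \<and> (\<Sum>(x, y)\<in>P. y - x) < \<delta>"
  obtain \<delta>1 where \<delta>1: "\<delta>1 > 0" "\<And>P. ?Q P \<delta>1 \<Longrightarrow> (\<Sum>(x, y)\<in>P. norm (F y - F x)) < e / (2 * M')"
    using F[unfolded abs_cont_on_def, rule_format, OF e'] by blast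
  obtain \<delta>2 where \<delta>2: "\<delta>2 > 0" "\<And>P. ?Q P \<delta>2 \<Longrightarrow> (\<Sum>(x, y)\<in>P. norm (G y - G x)) < e / (2 * M')"
    using G[unfolded abs_cont_on_def, rule_format, OF e'] by blast
  show "\<exists>\<delta>>0. \<forall>P. ?Q P \<delta> \<longrightarrow> (\<Sum>(x, y)\<in>P. norm (F y * G y - F x * G x)) < e"
  proof (intro exI[of _ "min \<delta>1 \<delta>2"] conjI allI impI)
    show "min \<delta>1 \<delta>2 > 0" using \<delta>1 \<delta>2 by simp
    fix P assume P: "?Q P (min \<delta>1 \<delta>2)"
    have "(\<Sum>(x, y)\<in>P. norm (F y * G y - F x * G x)) \<le> (\<Sum>(x, y)\<in>P. M' * norm (F y - F x) + M' * norm (G y - G x))"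
    proof (rule sum_mono)
      fix i assume i: "i \<in> P"
      obtain x y where ixy: "i = (x, y)" by (cases i)
      then have xy: "x \<in> {s..t}" "y \<in> {s..t}" using P i by auto
      have "norm (F y * G y - F x * G x) = norm (G y * (F y - F x) + F x * (G y - G x))"
        by (simp add: algebra_simps)
      also have "\<dots> \<le> norm (G y) * norm (F y - F x) + norm (F x) * norm (G y - G x)"
        by (metis norm_triangle_ineq norm_mult)
      also have "\<dots> \<le> M' * norm (F y - F x) + M' * norm (G y - G x)"
        using M(1)[OF xy(1)] M(2)[OF xy(2)] by (intro add_mono mult_right_mono) (auto simp: M'_def)
      finally show "(case i of (x, y) \<Rightarrow> norm (F y * G y - F x * G x)) \<le>
          (case i of (x, y) \<Rightarrow> M' * norm (F y - F x) + M' * norm (G y - G x))" by (simp add: ixy)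
    qed
    also have "\<dots> = M' * (\<Sum>(x, y)\<in>P. norm (F y - F x)) + M' * (\<Sum>(x, y)\<in>P. norm (G y - G x))"
      by (simp add: sum.distrib sum_distrib_left case_prod_unfold)
    also have "\<dots> < M' * (e / (2 * M')) + M' * (e / (2 * M'))"
      using \<delta>1(2)[of P] \<delta>2(2)[of P] P M' by (intro add_strict_mono mult_strict_left_mono) auto
    also have "\<dots> = e" using M' by (simp add: field_simps)
    finally show "(\<Sum>(x, y)\<in>P. norm (F y * G y - F x * G x)) < e" .
  qed
qed

lemma indefinite_integral_continuous_on:
  fixes F f :: "real \<Rightarrow> 'b::euclidean_space"
  assumes F: "\<And>x y. s \<le> x \<Longrightarrow> x \<le> y \<Longrightarrow> y \<le> t \<Longrightarrow> (f has_integral F y - F x) {x..y}"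
  shows "continuous_on {s..t} F"
proof (cases "s \<le> t")
  case True
  have "f integrable_on {s..t}" using F[OF order_refl True order_refl] by blast
  then have "continuous_on {s..t} (\<lambda>y. F s + integral {s..y} f)"
    by (intro continuous_intros indefinite_integral_continuous_1)
  moreover have "F s + integral {s..y} f = F y" if "y \<in> {s..t}" for y
    using integral_unique[OF F[of s y]] that by simp
  ultimately show ?thesis by (rule continuous_on_eq)
qed simp

lemma indefinite_integral_derivative:
  fixes F f :: "real \<Rightarrow> 'b::euclidean_space"
  assumes F: "\<And>x y. s \<le> x \<Longrightarrow> x \<le> y \<Longrightarrow> y \<le> t \<Longrightarrow> (f has_integral F y - F x) {x..y}"
  obtains N where "negligible N" "\<And>x. x \<in> {s..t} - N \<Longrightarrow> (F has_vector_derivative f x) (at x)"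
proof (cases "s \<le> t")
  case True
  define f' where "f' x = (if x \<in> {s..t} then f x else 0)" for x
  have "f integrable_on {s..t}" using F[OF order_refl True order_refl] by blast
  then have "f' integrable_on UNIV" unfolding f'_def by (subst integrable_restrict_UNIV)
  then have "f' integrable_on {a..b}" for a b
    using integrable_on_subcbox[of f' UNIV a b] by (simp add: cbox_interval)
  from AE_derivative_indefinite_integral[OF this] obtain N where N: "negligible N"
    "\<And>s x. x \<notin> N \<Longrightarrow> s < x \<Longrightarrow> ((\<lambda>y. integral {s..y} f') has_vector_derivative f' x) (at x)" by blast
  show ?thesis
  proof (rule that[of "N \<union> {s, t}"])
    show "negligible (N \<union> {s, t})" using N by simp
    fix x assume x: "x \<in> {s..t} - (N \<union> {s, t})"
    have "((\<lambda>y. F s + integral {s..y} f') has_vector_derivative 0 + f' x) (at x)"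
      using N(2)[of x s] x by (intro has_vector_derivative_add has_vector_derivative_const) auto
    moreover have "F s + integral {s..y} f' = F y" if "y \<in> {s<..<t}" for y
    proof -
      have "integral {s..y} f' = integral {s..y} f"
        by (rule Henstock_Kurzweil_Integration.integral_cong) (use that in \<open>auto simp: f'_def\<close>)
      then show ?thesis using integral_unique[OF F[of s y]] that by simp
    qed
    ultimately have "(F has_vector_derivative 0 + f' x) (at x)"
      using x by (elim has_vector_derivative_transform_within_open[where S="{s<..<t}"]) auto
    then show "(F has_vector_derivative f x) (at x)" using x by (simp add: f'_def)
  qed
qed (use that[of "{}"] in auto)

text \<open>F and G are differentiable only almost everywhere. The product rule off a null set still
  suffices, because F * G is absolutely continuous and \<open>abs_cont_FTC\<close> applies to
  it.\<close>

theorem indefinite_integral_by_parts: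
  fixes f g F G :: "real \<Rightarrow> complex"
  assumes st: "s \<le> t"
    and f: "f absolutely_integrable_on {s..t}" and g: "g absolutely_integrable_on {s..t}"
    and F: "\<And>x y. s \<le> x \<Longrightarrow> x \<le> y \<Longrightarrow> y \<le> t \<Longrightarrow> (f has_integral F y - F x) {x..y}"
    and G: "\<And>x y. s \<le> x \<Longrightarrow> x \<le> y \<Longrightarrow> y \<le> t \<Longrightarrow> (g has_integral G y - G x) {x..y}"
  shows "((\<lambda>x. F x * g x + f x * G x) has_integral F t * G t - F s * G s) {s..t}"
proof -
  have "compact (F ` {s..t} \<union> G ` {s..t})"
    using indefinite_integral_continuous_on[of s t f F] indefinite_integral_continuous_on[of s t g G] F G
    by (intro compact_Un compact_continuous_image) auto
  then obtain M where M: "\<And>z. z \<in> F ` {s..t} \<union> G ` {s..t} \<Longrightarrow> norm z \<le> M"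
    using compact_imp_bounded bounded_iff by metis
  obtain N1 where N1: "negligible N1" "\<And>x. x \<in> {s..t} - N1 \<Longrightarrow> (F has_vector_derivative f x) (at x)"
    using indefinite_integral_derivative[of s t f F] F by blast
  obtain N2 where N2: "negligible N2" "\<And>x. x \<in> {s..t} - N2 \<Longrightarrow> (G has_vector_derivative g x) (at x)"
    using indefinite_integral_derivative[of s t g G] G by blast
  show ?thesis
  proof (rule abs_cont_FTC[where N="N1 \<union> N2" and u="\<lambda>x. F x * G x"])
    show "abs_cont_on s t (\<lambda>x. F x * G x)"
    proof (rule abs_cont_on_mult[where M=M])
      show "abs_cont_on s t F" by (rule abs_cont_on_indefinite_integral[OF f F])
      show "abs_cont_on s t G" by (rule abs_cont_on_indefinite_integral[OF g G])
      show "norm (F x) \<le> M" "norm (G x) \<le> M" if "x \<in> {s..t}" for x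
        using that by (auto intro!: M)
    qed
    show "((\<lambda>x. F x * G x) has_vector_derivative F x * g x + f x * G x) (at x within {s..t})"
      if "x \<in> {s..t} - (N1 \<union> N2)" for x
    proof (rule has_vector_derivative_mult)
      show "(F has_vector_derivative f x) (at x within {s..t})" "(G has_vector_derivative g x) (at x within {s..t})"
        using that N1(2)[of x] N2(2)[of x] has_vector_derivative_at_within by blast+
    qed
  qed (use st N1 N2 in auto)
qed

lemma has_integral_complex_of_real:
  "(h has_integral c) A \<Longrightarrow> ((\<lambda>x. complex_of_real (h x)) has_integral complex_of_real c) A"
  using has_integral_linear[OF _ bounded_linear_of_real[where 'a=complex], of h c A] by (simp add: o_def)

lemma absolutely_integrable_complex_of_real:
  "h absolutely_integrable_on A \<Longrightarrow> (\<lambda>x. complex_of_real (h x)) absolutely_integrable_on A"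
  by (drule absolutely_integrable_linear[OF _ bounded_linear_of_real[where 'a=complex]]) (simp add: o_def)

text \<open>Deduced from the complex version by embedding and taking real parts, because
  \<open>abs_cont_on\<close> speaks of complex functions.\<close>

corollary indefinite_integral_by_parts_real:
  fixes f g F G :: "real \<Rightarrow> real"
  assumes st: "s \<le> t"
    and f: "f absolutely_integrable_on {s..t}" and g: "g absolutely_integrable_on {s..t}"
    and F: "\<And>x y. s \<le> x \<Longrightarrow> x \<le> y \<Longrightarrow> y \<le> t \<Longrightarrow> (f has_integral F y - F x) {x..y}"
    and G: "\<And>x y. s \<le> x \<Longrightarrow> x \<le> y \<Longrightarrow> y \<le> t \<Longrightarrow> (g has_integral G y - G x) {x..y}"
  shows "((\<lambda>x. F x * g x + f x * G x) has_integral F t * G t - F s * G s) {s..t}"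
proof -
  have lift: "((\<lambda>x. complex_of_real (h x)) has_integral complex_of_real c - complex_of_real d) A"
    if "(h has_integral c - d) A" for h c d A
    using has_integral_complex_of_real[OF that] by simp
  have "((\<lambda>x. of_real (F x) * of_real (g x) + of_real (f x) * of_real (G x)) has_integral
       complex_of_real (F t) * of_real (G t) - of_real (F s) * of_real (G s)) {s..t}"
    by (intro indefinite_integral_by_parts st absolutely_integrable_complex_of_real f g lift F G)
  then have "((\<lambda>x. complex_of_real (F x * g x + f x * G x)) has_integral complex_of_real (F t * G t - F s * G s)) {s..t}"
    by simp
  from has_integral_linear[OF this bounded_linear_Re] show ?thesis by (simp add: o_def)
qed

section \<open>Weak solutions of \<open>u'' = k u\<close>\<close>

definition loc_int :: "real set \<Rightarrow> (real \<Rightarrow> real) \<Rightarrow> bool" where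
  "loc_int S k \<longleftrightarrow> (\<forall>s t. {s..t} \<subseteq> S \<longrightarrow> k absolutely_integrable_on {s..t})"

text \<open>The system (u, u')' = (u', k u) in integrated form. Only compact subintervals of S
  enter, so S may include its endpoints, and u' need not be differentiable at any given
  point.\<close>

definition weak_sol :: "real set \<Rightarrow> (real \<Rightarrow> real) \<Rightarrow> (real \<Rightarrow> real) \<Rightarrow> (real \<Rightarrow> real) \<Rightarrow> bool" where
  "weak_sol S k u u' \<longleftrightarrow> (\<forall>s t. s \<le> t \<longrightarrow> {s..t} \<subseteq> S \<longrightarrow>
     (u' has_integral u t - u s) {s..t} \<and> ((\<lambda>x. k x * u x) has_integral u' t - u' s) {s..t})"

definition wronskian :: "(real \<Rightarrow> real) \<Rightarrow> (real \<Rightarrow> real) \<Rightarrow> (real \<Rightarrow> real) \<Rightarrow> (real \<Rightarrow> real) \<Rightarrow> real \<Rightarrow> real" where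
  "wronskian u u' w w' x = u x * w' x - u' x * w x"

lemma is_interval_Icc_subset:
  fixes S :: "real set"
  assumes "is_interval S" "s \<in> S" "t \<in> S"
  shows "{s..t} \<subseteq> S"
  using mem_is_interval_1_I[OF assms] by auto

lemma loc_intD: "loc_int S k \<Longrightarrow> {s..t} \<subseteq> S \<Longrightarrow> k absolutely_integrable_on {s..t}"
  by (auto simp: loc_int_def)

lemma loc_int_subset: "loc_int S k \<Longrightarrow> T \<subseteq> S \<Longrightarrow> loc_int T k"
  by (auto simp: loc_int_def)

lemma weak_solD:
  assumes "weak_sol S k u u'" "s \<le> t" "{s..t} \<subseteq> S"
  shows "(u' has_integral u t - u s) {s..t}" "((\<lambda>x. k x * u x) has_integral u' t - u' s) {s..t}"
  using assms by (auto simp: weak_sol_def)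

lemma weak_sol_subset: "weak_sol S k u u' \<Longrightarrow> T \<subseteq> S \<Longrightarrow> weak_sol T k u u'"
  unfolding weak_sol_def by (meson order_trans)

lemma weak_sol_cong:
  assumes "weak_sol S k u u'" "\<And>x. x \<in> S \<Longrightarrow> k x = l x"
  shows "weak_sol S l u u'"
  unfolding weak_sol_def
proof (intro allI impI conjI)
  fix s t :: real assume st: "s \<le> t" "{s..t} \<subseteq> S"
  show "(u' has_integral u t - u s) {s..t}" using weak_solD(1)[OF assms(1) st] .
  show "((\<lambda>x. l x * u x) has_integral u' t - u' s) {s..t}"
    by (rule has_integral_eq[OF _ weak_solD(2)[OF assms(1) st]]) (use st assms(2) in auto)
qed

lemma weak_sol_continuous:
  assumes "weak_sol S k u u'" "{s..t} \<subseteq> S"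
  shows "continuous_on {s..t} u" "continuous_on {s..t} u'"
proof -
  have sub: "{x..y} \<subseteq> S" if "s \<le> x" "y \<le> t" for x y
    using that assms(2) by (meson atLeastatMost_subset_iff order_trans)
  show "continuous_on {s..t} u"
    by (rule indefinite_integral_continuous_on[of s t u' u]) (use weak_solD(1)[OF assms(1)] sub in auto)
  show "continuous_on {s..t} u'"
    by (rule indefinite_integral_continuous_on[of s t "\<lambda>x. k x * u x" u']) (use weak_solD(2)[OF assms(1)] sub in auto)
qed

lemma absolutely_integrable_mult_continuous:
  fixes k g :: "real \<Rightarrow> real"
  assumes "k absolutely_integrable_on {s..t}" "continuous_on {s..t} g"
  shows "(\<lambda>x. k x * g x) absolutely_integrable_on {s..t}"
proof -
  have "(\<lambda>x. g x * k x) absolutely_integrable_on {s..t}"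
  proof (rule absolutely_integrable_bounded_measurable_product_real)
    show "g \<in> borel_measurable (lebesgue_on {s..t})"
      using assms(2) by (intro continuous_imp_measurable_on_sets_lebesgue) auto
    show "bounded (g ` {s..t})" using assms(2) by (simp add: compact_imp_bounded compact_continuous_image)
  qed (use assms in auto)
  then show ?thesis by (simp add: mult.commute)
qed

lemma absolutely_integrable_continuous_on:
  fixes g :: "real \<Rightarrow> real"
  assumes "continuous_on {s..t} g"
  shows "g absolutely_integrable_on {s..t}"
  using absolutely_integrable_continuous_real[OF assms] by simp

text \<open>Lagrange's identity: integration by parts for u * w' and for u' * w, subtracted; the
  term u' * w' cancels.\<close>

lemma wronskian_has_integral:
  assumes k: "loc_int S k" "loc_int S l" and u: "weak_sol S k u u'" and w: "weak_sol S l w w'"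
    and st: "s \<le> t" "{s..t} \<subseteq> S"
  shows "((\<lambda>x. (l x - k x) * (u x * w x)) has_integral wronskian u u' w w' t - wronskian u u' w w' s) {s..t}"
proof -
  have sub: "{x..y} \<subseteq> S" if "s \<le> x" "y \<le> t" for x y
    using that st by (meson atLeastatMost_subset_iff order_trans)
  note U = weak_solD[OF u _ sub] and W = weak_solD[OF w _ sub]
  note cu = weak_sol_continuous[OF u st(2)] and cw = weak_sol_continuous[OF w st(2)]
  note a1 = absolutely_integrable_continuous_on[OF cu(2)] absolutely_integrable_continuous_on[OF cw(2)]
  note a2 = absolutely_integrable_mult_continuous[OF loc_intD[OF k(1) st(2)] cu(1)]
     absolutely_integrable_mult_continuous[OF loc_intD[OF k(2) st(2)] cw(1)]
  have "((\<lambda>x. u x * (l x * w x) + u' x * w' x) has_integral u t * w' t - u s * w' s) {s..t}"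
    by (rule indefinite_integral_by_parts_real[where F=u and G=w', OF st(1) a1(1) a2(2)]) (rule U(1) W(2); assumption)+
  moreover have "((\<lambda>x. u' x * w' x + k x * u x * w x) has_integral u' t * w t - u' s * w s) {s..t}"
    by (rule indefinite_integral_by_parts_real[where F=u' and G=w, OF st(1) a2(1) a1(2)]) (rule U(2) W(1); assumption)+
  ultimately have "((\<lambda>x. (u x * (l x * w x) + u' x * w' x) - (u' x * w' x + k x * u x * w x)) has_integral
      (u t * w' t - u s * w' s) - (u' t * w t - u' s * w s)) {s..t}"
    by (rule has_integral_diff)
  then show ?thesis by (simp add: wronskian_def algebra_simps)
qed

lemma wronskian_constant:
  assumes k: "loc_int S k" and u: "weak_sol S k u u'" and w: "weak_sol S k w w'"
    and S: "is_interval S" "x \<in> S" "y \<in> S"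
  shows "wronskian u u' w w' x = wronskian u u' w w' y"
proof -
  have *: "wronskian u u' w w' t = wronskian u u' w w' s" if "s \<le> t" "s \<in> S" "t \<in> S" for s t
  proof -
    have "{s..t} \<subseteq> S" using S(1) that by (simp add: is_interval_Icc_subset)
    from wronskian_has_integral[OF k k u w that(1) this]
    have "((\<lambda>x. 0 :: real) has_integral wronskian u u' w w' t - wronskian u u' w w' s) {s..t}" by simp
    then show ?thesis using has_integral_unique[OF has_integral_0] by (simp add: has_integral_0_eq)
  qed
  show ?thesis using *[of x y] *[of y x] S by linarith
qed

text \<open>The algebraic identity expressing a solution through two others makes uniqueness of the
  initial value problem a consequence of existence.\<close>

lemma weak_sol_representation:
  assumes k: "loc_int S k" and S: "is_interval S" "x \<in> S" "z \<in> S"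
    and u: "weak_sol S k u u'" and v: "weak_sol S k v v'" and w: "weak_sol S k w w'"
  shows "wronskian v v' w w' z * u x = wronskian u u' w w' z * v x + wronskian v v' u u' z * w x"
    "wronskian v v' w w' z * u' x = wronskian u u' w w' z * v' x + wronskian v v' u u' z * w' x"
proof -
  have eqs: "wronskian v v' w w' z = wronskian v v' w w' x" "wronskian u u' w w' z = wronskian u u' w w' x"
     "wronskian v v' u u' z = wronskian v v' u u' x"
    using wronskian_constant[OF k _ _ S(1,3,2)] u v w by blast+
  show "wronskian v v' w w' z * u x = wronskian u u' w w' z * v x + wronskian v v' u u' z * w x"
    "wronskian v v' w w' z * u' x = wronskian u u' w w' z * v' x + wronskian v v' u u' z * w' x"
    unfolding eqs by (simp_all add: wronskian_def algebra_simps)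
qed

section \<open>Existence by Picard iteration\<close>

text \<open>The oriented integral from x0 to x, written as one integral over the whole line whose
  kernel carries the dependence on x. In this form, measurability jointly in x and a parameter is an
  instance of measurability of parameter integrals.\<close>

definition signed_integral :: "real \<Rightarrow> (real \<Rightarrow> real) \<Rightarrow> real \<Rightarrow> real" where
  "signed_integral x0 g x = (LINT y|lebesgue. (indicator {x0..x} y - indicator {x..x0} y) * g y)"

lemma signed_integral_refl [simp]: "signed_integral x0 g x0 = 0"
  by (simp add: signed_integral_def)

lemma signed_integral_ge:
  assumes "x0 \<le> x" "g absolutely_integrable_on {x0..x}"
  shows "(g has_integral signed_integral x0 g x) {x0..x}"
proof -
  have "AE y in lebesgue. y \<noteq> x0" by (rule AE_I'[of "{x0}"]) auto
  then have "signed_integral x0 g x = (LINT y|lebesgue. indicator {x0..x} y *\<^sub>R g y)"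
    unfolding signed_integral_def
  proof (intro Bochner_Integration.integral_cong_AE)
    have *: "(\<lambda>y. indicator {x0..x} y *\<^sub>R g y) \<in> borel_measurable lebesgue"
      using assms(2) by (auto simp: set_integrable_def)
    then show "(\<lambda>y. indicator {x0..x} y *\<^sub>R g y) \<in> borel_measurable lebesgue" .
    have "(\<lambda>y. (1 - indicator {x..x0} y) * (indicator {x0..x} y *\<^sub>R g y)) \<in> borel_measurable lebesgue"
      by (intro borel_measurable_times borel_measurable_diff borel_measurable_indicator * measurable_const) auto
    show "(\<lambda>y. (indicator {x0..x} y - indicator {x..x0} y) * g y) \<in> borel_measurable lebesgue"
    proof (cases "x = x0")
      case False
      then have "(\<lambda>y. (indicator {x0..x} y - indicator {x..x0} y) * g y) = (\<lambda>y. indicator {x0..x} y *\<^sub>R g y)"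
        using assms(1) by (auto simp: fun_eq_iff indicator_def)
      then show ?thesis using * by simp
    qed simp
  qed (use assms(1) in \<open>auto elim!: eventually_mono simp: indicator_def\<close>)
  then show ?thesis
    using has_integral_integral_lebesgue[of "\<lambda>y. indicator {x0..x} y *\<^sub>R g y"] assms(2)
      has_integral_restrict_UNIV[of "{x0..x}" g]
    by (simp add: set_integrable_def indicator_def of_bool_def if_distrib[of "\<lambda>c. c * _"] cong: if_cong)
qed

lemma signed_integral_le:
  assumes "x \<le> x0" "g absolutely_integrable_on {x..x0}"
  shows "(g has_integral - signed_integral x0 g x) {x..x0}"
proof -
  have "signed_integral x0 g x = - signed_integral x g x0"
    unfolding signed_integral_def Bochner_Integration.integral_minus[symmetric] by (simp add: left_diff_distrib)
  then show ?thesis using signed_integral_ge[OF assms] by simp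
qed

lemma signed_integral_has_integral:
  assumes S: "is_interval S" "x0 \<in> S" "s \<in> S" "t \<in> S" "s \<le> t" and g: "loc_int S g"
  shows "(g has_integral signed_integral x0 g t - signed_integral x0 g s) {s..t}"
proof -
  have sub: "{x..y} \<subseteq> S" if "x \<in> S" "y \<in> S" for x y using S(1) that by (simp add: is_interval_Icc_subset)
  note a = loc_intD[OF g sub]
  consider "x0 \<le> s" | "s \<le> x0" "x0 \<le> t" | "t \<le> x0" by linarith
  then show ?thesis
  proof cases
    case 1
    from a[OF S(3,4)] have i: "(g has_integral integral {s..t} g) {s..t}"
      by (simp add: integrable_integral set_lebesgue_integral_eq_integral(1))
    have "(g has_integral signed_integral x0 g s + integral {s..t} g) {x0..t}"
      by (rule has_integral_combine[OF _ _ signed_integral_ge i]) (use 1 S a in auto)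
    moreover have "(g has_integral signed_integral x0 g t) {x0..t}"
      by (rule signed_integral_ge) (use 1 S a in auto)
    ultimately have "signed_integral x0 g s + integral {s..t} g = signed_integral x0 g t"
      by (rule has_integral_unique)
    then have "integral {s..t} g = signed_integral x0 g t - signed_integral x0 g s" by simp
    then show ?thesis using i by simp
  next
    case 2
    have "(g has_integral - signed_integral x0 g s + signed_integral x0 g t) {s..t}"
      by (rule has_integral_combine[OF _ _ signed_integral_le signed_integral_ge]) (use 2 S a in auto)
    then show ?thesis by simp
  next
    case 3
    from a[OF S(3,4)] have i: "(g has_integral integral {s..t} g) {s..t}"
      by (simp add: integrable_integral set_lebesgue_integral_eq_integral(1))
    have "(g has_integral integral {s..t} g + - signed_integral x0 g t) {s..x0}"
      by (rule has_integral_combine[OF _ _ i signed_integral_le]) (use 3 S a in auto)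
    moreover have "(g has_integral - signed_integral x0 g s) {s..x0}"
      by (rule signed_integral_le) (use 3 S a in auto)
    ultimately have "integral {s..t} g + - signed_integral x0 g t = - signed_integral x0 g s"
      by (rule has_integral_unique)
    then have "integral {s..t} g = signed_integral x0 g t - signed_integral x0 g s" by simp
    then show ?thesis using i by simp
  qed
qed

text \<open>A chain rule for F^(n+1), where F is differentiable only almost everywhere. It is
  obtained by induction, integrating by parts with F and G = F^(n+1): the two terms F * g and f * G
  combine to n + 2 times the next integrand.\<close>

lemma has_integral_power_indefinite:
  fixes f F :: "real \<Rightarrow> real"
  assumes f: "f absolutely_integrable_on {s..t}"
    and F: "\<And>x y. s \<le> x \<Longrightarrow> x \<le> y \<Longrightarrow> y \<le> t \<Longrightarrow> (f has_integral F y - F x) {x..y}"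
    and xy: "s \<le> x" "x \<le> y" "y \<le> t"
  shows "((\<lambda>z. f z * F z ^ n) has_integral (F y ^ Suc n - F x ^ Suc n) / real (Suc n)) {x..y}"
  using xy
proof (induction n arbitrary: x y)
  case 0
  then show ?case using F[of x y] by simp
next
  case (Suc n)
  define G where "G z = F z ^ Suc n" for z
  define g where "g z = real (Suc n) * (f z * F z ^ n)" for z
  have cF: "continuous_on {s..t} F" by (rule indefinite_integral_continuous_on[OF F])
  have sub: "{x..y} \<subseteq> {s..t}" using Suc.prems by auto
  have f': "f absolutely_integrable_on {x..y}" using f sub by (rule absolutely_integrable_on_subinterval)
  have "(\<lambda>z. f z * F z ^ n) absolutely_integrable_on {x..y}"
    using cF sub by (intro absolutely_integrable_mult_continuous f' continuous_on_power) (rule continuous_on_subset)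
  then have g: "g absolutely_integrable_on {x..y}" unfolding g_def by (intro set_integrable_mult_right)
  have G: "(g has_integral G v - G u) {u..v}" if "x \<le> u" "u \<le> v" "v \<le> y" for u v
    using has_integral_mult_right[OF Suc.IH[of u v], of "real (Suc n)"] that Suc.prems
    by (simp add: g_def[abs_def] G_def del: of_nat_Suc)
  have F': "(f has_integral F v - F u) {u..v}" if "x \<le> u" "u \<le> v" "v \<le> y" for u v
    by (rule F) (use that Suc.prems in auto)
  have "((\<lambda>z. F z * g z + f z * G z) has_integral F y * G y - F x * G x) {x..y}"
    using Suc.prems(2) f' g F' G by (rule indefinite_integral_by_parts_real)
  moreover have "F z * g z + f z * G z = real (Suc (Suc n)) * (f z * F z ^ Suc n)" for z
    by (simp add: g_def G_def algebra_simps)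
  ultimately have "((\<lambda>z. real (Suc (Suc n)) * (f z * F z ^ Suc n)) has_integral F y ^ Suc (Suc n) - F x ^ Suc (Suc n)) {x..y}"
    by (simp add: G_def)
  from has_integral_divide[OF this, of "real (Suc (Suc n))"] show ?case
    by (simp del: of_nat_Suc power_Suc)
qed

text \<open>The n-th pair is the n-th term of the Neumann series, that is, a difference of
  successive Picard iterates for (u, u')' = (u', k u) with data (A, B) at x0. The solution is the
  sum over n, not the limit of these pairs.\<close>

primrec picard :: "(real \<Rightarrow> real) \<Rightarrow> real \<Rightarrow> real \<Rightarrow> real \<Rightarrow> nat \<Rightarrow> (real \<Rightarrow> real) \<times> (real \<Rightarrow> real)" where
  "picard k x0 A B 0 = ((\<lambda>x. A), (\<lambda>x. B))"
| "picard k x0 A B (Suc n) = (signed_integral x0 (snd (picard k x0 A B n)),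
     signed_integral x0 (\<lambda>y. k y * fst (picard k x0 A B n) y))"

definition ivp_sol :: "(real \<Rightarrow> real) \<Rightarrow> real \<Rightarrow> real \<Rightarrow> real \<Rightarrow> real \<Rightarrow> real" where
  "ivp_sol k x0 A B x = (\<Sum>n. fst (picard k x0 A B n) x)"

definition ivp_deriv :: "(real \<Rightarrow> real) \<Rightarrow> real \<Rightarrow> real \<Rightarrow> real \<Rightarrow> real \<Rightarrow> real" where
  "ivp_deriv k x0 A B x = (\<Sum>n. snd (picard k x0 A B n) x)"

lemma loc_int_continuous:
  assumes "\<And>s t. {s..t} \<subseteq> S \<Longrightarrow> continuous_on {s..t} g"
  shows "loc_int S g"
  using assms absolutely_integrable_continuous_on unfolding loc_int_def by blast

lemma loc_int_mult_continuous:
  assumes "loc_int S k" "\<And>s t. {s..t} \<subseteq> S \<Longrightarrow> continuous_on {s..t} g"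
  shows "loc_int S (\<lambda>x. k x * g x)"
  using assms absolutely_integrable_mult_continuous unfolding loc_int_def by blast

lemma signed_integral_continuous:
  assumes S: "is_interval S" "x0 \<in> S" and g: "loc_int S g" and st: "{s..t} \<subseteq> S"
  shows "continuous_on {s..t} (signed_integral x0 g)"
proof (rule indefinite_integral_continuous_on)
  show "(g has_integral signed_integral x0 g y - signed_integral x0 g x) {x..y}"
    if "s \<le> x" "x \<le> y" "y \<le> t" for x y
    using that st by (intro signed_integral_has_integral[OF S _ _ _ g]) auto
qed

lemma picard_continuous:
  assumes S: "is_interval S" "x0 \<in> S" and k: "loc_int S k" and st: "{s..t} \<subseteq> S"
  shows "continuous_on {s..t} (fst (picard k x0 A B n)) \<and> continuous_on {s..t} (snd (picard k x0 A B n))"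
  using st
proof (induction n arbitrary: s t)
  case (Suc n)
  then show ?case
    using signed_integral_continuous[OF S] loc_int_continuous loc_int_mult_continuous[OF k] by simp
qed simp

lemma loc_int_weight:
  assumes "loc_int S k"
  shows "loc_int S (\<lambda>y. 1 + \<bar>k y\<bar>)"
  unfolding loc_int_def
proof (intro allI impI)
  fix s t :: real assume "{s..t} \<subseteq> S"
  then show "(\<lambda>y. 1 + \<bar>k y\<bar>) absolutely_integrable_on {s..t}"
    using assms by (intro set_integral_add absolutely_integrable_continuous_on set_integrable_abs loc_intD) auto
qed

text \<open>The weight 1 + |k| serves both components at once, since |w| + |k u| <= (1 + |k|) (|u| +
  |w|). If K is its indefinite integral, then (1 + |k|) K^n integrates to K^(n+1) / (n+1), which
  produces the factorial.\<close>

lemma picard_bound: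
  assumes S: "is_interval S" "x0 \<in> S" and k: "loc_int S k" and x: "x \<in> S"
  shows "\<bar>fst (picard k x0 A B n) x\<bar> + \<bar>snd (picard k x0 A B n) x\<bar> \<le>
    (\<bar>A\<bar> + \<bar>B\<bar>) * \<bar>signed_integral x0 (\<lambda>y. 1 + \<bar>k y\<bar>) x\<bar> ^ n / fact n"
  using x
proof (induction n arbitrary: x)
  case (Suc n)
  define \<kappa> where "\<kappa> = (\<lambda>y. 1 + \<bar>k y\<bar>)"
  define K where "K = signed_integral x0 \<kappa>"
  define C where "C = \<bar>A\<bar> + \<bar>B\<bar>"
  define u where "u = fst (picard k x0 A B n)"
  define w where "w = snd (picard k x0 A B n)"
  \<comment> \<open>Ordering x0 and x treats both sides of x0 together; only the sign of K still has
    to be distinguished.\<close>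
  define l where "l = min x0 x"
  define r where "r = max x0 x"
  have lr: "l \<le> r" "l \<in> S" "r \<in> S" "x0 \<in> {l..r}" "x \<in> {l..r}"
    using S Suc.prems by (auto simp: l_def r_def min_def max_def)
  have sub: "{l..r} \<subseteq> S" using is_interval_Icc_subset[OF S(1) lr(2,3)] .
  have \<kappa>: "loc_int S \<kappa>"
    unfolding \<kappa>_def by (rule loc_int_weight[OF k])
  have cu: "continuous_on {s..t} u" "continuous_on {s..t} w" if "{s..t} \<subseteq> S" for s t
    using picard_continuous[OF S k that] by (simp_all add: u_def w_def)
  have lw: "loc_int S w" and lu: "loc_int S (\<lambda>y. k y * u y)"
    using cu k by (auto intro: loc_int_continuous loc_int_mult_continuous)
  have abs_si: "\<bar>signed_integral x0 g x\<bar> = \<bar>integral {l..r} g\<bar>" if "loc_int S g" for g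
  proof (cases "x0 \<le> x")
    case True
    then show ?thesis
      using signed_integral_has_integral[OF S S(2) Suc.prems True that] by (simp add: l_def r_def min_def max_def integral_unique)
  next
    case False
    then have "x \<le> x0" by simp
    then show ?thesis
      using signed_integral_has_integral[OF S Suc.prems S(2) _ that] by (simp add: l_def r_def min_def max_def integral_unique)
  qed
  have K_int: "(\<kappa> has_integral K y - K z) {z..y}" if "l \<le> z" "z \<le> y" "y \<le> r" for z y
    unfolding K_def using that sub by (intro signed_integral_has_integral[OF S _ _ _ \<kappa>]) auto
  note pow = has_integral_power_indefinite[OF loc_intD[OF \<kappa> sub] K_int order_refl lr(1) order_refl, of n]
  have K0: "K x0 = 0" by (simp add: K_def)
  have Kmono: "K z \<le> K y" if "l \<le> z" "z \<le> y" "y \<le> r" for z y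
    using has_integral_nonneg[OF K_int[OF that]] by (simp add: \<kappa>_def)
  have pow': "((\<lambda>y. \<kappa> y * \<bar>K y\<bar> ^ n) has_integral \<bar>K x\<bar> ^ Suc n / real (Suc n)) {l..r}"
  proof (cases "x0 \<le> x")
    case True
    then have eq: "l = x0" "r = x" by (auto simp: l_def r_def)
    have "\<bar>K y\<bar> = K y" if "y \<in> {l..r}" for y using Kmono[of x0 y] that eq K0 by simp
    then show ?thesis using pow K0 eq lr
      by (intro has_integral_eq[OF _ pow[unfolded eq K0, simplified, folded eq], THEN has_integral_eq_rhs]) auto
  next
    case False
    then have eq: "l = x" "r = x0" by (auto simp: l_def r_def)
    have Kneg: "\<bar>K y\<bar> = - K y" if "y \<in> {l..r}" for y using Kmono[of y x0] that eq K0 by simp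
    \<comment> \<open>To the left of x0 the function K is nonpositive, and the factor (-1)^n turns
      K^n into the power of its absolute value.\<close>
    have "((\<lambda>y. (-1) ^ n * (\<kappa> y * K y ^ n)) has_integral (-1) ^ n * ((K r ^ Suc n - K l ^ Suc n) / real (Suc n))) {l..r}"
      by (rule has_integral_mult_right[OF pow])
    moreover have "(-1) ^ n * ((K r ^ Suc n - K l ^ Suc n) / real (Suc n)) = \<bar>K x\<bar> ^ Suc n / real (Suc n)"
      using Kneg[of x] eq lr K0 by (simp add: power_minus[of "K x"])
    moreover have "(-1) ^ n * (\<kappa> y * K y ^ n) = \<kappa> y * \<bar>K y\<bar> ^ n" if "y \<in> {l..r}" for y
      using Kneg[OF that] by (simp add: power_minus[of "K y"])
    ultimately show ?thesis by (metis (no_types, lifting) has_integral_eq)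
  qed
  have aw: "w absolutely_integrable_on {l..r}" and au: "(\<lambda>y. k y * u y) absolutely_integrable_on {l..r}"
    using loc_intD[OF lw sub] loc_intD[OF lu sub] .
  have abs_le: "\<bar>integral {l..r} g\<bar> \<le> integral {l..r} (\<lambda>y. \<bar>g y\<bar>)"
    if "g absolutely_integrable_on {l..r}" for g :: "real \<Rightarrow> real"
    using integral_norm_bound_integral[of g "{l..r}" "\<lambda>y. \<bar>g y\<bar>"] that set_integrable_abs[OF that]
    by (simp add: set_lebesgue_integral_eq_integral(1))
  have "\<bar>signed_integral x0 w x\<bar> + \<bar>signed_integral x0 (\<lambda>y. k y * u y) x\<bar> \<le>
      integral {l..r} (\<lambda>y. \<bar>w y\<bar>) + integral {l..r} (\<lambda>y. \<bar>k y * u y\<bar>)"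
    unfolding abs_si[OF lw] abs_si[OF lu]
    by (intro add_mono abs_le aw au)
  also have "\<dots> = integral {l..r} (\<lambda>y. \<bar>w y\<bar> + \<bar>k y * u y\<bar>)"
    using aw au by (intro Henstock_Kurzweil_Integration.integral_add[symmetric])
      (auto intro: set_lebesgue_integral_eq_integral set_integrable_abs)
  also have "\<dots> \<le> integral {l..r} (\<lambda>y. C / fact n * (\<kappa> y * \<bar>K y\<bar> ^ n))"
  proof (rule integral_le)
    show "(\<lambda>y. \<bar>w y\<bar> + \<bar>k y * u y\<bar>) integrable_on {l..r}"
      using aw au by (intro integrable_add) (auto intro: set_lebesgue_integral_eq_integral set_integrable_abs)
    show "(\<lambda>y. C / fact n * (\<kappa> y * \<bar>K y\<bar> ^ n)) integrable_on {l..r}"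
      using has_integral_mult_right[OF pow'] by blast
    fix y assume y: "y \<in> {l..r}"
    have "\<bar>w y\<bar> + \<bar>k y * u y\<bar> \<le> \<kappa> y * (\<bar>u y\<bar> + \<bar>w y\<bar>)"
      by (simp add: \<kappa>_def algebra_simps abs_mult)
    also have "\<dots> \<le> \<kappa> y * (C * \<bar>K y\<bar> ^ n / fact n)"
      using Suc.IH[of y] y sub unfolding u_def w_def C_def K_def \<kappa>_def by (intro mult_left_mono) auto
    finally show "\<bar>w y\<bar> + \<bar>k y * u y\<bar> \<le> C / fact n * (\<kappa> y * \<bar>K y\<bar> ^ n)" by (simp add: algebra_simps)
  qed
  also have "\<dots> = C / fact n * (\<bar>K x\<bar> ^ Suc n / real (Suc n))"
    using has_integral_mult_right[OF pow', of "C / fact n"] by (rule integral_unique)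
  also have "\<dots> = C * \<bar>K x\<bar> ^ Suc n / fact (Suc n)" by (simp add: field_simps)
  finally show ?case by (simp add: u_def w_def C_def K_def \<kappa>_def)
qed simp

text \<open>Exchanges the Picard series with the integral by dominated convergence of the partial
  sums. The function H will be the constant 1 in the equation for u and |k| in the equation for
  u'.\<close>

lemma sums_has_integral_dominated:
  fixes h :: "nat \<Rightarrow> real \<Rightarrow> real"
  assumes h: "\<And>n. (h n has_integral I n) {s..t}" and I: "I sums J"
    and H: "H integrable_on {s..t}" "\<And>x. x \<in> {s..t} \<Longrightarrow> 0 \<le> H x"
    and M: "summable M" and bound: "\<And>n x. x \<in> {s..t} \<Longrightarrow> \<bar>h n x\<bar> \<le> M n * H x"
  shows "((\<lambda>x. \<Sum>n. h n x) has_integral J) {s..t}"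
proof (rule has_integral_dominated_convergence[where f="\<lambda>m x. \<Sum>n<m. h n x" and y="\<lambda>m. \<Sum>n<m. I n"
    and h="\<lambda>x. \<Sum>n. M n * H x"])
  show "((\<lambda>x. \<Sum>n<m. h n x) has_integral (\<Sum>n<m. I n)) {s..t}" for m
    by (intro has_integral_sum h) auto
  have sum_eq: "(\<Sum>n. M n * H x) = (\<Sum>n. M n) * H x" for x
    using suminf_mult2[OF M] by simp
  show "(\<lambda>x. \<Sum>n. M n * H x) integrable_on {s..t}"
    unfolding sum_eq using integrable_on_mult_right[OF H(1)] by simp
  show "\<forall>x\<in>{s..t}. norm (\<Sum>n<m. h n x) \<le> (\<Sum>n. M n * H x)" for m
  proof
    fix x assume x: "x \<in> {s..t}"
    have "norm (\<Sum>n<m. h n x) \<le> (\<Sum>n<m. \<bar>h n x\<bar>)" by (simp add: sum_abs)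
    also have "\<dots> \<le> (\<Sum>n<m. M n * H x)" by (intro sum_mono bound x)
    also have "\<dots> \<le> (\<Sum>n. M n * H x)"
    proof (intro sum_le_suminf summable_mult2 M ballI)
      show "0 \<le> M n * H x" for n using bound[OF x, of n] by linarith
    qed auto
    finally show "norm (\<Sum>n<m. h n x) \<le> (\<Sum>n. M n * H x)" .
  qed
  show "\<forall>x\<in>{s..t}. (\<lambda>m. \<Sum>n<m. h n x) \<longlonglongrightarrow> (\<Sum>n. h n x)"
  proof
    fix x assume x: "x \<in> {s..t}"
    have "summable (\<lambda>n. h n x)"
      using bound[OF x] summable_mult2[OF M, of "H x"] by (intro summable_comparison_test[of "\<lambda>n. h n x"]) auto
    then show "(\<lambda>m. \<Sum>n<m. h n x) \<longlonglongrightarrow> (\<Sum>n. h n x)" by (rule summable_LIMSEQ)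
  qed
  show "(\<lambda>m. \<Sum>n<m. I n) \<longlonglongrightarrow> J" using I by (simp add: sums_def)
qed

lemma ivp_sol_initial [simp]: "ivp_sol k x0 A B x0 = A" "ivp_deriv k x0 A B x0 = B"
proof -
  have "fst (picard k x0 A B n) x0 = (if n = 0 then A else 0)" "snd (picard k x0 A B n) x0 = (if n = 0 then B else 0)" for n
    by (cases n; simp)+
  then show "ivp_sol k x0 A B x0 = A" "ivp_deriv k x0 A B x0 = B"
    unfolding ivp_sol_def ivp_deriv_def by (simp_all add: sums_If_finite[of "\<lambda>n. n = 0", THEN sums_unique, symmetric])
qed

theorem ivp_sol_weak_sol:
  assumes S: "is_interval S" "x0 \<in> S" and k: "loc_int S k"
  shows "weak_sol S k (ivp_sol k x0 A B) (ivp_deriv k x0 A B)"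
  unfolding weak_sol_def
proof (intro allI impI)
  fix s t :: real assume st: "s \<le> t" "{s..t} \<subseteq> S"
  define K where "K = signed_integral x0 (\<lambda>y. 1 + \<bar>k y\<bar>)"
  define u where "u n = fst (picard k x0 A B n)" for n
  define w where "w n = snd (picard k x0 A B n)" for n
  have cu: "continuous_on {x..y} (u n)" "continuous_on {x..y} (w n)" if "{x..y} \<subseteq> S" for x y n
    using picard_continuous[OF S k that] by (simp_all add: u_def w_def)
  have lw: "loc_int S (w n)" and lu: "loc_int S (\<lambda>y. k y * u n y)" for n
    using cu k by (auto intro: loc_int_continuous loc_int_mult_continuous)
  have "continuous_on {s..t} K"
    unfolding K_def by (rule signed_integral_continuous[OF S loc_int_weight[OF k] st(2)])
  then have "bounded (K ` {s..t})" by (simp add: compact_continuous_image compact_imp_bounded)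
  \<comment> \<open>On a compact interval K is bounded, so the factorial bound becomes a multiple of
    R^n / n!, a majorant independent of the point.\<close>
  then obtain R where "\<forall>y\<in>{s..t}. \<bar>K y\<bar> \<le> R" unfolding bounded_iff by auto
  then have R: "\<bar>K y\<bar> \<le> R" if "y \<in> {s..t}" for y using that by blast
  define M where "M n = (\<bar>A\<bar> + \<bar>B\<bar>) * (R ^ n / fact n)" for n
  have M: "summable M"
    unfolding M_def using summable_exp[of R] by (intro summable_mult) (simp add: field_simps)
  have bound: "\<bar>u n y\<bar> + \<bar>w n y\<bar> \<le> M n" if "y \<in> {s..t}" for n y
  proof -
    have "\<bar>u n y\<bar> + \<bar>w n y\<bar> \<le> (\<bar>A\<bar> + \<bar>B\<bar>) * \<bar>K y\<bar> ^ n / fact n"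
      unfolding u_def w_def K_def using that st by (intro picard_bound[OF S k]) auto
    also have "\<dots> \<le> M n" unfolding M_def times_divide_eq_right
      using R[OF that] by (intro divide_right_mono mult_left_mono power_mono) auto
    finally show ?thesis .
  qed
  have bu: "\<bar>u n y\<bar> \<le> M n" and bw: "\<bar>w n y\<bar> \<le> M n" if "y \<in> {s..t}" for n y
    using bound[OF that, of n] by linarith+
  have su: "summable (\<lambda>n. u n y)" and sw: "summable (\<lambda>n. w n y)" if "y \<in> {s..t}" for y
    using M bu[OF that] bw[OF that] by (auto intro!: summable_comparison_test[of _ M])
  \<comment> \<open>The integral of term n is the increment of term n + 1. Starting at index 1 loses
    nothing, because term 0 is constant and has increment 0.\<close>
  have diff: "(\<lambda>n. g (Suc n) t - g (Suc n) s) sums ((\<Sum>n. g n t) - (\<Sum>n. g n s))"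
    if "summable (\<lambda>n. g n s)" "summable (\<lambda>n. g n t)" "g 0 s = g 0 t" for g :: "nat \<Rightarrow> real \<Rightarrow> real"
  proof -
    have "(\<lambda>n. g n t - g n s) sums ((\<Sum>n. g n t) - (\<Sum>n. g n s))"
      using that by (intro sums_diff summable_sums) auto
    then show ?thesis using that(3) by (subst sums_Suc_iff) simp
  qed
  have tt: "s \<in> {s..t}" "t \<in> {s..t}" "s \<in> S" "t \<in> S" using st by auto
  have "((\<lambda>x. \<Sum>n. w n x) has_integral (\<Sum>n. u n t) - (\<Sum>n. u n s)) {s..t}"
  proof (rule sums_has_integral_dominated[where H="\<lambda>_. 1" and M=M])
    show "(w n has_integral u (Suc n) t - u (Suc n) s) {s..t}" for n
      using signed_integral_has_integral[OF S tt(3,4) st(1) lw] by (simp add: u_def w_def)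
    show "(\<lambda>n. u (Suc n) t - u (Suc n) s) sums ((\<Sum>n. u n t) - (\<Sum>n. u n s))"
      by (rule diff) (use su tt in \<open>auto simp: u_def\<close>)
  qed (use M bw in auto)
  moreover have "((\<lambda>x. \<Sum>n. k x * u n x) has_integral (\<Sum>n. w n t) - (\<Sum>n. w n s)) {s..t}"
  proof (rule sums_has_integral_dominated[where H="\<lambda>x. \<bar>k x\<bar>" and M=M])
    show "((\<lambda>x. k x * u n x) has_integral w (Suc n) t - w (Suc n) s) {s..t}" for n
      using signed_integral_has_integral[OF S tt(3,4) st(1) lu] by (simp add: u_def w_def)
    show "(\<lambda>n. w (Suc n) t - w (Suc n) s) sums ((\<Sum>n. w n t) - (\<Sum>n. w n s))"
      by (rule diff) (use sw tt in \<open>auto simp: w_def\<close>)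
    show "(\<lambda>x. \<bar>k x\<bar>) integrable_on {s..t}"
      using set_integrable_abs[OF loc_intD[OF k st(2)]] by (rule set_lebesgue_integral_eq_integral(1))
    show "\<bar>k x * u n x\<bar> \<le> M n * \<bar>k x\<bar>" if "x \<in> {s..t}" for n x
      using mult_right_mono[OF bu[OF that, of n], of "\<bar>k x\<bar>"] by (simp add: abs_mult mult.commute)
  qed (use M in auto)
  then have "((\<lambda>x. k x * (\<Sum>n. u n x)) has_integral (\<Sum>n. w n t) - (\<Sum>n. w n s)) {s..t}"
    by (rule has_integral_eq[rotated]) (use su in \<open>auto simp: suminf_mult\<close>)
  ultimately show "(ivp_deriv k x0 A B has_integral ivp_sol k x0 A B t - ivp_sol k x0 A B s) {s..t} \<and>
       ((\<lambda>x. k x * ivp_sol k x0 A B x) has_integral ivp_deriv k x0 A B t - ivp_deriv k x0 A B s) {s..t}"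
    unfolding ivp_sol_def[abs_def] ivp_deriv_def[abs_def] u_def w_def by simp
qed

text \<open>At x0 the two fundamental solutions have Wronskian 1, and the other Wronskians in
  \<open>weak_sol_representation\<close> are the Cauchy data of u.\<close>

lemma weak_sol_eq_ivp_sol:
  assumes S: "is_interval S" "x0 \<in> S" and k: "loc_int S k" and u: "weak_sol S k u u'" and x: "x \<in> S"
  shows "u x = u x0 * ivp_sol k x0 1 0 x + u' x0 * ivp_sol k x0 0 1 x"
    "u' x = u x0 * ivp_deriv k x0 1 0 x + u' x0 * ivp_deriv k x0 0 1 x"
  using weak_sol_representation[OF k S(1) x S(2) u ivp_sol_weak_sol[OF S k, of 1 0] ivp_sol_weak_sol[OF S k, of 0 1]]
  by (simp_all add: wronskian_def)

section \<open>Eigenvalues in terms of the fundamental solutions\<close>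

lemma is_interval_einterval: "is_interval (einterval a b)"
  unfolding is_interval_1
proof (intro ballI allI impI)
  fix x y z assume h: "x \<in> einterval a b" "y \<in> einterval a b" "x \<le> z \<and> z \<le> y"
  then have "ereal x \<le> ereal z" "ereal z \<le> ereal y" by auto
  then show "z \<in> einterval a b" using h unfolding einterval_iff by (meson less_le_trans le_less_trans)
qed

lemma AE_lebesgue_on_iff_negligible:
  assumes "S \<in> sets lebesgue"
  shows "(AE x in lebesgue_on S. P x) \<longleftrightarrow> (\<exists>N. negligible N \<and> (\<forall>x\<in>S - N. P x))"
proof -
  have "(AE x in lebesgue_on S. P x) \<longleftrightarrow> (AE x in lebesgue. x \<in> S \<longrightarrow> P x)"
    using assms by (subst AE_restrict_space_iff) auto
  also have "\<dots> \<longleftrightarrow> (\<exists>N\<in>null_sets lebesgue. \<forall>x\<in>S - N. P x)"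
    unfolding eventually_ae_filter by (intro bex_cong refl) auto
  also have "\<dots> \<longleftrightarrow> (\<exists>N. negligible N \<and> (\<forall>x\<in>S - N. P x))"
    by (simp only: negligible_iff_null_sets Bex_def)
  finally show ?thesis .
qed

lemma einterval_in_sets_lebesgue [simp]: "einterval a b \<in> sets lebesgue"
  by (simp add: borel_einterval)

lemma locally_L1_loc_int:
  assumes "locally_L1 a b q"
  shows "loc_int (einterval a b) (\<lambda>x. q x - r)"
  unfolding loc_int_def
proof (intro allI impI)
  fix s t assume "{s..t} \<subseteq> einterval a b"
  then have "q absolutely_integrable_on {s..t}" using assms by (simp add: locally_L1_def)
  then show "(\<lambda>x. q x - r) absolutely_integrable_on {s..t}"
    using set_integral_diff(1)[OF _ absolutely_integrable_continuous_on[of s t "\<lambda>_. r"]] by simp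
qed

section \<open>The differential expression and its weak form\<close>

text \<open>As q and r are real, real and imaginary parts solve the equation separately. The
  right-hand side is prescribed only almost everywhere, because an element of the operator graph
  agrees with its regular representative u only almost everywhere.\<close>

lemma sl_eq_imp_weak_sol:
  assumes u: "sl_eq a b q u u' g" and g: "AE x in lebesgue_on (einterval a b). g x = of_real r * u x"
  shows "weak_sol (einterval a b) (\<lambda>x. q x - r) (\<lambda>x. Re (u x)) (\<lambda>x. Re (u' x))"
    "weak_sol (einterval a b) (\<lambda>x. q x - r) (\<lambda>x. Im (u x)) (\<lambda>x. Im (u' x))"
proof -
  have ac: "abs_cont_on s t u" "abs_cont_on s t u'" if "{s..t} \<subseteq> einterval a b" for s t
    using u that by (auto simp: sl_eq_def locally_abs_cont_def)
  have der: "(u has_vector_derivative u' x) (at x)" if "x \<in> einterval a b" for x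
    using u that by (auto simp: sl_eq_def)
  have "AE x in lebesgue_on (einterval a b). (u' has_vector_derivative of_real (q x - r) * u x) (at x)"
    using u g unfolding sl_eq_def by (auto elim!: eventually_elim2 simp: algebra_simps)
  then obtain N where N: "negligible N"
    "\<And>x. x \<in> einterval a b - N \<Longrightarrow> (u' has_vector_derivative of_real (q x - r) * u x) (at x)"
    by (auto simp: AE_lebesgue_on_iff_negligible)
  have 1: "(u' has_integral u t - u s) {s..t}" if "s \<le> t" "{s..t} \<subseteq> einterval a b" for s t
  proof (rule abs_cont_FTC[OF ac(1)[OF that(2)] that(1) negligible_empty])
    fix x assume "x \<in> {s..t} - {}"
    then have "x \<in> einterval a b" using that(2) by blast
    then show "(u has_vector_derivative u' x) (at x within {s..t})"
      by (rule has_vector_derivative_at_within[OF der])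
  qed
  have 2: "((\<lambda>x. of_real (q x - r) * u x) has_integral u' t - u' s) {s..t}" if "s \<le> t" "{s..t} \<subseteq> einterval a b" for s t
  proof (rule abs_cont_FTC[OF ac(2)[OF that(2)] that(1) N(1)])
    fix x assume "x \<in> {s..t} - N"
    then have "x \<in> einterval a b - N" using that(2) by blast
    then show "(u' has_vector_derivative of_real (q x - r) * u x) (at x within {s..t})"
      by (rule has_vector_derivative_at_within[OF N(2)])
  qed
  show "weak_sol (einterval a b) (\<lambda>x. q x - r) (\<lambda>x. Re (u x)) (\<lambda>x. Re (u' x))"
    using has_integral_linear[OF 1 bounded_linear_Re] has_integral_linear[OF 2 bounded_linear_Re]
    by (simp add: weak_sol_def o_def)
  show "weak_sol (einterval a b) (\<lambda>x. q x - r) (\<lambda>x. Im (u x)) (\<lambda>x. Im (u' x))"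
    using has_integral_linear[OF 1 bounded_linear_Im] has_integral_linear[OF 2 bounded_linear_Im]
    by (simp add: weak_sol_def o_def)
qed

text \<open>Since u' is continuous, the derivative of u exists at every point of the open interval
  and not only almost everywhere.\<close>

lemma weak_sol_has_derivative:
  assumes u: "weak_sol (einterval a b) k u u'" and x: "x \<in> einterval a b"
  shows "(u has_vector_derivative u' x) (at x)"
proof -
  obtain e where e: "e > 0" "cball x e \<subseteq> einterval a b"
    using open_contains_cball[of "einterval a b"] x by auto
  have st: "{x - e..x + e} \<subseteq> einterval a b" "x \<in> {x - e..x + e}"
    using e by (auto simp: cball_eq_atLeastAtMost)
  have "((\<lambda>y. u (x - e) + integral {x - e..y} u') has_vector_derivative 0 + u' x) (at x within {x - e..x + e})"
    by (intro has_vector_derivative_add has_vector_derivative_const integral_has_vector_derivative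
        weak_sol_continuous[OF u] st)
  then have "((\<lambda>y. u (x - e) + integral {x - e..y} u') has_vector_derivative u' x) (at x)"
    using e by (subst (asm) at_within_Icc_at) auto
  then show ?thesis
  proof (rule has_vector_derivative_transform_within_open[where S="{x - e<..<x + e}"])
    fix y assume "y \<in> {x - e<..<x + e}"
    then have "(u' has_integral u y - u (x - e)) {x - e..y}"
      using st by (intro weak_solD[OF u]) auto
    then show "u (x - e) + integral {x - e..y} u' = u y" by (simp add: integral_unique)
  qed (use e in auto)
qed

lemma weak_sol_imp_sl_eq:
  assumes ab: "a < b" and q: "locally_L1 a b q" and u: "weak_sol (einterval a b) (\<lambda>x. q x - r) u u'"
  shows "sl_eq a b q (\<lambda>x. of_real (u x)) (\<lambda>x. of_real (u' x)) (\<lambda>x. of_real r * of_real (u x))"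
proof -
  note k = locally_L1_loc_int[OF q, of r]
  note cont = weak_sol_continuous[OF u]
  have sub: "{x..y} \<subseteq> einterval a b" if "s \<le> x" "y \<le> t" "{s..t} \<subseteq> einterval a b" for s t x y
    using that by (meson atLeastatMost_subset_iff order_trans)
  have ac: "abs_cont_on s t (\<lambda>x. of_real (u x))" "abs_cont_on s t (\<lambda>x. of_real (u' x))" if st: "{s..t} \<subseteq> einterval a b" for s t
  proof -
    show "abs_cont_on s t (\<lambda>x. of_real (u x))"
    proof (rule abs_cont_on_indefinite_integral)
      show "(\<lambda>x. complex_of_real (u' x)) absolutely_integrable_on {s..t}"
        by (intro absolutely_integrable_complex_of_real absolutely_integrable_continuous_on cont st)
      fix x y assume "s \<le> x" "x \<le> y" "y \<le> t"
      then show "((\<lambda>x. complex_of_real (u' x)) has_integral of_real (u y) - of_real (u x)) {x..y}"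
        unfolding of_real_diff[symmetric] by (intro has_integral_complex_of_real weak_solD[OF u] sub[OF _ _ st])
    qed
    show "abs_cont_on s t (\<lambda>x. of_real (u' x))"
    proof (rule abs_cont_on_indefinite_integral)
      show "(\<lambda>x. complex_of_real ((q x - r) * u x)) absolutely_integrable_on {s..t}"
        by (intro absolutely_integrable_complex_of_real absolutely_integrable_mult_continuous loc_intD[OF k] cont st)
      fix x y assume "s \<le> x" "x \<le> y" "y \<le> t"
      then show "((\<lambda>x. complex_of_real ((q x - r) * u x)) has_integral of_real (u' y) - of_real (u' x)) {x..y}"
        unfolding of_real_diff[symmetric] by (intro has_integral_complex_of_real weak_solD[OF u] sub[OF _ _ st])
    qed
  qed
  \<comment> \<open>The exceptional set is found on each interval of a countable exhaustion by
    compact intervals, and the countable union is again negligible.\<close>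
  have "\<exists>N. negligible N \<and> (\<forall>x\<in>einterval a b - N. (u' has_vector_derivative (q x - r) * u x) (at x))"
  proof -
    obtain l m :: "nat \<Rightarrow> real" where E: "einterval a b = (\<Union>i. {l i..m i})"
      using einterval_Icc_approximation[OF ab] by metis
    have "\<exists>N. negligible N \<and> (\<forall>x\<in>{l i..m i} - N. (u' has_vector_derivative (q x - r) * u x) (at x))" for i
    proof -
      have lm: "{l i..m i} \<subseteq> einterval a b" using E by auto
      have "((\<lambda>x. (q x - r) * u x) has_integral u' y - u' x) {x..y}" if "l i \<le> x" "x \<le> y" "y \<le> m i" for x y
        by (rule weak_solD(2)[OF u that(2) sub[OF that(1,3) lm]])
      from indefinite_integral_derivative[of "l i" "m i" "\<lambda>x. (q x - r) * u x" u', OF this]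
      obtain N where "negligible N" "\<And>x. x \<in> {l i..m i} - N \<Longrightarrow> (u' has_vector_derivative (q x - r) * u x) (at x)"
        by blast
      then show ?thesis by blast
    qed
    then obtain N where N: "\<And>i. negligible (N i)"
       "\<And>i x. x \<in> {l i..m i} - N i \<Longrightarrow> (u' has_vector_derivative (q x - r) * u x) (at x)" by metis
    show ?thesis
    proof (intro exI[of _ "\<Union>i. N i"] conjI ballI)
      show "negligible (\<Union>i. N i)" by (intro negligible_countable_Union) (use N(1) in auto)
      fix x assume "x \<in> einterval a b - (\<Union>i. N i)"
      then show "(u' has_vector_derivative (q x - r) * u x) (at x)" using N(2) unfolding E by blast
    qed
  qed
  then have "AE x in lebesgue_on (einterval a b). (u' has_vector_derivative (q x - r) * u x) (at x)"
    by (simp add: AE_lebesgue_on_iff_negligible)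
  then have "AE x in lebesgue_on (einterval a b). \<exists>u''. ((\<lambda>x. complex_of_real (u' x)) has_vector_derivative u'') (at x) \<and>
      - u'' + of_real (q x) * of_real (u x) = of_real r * of_real (u x)"
  proof (rule eventually_mono)
    fix x assume "(u' has_vector_derivative (q x - r) * u x) (at x)"
    then have "((\<lambda>x. complex_of_real (u' x)) has_vector_derivative of_real ((q x - r) * u x)) (at x)"
      by (rule bounded_linear.has_vector_derivative[OF bounded_linear_of_real])
    then show "\<exists>u''. ((\<lambda>x. complex_of_real (u' x)) has_vector_derivative u'') (at x) \<and>
      - u'' + of_real (q x) * of_real (u x) = of_real r * of_real (u x)"
      by (intro exI conjI) (assumption, simp add: algebra_simps)
  qed
  moreover have "((\<lambda>x. complex_of_real (u x)) has_vector_derivative of_real (u' x)) (at x)" if "x \<in> einterval a b" for x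
    by (intro bounded_linear.has_vector_derivative[OF bounded_linear_of_real] weak_sol_has_derivative[OF u that])
  ultimately show ?thesis
    using ac by (auto simp: sl_eq_def locally_abs_cont_def)
qed

text \<open>At a regular endpoint the coefficient is integrable up to the endpoint, so extending it by
  zero lets the solutions be continued through it. Boundary values become ordinary values.\<close>

definition sol_region :: "ereal \<Rightarrow> ereal \<Rightarrow> (real \<Rightarrow> real) \<Rightarrow> real set" where
  "sol_region a b q = einterval a b \<union> {x. regular_left a b q \<and> x = real_of_ereal a}
     \<union> {x. regular_right a b q \<and> x = real_of_ereal b}"

definition sol_coeff :: "ereal \<Rightarrow> ereal \<Rightarrow> (real \<Rightarrow> real) \<Rightarrow> real \<Rightarrow> real \<Rightarrow> real" where
  "sol_coeff a b q r x = indicator (einterval a b) x * (q x - r)"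

lemma regular_leftD: "a < b \<Longrightarrow> regular_left a b q \<Longrightarrow> a = ereal (real_of_ereal a)"
  by (cases a) (auto simp: regular_left_def)

lemma regular_rightD: "a < b \<Longrightarrow> regular_right a b q \<Longrightarrow> b = ereal (real_of_ereal b)"
  by (cases b) (auto simp: regular_right_def)

lemma sol_region_mem:
  assumes "a < b" "x \<in> sol_region a b q"
  shows "a \<le> ereal x" "ereal x \<le> b"
  using assms regular_leftD[OF assms(1)] regular_rightD[OF assms(1)]
  by (auto simp: sol_region_def einterval_iff)

lemma is_interval_sol_region:
  assumes ab: "a < b"
  shows "is_interval (sol_region a b q)"
  unfolding is_interval_1
proof (intro ballI allI impI)
  fix x y z assume h: "x \<in> sol_region a b q" "y \<in> sol_region a b q" "x \<le> z \<and> z \<le> y"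
  show "z \<in> sol_region a b q"
  proof (cases "z = x \<or> z = y")
    case False
    then have "ereal x < ereal z" "ereal z < ereal y" using h by auto
    then have "a < ereal z" "ereal z < b"
      using le_less_trans[OF sol_region_mem(1)[OF ab h(1)]] less_le_trans[OF _ sol_region_mem(2)[OF ab h(2)]] by blast+
    then show ?thesis by (simp add: sol_region_def einterval_iff)
  qed (use h in auto)
qed

lemma sol_coeff_absolutely_integrable:
  assumes "q absolutely_integrable_on S" "S \<in> lmeasurable" "S \<subseteq> einterval a b"
  shows "sol_coeff a b q r absolutely_integrable_on S"
proof -
  have "(\<lambda>x. q x - r) absolutely_integrable_on S"
    using assms by (intro set_integral_diff(1) absolutely_integrable_on_const)
  moreover have "(\<lambda>x. indicator S x *\<^sub>R sol_coeff a b q r x) = (\<lambda>x. indicator S x *\<^sub>R (q x - r))"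
    using assms(3) by (auto simp: fun_eq_iff sol_coeff_def indicator_def)
  ultimately show ?thesis unfolding set_integrable_def by metis
qed

lemma sol_coeff_locally:
  assumes q: "locally_L1 a b q" and "s \<in> einterval a b" "t \<in> einterval a b"
  shows "sol_coeff a b q r absolutely_integrable_on {s..t}"
proof -
  have sub: "{s..t} \<subseteq> einterval a b" using is_interval_Icc_subset[OF is_interval_einterval assms(2,3)] .
  then have "q absolutely_integrable_on {s..t}" using q by (simp add: locally_L1_def)
  then show ?thesis using sub by (intro sol_coeff_absolutely_integrable) auto
qed

lemma sol_coeff_regular_left:
  assumes ab: "a < b" and q: "locally_L1 a b q" and reg: "regular_left a b q" and t: "t \<in> einterval a b"
  shows "sol_coeff a b q r absolutely_integrable_on {real_of_ereal a..t}"
proof -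
  define a0 where "a0 = real_of_ereal a"
  have a: "a = ereal a0" unfolding a0_def using regular_leftD[OF ab reg] .
  obtain c where c: "c \<in> einterval a b" "q absolutely_integrable_on einterval a (ereal c)"
    using reg by (auto simp: regular_left_def)
  have ac: "einterval a (ereal c) = {a0<..<c}" by (simp add: a)
  have "{a0<..<c} \<subseteq> einterval a b"
  proof
    fix x assume "x \<in> {a0<..<c}"
    then have "a < ereal x" "ereal x < ereal c" by (auto simp: a)
    then show "x \<in> einterval a b" using c(1) unfolding einterval_iff by (meson less_trans)
  qed
  then have 1: "sol_coeff a b q r absolutely_integrable_on {a0<..<c}"
    using c(2) unfolding ac by (intro sol_coeff_absolutely_integrable) auto
  have 2: "sol_coeff a b q r absolutely_integrable_on {c..t}" by (rule sol_coeff_locally[OF q c(1) t])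
  have 3: "sol_coeff a b q r absolutely_integrable_on {a0}" by (rule absolutely_integrable_negligible) auto
  have "sol_coeff a b q r absolutely_integrable_on ({a0} \<union> ({a0<..<c} \<union> {c..t}))"
    by (intro set_integrable_Un 1 2 3) auto
  then show ?thesis unfolding a0_def[symmetric]
    by (rule set_integrable_subset) auto
qed

lemma sol_coeff_regular_right:
  assumes ab: "a < b" and q: "locally_L1 a b q" and reg: "regular_right a b q" and t: "t \<in> einterval a b"
  shows "sol_coeff a b q r absolutely_integrable_on {t..real_of_ereal b}"
proof -
  define b0 where "b0 = real_of_ereal b"
  have b: "b = ereal b0" unfolding b0_def using regular_rightD[OF ab reg] .
  obtain c where c: "c \<in> einterval a b" "q absolutely_integrable_on einterval (ereal c) b"
    using reg by (auto simp: regular_right_def)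
  have cb: "einterval (ereal c) b = {c<..<b0}" by (simp add: b)
  have "{c<..<b0} \<subseteq> einterval a b"
  proof
    fix x assume "x \<in> {c<..<b0}"
    then have "ereal c < ereal x" "ereal x < b" by (auto simp: b)
    then show "x \<in> einterval a b" using c(1) unfolding einterval_iff by (meson less_trans)
  qed
  then have 1: "sol_coeff a b q r absolutely_integrable_on {c<..<b0}"
    using c(2) unfolding cb by (intro sol_coeff_absolutely_integrable) auto
  have 2: "sol_coeff a b q r absolutely_integrable_on {t..c}" by (rule sol_coeff_locally[OF q t c(1)])
  have 3: "sol_coeff a b q r absolutely_integrable_on {b0}" by (rule absolutely_integrable_negligible) auto
  have "sol_coeff a b q r absolutely_integrable_on ({b0} \<union> ({c<..<b0} \<union> {t..c}))"
    by (intro set_integrable_Un 1 2 3) auto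
  then show ?thesis unfolding b0_def[symmetric]
    by (rule set_integrable_subset) auto
qed

lemma loc_int_sol_coeff:
  assumes ab: "a < b" and q: "locally_L1 a b q"
  shows "loc_int (sol_region a b q) (sol_coeff a b q r)"
  unfolding loc_int_def
proof (intro allI impI)
  fix s t assume sub: "{s..t} \<subseteq> sol_region a b q"
  let ?k = "sol_coeff a b q r"
  consider "t \<le> s" | "s < t" by linarith
  then show "?k absolutely_integrable_on {s..t}"
  proof cases
    case 1
    then have "negligible {s..t}" by (cases "s = t") auto
    then show ?thesis by (rule absolutely_integrable_negligible)
  next
    case 2
    then have st: "s \<in> sol_region a b q" "t \<in> sol_region a b q" using sub by auto
    have "ereal s < b" "a < ereal t"
      using 2 sol_region_mem(2)[OF ab st(2)] sol_region_mem(1)[OF ab st(1)]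
      by (metis less_ereal.simps(1) less_le_trans, metis less_ereal.simps(1) le_less_trans)
    then have s: "s \<in> einterval a b \<or> regular_left a b q \<and> s = real_of_ereal a"
      and t: "t \<in> einterval a b \<or> regular_right a b q \<and> t = real_of_ereal b"
      using st regular_rightD[OF ab] regular_leftD[OF ab] unfolding sol_region_def by auto
    obtain m where m: "m \<in> einterval a b" using einterval_nonempty[OF ab] by auto
    have l: "?k absolutely_integrable_on {s..m}"
      using s sol_coeff_locally[OF q _ m] sol_coeff_regular_left[OF ab q _ m] by blast
    have r: "?k absolutely_integrable_on {m..t}"
      using t sol_coeff_locally[OF q m] sol_coeff_regular_right[OF ab q _ m] by blast
    have "?k absolutely_integrable_on {s..m} \<union> {m..t}" by (intro set_integrable_Un l r) auto
    then show ?thesis by (rule set_integrable_subset) auto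
  qed
qed

lemma einterval_subset_sol_region: "einterval a b \<subseteq> sol_region a b q"
  by (auto simp: sol_region_def)

lemma Icc_subset_sol_region_left:
  assumes "a < b" "regular_left a b q" "t \<in> einterval a b"
  shows "{real_of_ereal a..t} \<subseteq> sol_region a b q"
  using assms by (intro is_interval_Icc_subset is_interval_sol_region) (auto simp: sol_region_def)

lemma Icc_subset_sol_region_right:
  assumes "a < b" "regular_right a b q" "t \<in> einterval a b"
  shows "{t..real_of_ereal b} \<subseteq> sol_region a b q"
  using assms by (intro is_interval_Icc_subset is_interval_sol_region) (auto simp: sol_region_def)

lemma regular_left_less:
  assumes "a < b" "regular_left a b q" "m \<in> einterval a b"
  shows "real_of_ereal a < m"
  using assms(3) regular_leftD[OF assms(1,2)] by (metis einterval_iff less_ereal.simps(1))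

lemma regular_right_less:
  assumes "a < b" "regular_right a b q" "m \<in> einterval a b"
  shows "m < real_of_ereal b"
  using assms(3) regular_rightD[OF assms(1,2)] by (metis einterval_iff less_ereal.simps(1))

lemma weak_sol_tendsto_left:
  assumes ab: "a < b" and v: "weak_sol (sol_region a b q) k v v'" and reg: "regular_left a b q"
  shows "(v \<longlongrightarrow> v (real_of_ereal a)) (at_right (real_of_ereal a))"
    "(v' \<longlongrightarrow> v' (real_of_ereal a)) (at_right (real_of_ereal a))"
proof -
  obtain m where m: "m \<in> einterval a b" using einterval_nonempty[OF ab] by auto
  have lt: "real_of_ereal a < m" by (rule regular_left_less[OF ab reg m])
  from weak_sol_continuous[OF v Icc_subset_sol_region_left[OF ab reg m]] show "(v \<longlongrightarrow> v (real_of_ereal a)) (at_right (real_of_ereal a))"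
    "(v' \<longlongrightarrow> v' (real_of_ereal a)) (at_right (real_of_ereal a))"
    using lt by (auto intro: continuous_on_Icc_at_rightD)
qed

lemma weak_sol_tendsto_right:
  assumes ab: "a < b" and v: "weak_sol (sol_region a b q) k v v'" and reg: "regular_right a b q"
  shows "(v \<longlongrightarrow> v (real_of_ereal b)) (at_left (real_of_ereal b))"
    "(v' \<longlongrightarrow> v' (real_of_ereal b)) (at_left (real_of_ereal b))"
proof -
  obtain m where m: "m \<in> einterval a b" using einterval_nonempty[OF ab] by auto
  have lt: "m < real_of_ereal b" by (rule regular_right_less[OF ab reg m])
  from weak_sol_continuous[OF v Icc_subset_sol_region_right[OF ab reg m]] show "(v \<longlongrightarrow> v (real_of_ereal b)) (at_left (real_of_ereal b))"
    "(v' \<longlongrightarrow> v' (real_of_ereal b)) (at_left (real_of_ereal b))"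
    using lt by (auto intro: continuous_on_Icc_at_leftD)
qed

lemma eventually_in_einterval_left:
  assumes ab: "a < b" and reg: "regular_left a b q"
  shows "\<forall>\<^sub>F x in at_right (real_of_ereal a). x \<in> einterval a b"
proof -
  obtain m where m: "m \<in> einterval a b" using einterval_nonempty[OF ab] by auto
  have lt: "real_of_ereal a < m" by (rule regular_left_less[OF ab reg m])
  show ?thesis unfolding eventually_at_right[OF lt]
  proof (intro exI[of _ m] conjI lt allI impI)
    fix y assume "y > real_of_ereal a" "y < m"
    then have "a < ereal y" "ereal y < ereal m" using regular_leftD[OF ab reg] by (metis less_ereal.simps(1))+
    then show "y \<in> einterval a b" using m unfolding einterval_iff by (meson less_trans)
  qed
qed

lemma eventually_in_einterval_right:
  assumes ab: "a < b" and reg: "regular_right a b q"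
  shows "\<forall>\<^sub>F x in at_left (real_of_ereal b). x \<in> einterval a b"
proof -
  obtain m where m: "m \<in> einterval a b" using einterval_nonempty[OF ab] by auto
  have lt: "m < real_of_ereal b" by (rule regular_right_less[OF ab reg m])
  show ?thesis unfolding eventually_at_left[OF lt]
  proof (intro exI[of _ m] conjI lt allI impI)
    fix y assume "y > m" "y < real_of_ereal b"
    then have "ereal m < ereal y" "ereal y < b" using regular_rightD[OF ab reg] by (metis less_ereal.simps(1))+
    then show "y \<in> einterval a b" using m unfolding einterval_iff by (meson less_trans)
  qed
qed

section \<open>Eigenfunctions encoded by normalised Cauchy data\<close>

definition bdry :: "real \<Rightarrow> (real \<Rightarrow> real) \<Rightarrow> (real \<Rightarrow> real) \<Rightarrow> real \<Rightarrow> real" where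
  "bdry \<gamma> u u' x = u x * cos \<gamma> + u' x * sin \<gamma>"

text \<open>(A, B) are the Cauchy data of the eigenfunction at x0. Normalisation excludes the zero
  solution and makes the set of candidates compact. The boundary conditions refer to values of the
  solution continued to the endpoint.\<close>

definition eigen_data :: "ereal \<Rightarrow> ereal \<Rightarrow> real \<Rightarrow> real \<Rightarrow> (real \<Rightarrow> real) \<Rightarrow> real \<Rightarrow> real \<Rightarrow> real \<Rightarrow> real \<Rightarrow> bool" where
  "eigen_data a b \<alpha> \<beta> q r x0 A B \<longleftrightarrow> A\<^sup>2 + B\<^sup>2 = 1 \<and>
     set_integrable lebesgue (einterval a b) (\<lambda>x. (ivp_sol (sol_coeff a b q r) x0 A B x)\<^sup>2) \<and>
     (regular_left a b q \<longrightarrow>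
       bdry \<alpha> (ivp_sol (sol_coeff a b q r) x0 A B) (ivp_deriv (sol_coeff a b q r) x0 A B) (real_of_ereal a) = 0) \<and>
     (regular_right a b q \<longrightarrow>
       bdry \<beta> (ivp_sol (sol_coeff a b q r) x0 A B) (ivp_deriv (sol_coeff a b q r) x0 A B) (real_of_ereal b) = 0)"

lemma weak_sol_continuous_on_einterval:
  "weak_sol (einterval a b) k u u' \<Longrightarrow> continuous_on (einterval a b) u"
  by (meson continuous_at_imp_continuous_on has_vector_derivative_continuous weak_sol_has_derivative)

lemma weak_sol_coeff_einterval:
  "weak_sol (einterval a b) (sol_coeff a b q r) u u' \<longleftrightarrow> weak_sol (einterval a b) (\<lambda>x. q x - r) u u'"
proof -
  have *: "sol_coeff a b q r x = q x - r" if "x \<in> einterval a b" for x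
    using that by (simp add: sol_coeff_def)
  show ?thesis
    using weak_sol_cong[of "einterval a b" "sol_coeff a b q r" u u' "\<lambda>x. q x - r"]
      weak_sol_cong[of "einterval a b" "\<lambda>x. q x - r" u u' "sol_coeff a b q r"] * by fastforce
qed

lemma ivp_sol_weak_sol_region:
  assumes "a < b" "locally_L1 a b q" "x0 \<in> einterval a b"
  shows "weak_sol (sol_region a b q) (sol_coeff a b q r) (ivp_sol (sol_coeff a b q r) x0 A B) (ivp_deriv (sol_coeff a b q r) x0 A B)"
  using assms einterval_subset_sol_region by (intro ivp_sol_weak_sol is_interval_sol_region loc_int_sol_coeff) auto

lemma ivp_sol_weak_sol_einterval:
  assumes "a < b" "locally_L1 a b q" "x0 \<in> einterval a b"
  shows "weak_sol (einterval a b) (\<lambda>x. q x - r) (ivp_sol (sol_coeff a b q r) x0 A B) (ivp_deriv (sol_coeff a b q r) x0 A B)"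
  using weak_sol_subset[OF ivp_sol_weak_sol_region[OF assms] einterval_subset_sol_region]
  by (simp add: weak_sol_coeff_einterval)

lemma borel_measurable_weak_sol:
  assumes "weak_sol (einterval a b) k u u'"
  shows "u \<in> borel_measurable (lebesgue_on (einterval a b))"
  by (intro continuous_imp_measurable_on_sets_lebesgue weak_sol_continuous_on_einterval[OF assms]) simp

text \<open>If u vanishes almost everywhere, then k * u integrates to 0, so u' is constant and u is
  affine; zeros at two different points outside the null set make it vanish.\<close>

lemma weak_sol_AE_zero_imp:
  assumes ab: "a < b" and q: "loc_int (einterval a b) k" and u: "weak_sol (einterval a b) k u u'"
    and ae: "AE x in lebesgue_on (einterval a b). u x = 0" and x: "x \<in> einterval a b"
  shows "u x = 0" "u' x = 0"
proof -
  obtain N where N: "negligible N" "\<And>x. x \<in> einterval a b - N \<Longrightarrow> u x = 0"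
    using ae by (auto simp: AE_lebesgue_on_iff_negligible)
  have sub: "{s..t} \<subseteq> einterval a b" if "s \<in> einterval a b" "t \<in> einterval a b" for s t
    using that by (rule is_interval_Icc_subset[OF is_interval_einterval])
  have const: "u' t = u' s" if "s \<in> einterval a b" "t \<in> einterval a b" "s \<le> t" for s t
  proof -
    have "((\<lambda>x. k x * u x) has_integral u' t - u' s) {s..t}" by (rule weak_solD(2)[OF u that(3) sub[OF that(1,2)]])
    moreover have "((\<lambda>x. k x * u x) has_integral 0) {s..t}"
      by (rule has_integral_spike[OF N(1) _ has_integral_0]) (use N(2) sub[OF that(1,2)] in auto)
    ultimately have "u' t - u' s = 0" by (rule has_integral_unique)
    then show ?thesis by simp
  qed
  have const': "u' t = u' x" if "t \<in> einterval a b" for t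
    using const[OF x that] const[OF that x] by linarith
  have affine: "u t - u s = u' x * (t - s)" if "s \<in> einterval a b" "t \<in> einterval a b" "s \<le> t" for s t
  proof -
    have "(u' has_integral u t - u s) {s..t}" by (rule weak_solD(1)[OF u that(3) sub[OF that(1,2)]])
    then have "((\<lambda>_. u' x) has_integral u t - u s) {s..t}"
      by (rule has_integral_eq[rotated]) (use const' sub[OF that(1,2)] in auto)
    moreover have "((\<lambda>_. u' x) has_integral u' x * (t - s)) {s..t}"
      using has_integral_const_real[of "u' x" s t] that(3) by (simp add: mult.commute)
    ultimately show ?thesis by (rule has_integral_unique)
  qed
  have "\<not> negligible (einterval a b)"
    using open_not_negligible[of "einterval a b"] x by auto
  then have "\<not> einterval a b \<subseteq> insert y N" for y
    using N(1) negligible_subset negligible_insert by metis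
  then obtain x1 x2 where x12: "x1 \<in> einterval a b - N" "x2 \<in> einterval a b - N" "x1 \<noteq> x2"
    by (metis DiffI insertCI insertI1 insert_iff subsetI)
  have "u' x * (x2 - x1) = 0"
    using affine[of x1 x2] affine[of x2 x1] N(2)[OF x12(1)] N(2)[OF x12(2)] x12
    by (cases "x1 \<le> x2") auto
  then show "u' x = 0" using x12(3) by simp
  then show "u x = 0"
    using affine[of x1 x] affine[of x x1] N(2)[OF x12(1)] x12 x by (cases "x1 \<le> x") auto
qed

text \<open>Equation and boundary conditions have real coefficients, so the real and imaginary parts
  of an eigenfunction satisfy them separately, and at a point where the eigenfunction is nonzero one
  of the two is nonzero.\<close>

lemma point_spectrum_real_solution:
  assumes ab: "a < b" and r: "r \<in> point_spectrum a b (sl_operator a b \<alpha> \<beta> q)"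
  obtains v v' z where "weak_sol (einterval a b) (\<lambda>x. q x - r) v v'" "z \<in> einterval a b" "v z \<noteq> 0"
    "set_integrable lebesgue (einterval a b) (\<lambda>x. (v x)\<^sup>2)"
    "regular_left a b q \<longrightarrow> (\<exists>y y'. (v \<longlongrightarrow> y) (at_right (real_of_ereal a)) \<and>
       (v' \<longlongrightarrow> y') (at_right (real_of_ereal a)) \<and> y * cos \<alpha> + y' * sin \<alpha> = 0)"
    "regular_right a b q \<longrightarrow> (\<exists>y y'. (v \<longlongrightarrow> y) (at_left (real_of_ereal b)) \<and>
       (v' \<longlongrightarrow> y') (at_left (real_of_ereal b)) \<and> y * cos \<beta> + y' * sin \<beta> = 0)"
proof -
  let ?E = "einterval a b"
  from r obtain \<phi> u u' where \<phi>: "\<phi> \<in> L2 a b" "AE x in lebesgue_on ?E. \<phi> x = u x"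
    "sl_eq a b q u u' (\<lambda>x. of_real r * \<phi> x)"
    "regular_left a b q \<longrightarrow> bc_left a \<alpha> u u'" "regular_right a b q \<longrightarrow> bc_right b \<beta> u u'"
    "\<not> (AE x in lebesgue_on ?E. \<phi> x = 0)"
    unfolding point_spectrum_def sl_operator_def by auto
  have "AE x in lebesgue_on ?E. of_real r * \<phi> x = of_real r * u x" using \<phi>(2) by auto
  note ws = sl_eq_imp_weak_sol[OF \<phi>(3) this]
  have "\<exists>z\<in>?E. u z \<noteq> 0"
  proof (rule ccontr)
    assume "\<not> (\<exists>z\<in>?E. u z \<noteq> 0)"
    then have "AE x in lebesgue_on ?E. \<phi> x = 0"
      using \<phi>(2) by (elim AE_mp) (auto intro!: AE_I2)
    then show False using \<phi>(6) by simp
  qed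
  then obtain z where z: "z \<in> ?E" "u z \<noteq> 0" by auto
  have int: "set_integrable lebesgue ?E (\<lambda>x. (v x)\<^sup>2)"
    if v: "weak_sol ?E k v v'" and le: "\<And>x. \<bar>v x\<bar> \<le> norm (u x)" for v v' k
  proof -
    have [measurable]: "v \<in> borel_measurable (lebesgue_on ?E)" by (rule borel_measurable_weak_sol[OF v])
    have "integrable (lebesgue_on ?E) (\<lambda>x. (v x)\<^sup>2)"
    proof (rule Bochner_Integration.integrable_bound)
      show "integrable (lebesgue_on ?E) (\<lambda>x. (norm (\<phi> x))\<^sup>2)" using \<phi>(1) by (simp add: L2_def)
      show "AE x in lebesgue_on ?E. norm ((v x)\<^sup>2) \<le> norm ((norm (\<phi> x))\<^sup>2)"
      proof (rule eventually_mono[OF \<phi>(2)])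
        fix x assume "\<phi> x = u x"
        then show "norm ((v x)\<^sup>2) \<le> norm ((norm (\<phi> x))\<^sup>2)"
          using power_mono[OF le[of x] abs_ge_zero, of 2] by simp
      qed
    qed measurable
    then show ?thesis by (simp add: integrable_restrict_space set_integrable_def)
  qed
  have bcl: "\<exists>ua ua'. (u \<longlongrightarrow> ua) (at_right (real_of_ereal a)) \<and> (u' \<longlongrightarrow> ua') (at_right (real_of_ereal a)) \<and>
       ua * of_real (cos \<alpha>) + ua' * of_real (sin \<alpha>) = 0" if "regular_left a b q"
    using \<phi>(4) that by (simp add: bc_left_def)
  have bcr: "\<exists>ua ua'. (u \<longlongrightarrow> ua) (at_left (real_of_ereal b)) \<and> (u' \<longlongrightarrow> ua') (at_left (real_of_ereal b)) \<and>
       ua * of_real (cos \<beta>) + ua' * of_real (sin \<beta>) = 0" if "regular_right a b q"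
    using \<phi>(5) that by (simp add: bc_right_def)
  have re: "\<exists>y y'. ((\<lambda>x. Re (u x)) \<longlongrightarrow> y) F \<and> ((\<lambda>x. Re (u' x)) \<longlongrightarrow> y') F \<and> y * cos \<gamma> + y' * sin \<gamma> = 0"
    and im: "\<exists>y y'. ((\<lambda>x. Im (u x)) \<longlongrightarrow> y) F \<and> ((\<lambda>x. Im (u' x)) \<longlongrightarrow> y') F \<and> y * cos \<gamma> + y' * sin \<gamma> = 0"
    if h: "\<exists>ua ua'. (u \<longlongrightarrow> ua) F \<and> (u' \<longlongrightarrow> ua') F \<and> ua * of_real (cos \<gamma>) + ua' * of_real (sin \<gamma>) = 0" for F \<gamma>
  proof -
    from h obtain ua ua' where h: "(u \<longlongrightarrow> ua) F" "(u' \<longlongrightarrow> ua') F" "ua * of_real (cos \<gamma>) + ua' * of_real (sin \<gamma>) = 0"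
      by blast
    have "Re (ua * of_real (cos \<gamma>) + ua' * of_real (sin \<gamma>)) = 0" "Im (ua * of_real (cos \<gamma>) + ua' * of_real (sin \<gamma>)) = 0"
      unfolding h(3) by simp_all
    then have "Re ua * cos \<gamma> + Re ua' * sin \<gamma> = 0" "Im ua * cos \<gamma> + Im ua' * sin \<gamma> = 0" by simp_all
    then show "\<exists>y y'. ((\<lambda>x. Re (u x)) \<longlongrightarrow> y) F \<and> ((\<lambda>x. Re (u' x)) \<longlongrightarrow> y') F \<and> y * cos \<gamma> + y' * sin \<gamma> = 0"
      "\<exists>y y'. ((\<lambda>x. Im (u x)) \<longlongrightarrow> y) F \<and> ((\<lambda>x. Im (u' x)) \<longlongrightarrow> y') F \<and> y * cos \<gamma> + y' * sin \<gamma> = 0"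
      using h(1,2) tendsto_Re tendsto_Im by blast+
  qed
  from z(2) consider "Re (u z) \<noteq> 0" | "Im (u z) \<noteq> 0" by (auto simp: complex_eq_iff)
  then show ?thesis
  proof cases
    case 1
    have "set_integrable lebesgue ?E (\<lambda>x. (Re (u x))\<^sup>2)" by (rule int[OF ws(1) abs_Re_le_cmod])
    from that[OF ws(1) z(1) 1 this] show ?thesis using re[OF bcl] re[OF bcr] by blast
  next
    case 2
    have "set_integrable lebesgue ?E (\<lambda>x. (Im (u x))\<^sup>2)" by (rule int[OF ws(2) abs_Im_le_cmod])
    from that[OF ws(2) z(1) 2 this] show ?thesis using im[OF bcl] im[OF bcr] by blast
  qed
qed

text \<open>A real eigenfunction is divided by the length of its Cauchy data at x0, which is
  positive by uniqueness. Conversely, a solution with unit Cauchy data cannot vanish almost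
  everywhere.\<close>

theorem point_spectrum_iff_eigen_data:
  assumes ab: "a < b" and q: "locally_L1 a b q" and x0: "x0 \<in> einterval a b"
  shows "r \<in> point_spectrum a b (sl_operator a b \<alpha> \<beta> q) \<longleftrightarrow> (\<exists>A B. eigen_data a b \<alpha> \<beta> q r x0 A B)"
proof
  let ?E = "einterval a b" and ?k = "sol_coeff a b q r"
  note k = locally_L1_loc_int[OF q, of r]
  note kk = loc_int_subset[OF loc_int_sol_coeff[OF ab q] einterval_subset_sol_region, of r]
  note wr = ivp_sol_weak_sol_region[OF ab q x0, of r]
  note we = ivp_sol_weak_sol_einterval[OF ab q x0, of r]
  note we' = we[folded weak_sol_coeff_einterval]
  note rep = weak_sol_eq_ivp_sol[OF is_interval_einterval x0 kk]
  {
    assume "r \<in> point_spectrum a b (sl_operator a b \<alpha> \<beta> q)"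
    from point_spectrum_real_solution[OF ab this] obtain v v' z where
      v: "weak_sol ?E (\<lambda>x. q x - r) v v'" and z: "z \<in> ?E" "v z \<noteq> 0"
      and int: "set_integrable lebesgue ?E (\<lambda>x. (v x)\<^sup>2)"
      and bl: "regular_left a b q \<longrightarrow> (\<exists>y y'. (v \<longlongrightarrow> y) (at_right (real_of_ereal a)) \<and>
         (v' \<longlongrightarrow> y') (at_right (real_of_ereal a)) \<and> y * cos \<alpha> + y' * sin \<alpha> = 0)"
      and br: "regular_right a b q \<longrightarrow> (\<exists>y y'. (v \<longlongrightarrow> y) (at_left (real_of_ereal b)) \<and>
         (v' \<longlongrightarrow> y') (at_left (real_of_ereal b)) \<and> y * cos \<beta> + y' * sin \<beta> = 0)"
      by blast
    have v': "weak_sol ?E ?k v v'" using v by (simp add: weak_sol_coeff_einterval)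
    define n where "n = sqrt ((v x0)\<^sup>2 + (v' x0)\<^sup>2)"
    have "\<not> (v x0 = 0 \<and> v' x0 = 0)" using rep(1)[OF v' z(1)] z(2) by auto
    then have n2: "(v x0)\<^sup>2 + (v' x0)\<^sup>2 > 0" by (simp add: sum_power2_gt_zero_iff)
    then have n: "n > 0" "n\<^sup>2 = (v x0)\<^sup>2 + (v' x0)\<^sup>2" by (simp_all add: n_def)
    define A where "A = v x0 / n"
    define B where "B = v' x0 / n"
    define w where "w = ivp_sol ?k x0 A B"
    define w' where "w' = ivp_deriv ?k x0 A B"
    have w: "w x = v x / n" "w' x = v' x / n" if "x \<in> ?E" for x
      using rep[OF v' that] rep[OF we'[of A B] that] by (simp_all add: w_def w'_def A_def B_def add_divide_distrib)
    have one: "A\<^sup>2 + B\<^sup>2 = 1" using n(1) by (simp only: A_def B_def power_divide add_divide_distrib[symmetric] n(2)[symmetric]) simp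
    have "set_integrable lebesgue ?E (\<lambda>x. (v x)\<^sup>2 / n\<^sup>2)" using int by (rule set_integrable_divide)
    moreover have "(\<lambda>x. indicator ?E x *\<^sub>R ((v x)\<^sup>2 / n\<^sup>2)) = (\<lambda>x. indicator ?E x *\<^sub>R (w x)\<^sup>2)"
      using w by (auto simp: fun_eq_iff indicator_def power_divide)
    ultimately have intw: "set_integrable lebesgue ?E (\<lambda>x. (w x)\<^sup>2)"
      unfolding set_integrable_def by simp
    \<comment> \<open>The operator constrains limits of v taken inside the open interval,
      \<open>eigen_data\<close> constrains the value of the continued solution w at the endpoint.
      Continuity of w there and uniqueness of limits identify the two.\<close>
    have bd: "bdry \<gamma> w w' p = 0"
      if h: "\<exists>y y'. (v \<longlongrightarrow> y) F \<and> (v' \<longlongrightarrow> y') F \<and> y * cos \<gamma> + y' * sin \<gamma> = 0"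
        and ev: "\<forall>\<^sub>F x in F. x \<in> ?E" and lim: "(w \<longlongrightarrow> w p) F" "(w' \<longlongrightarrow> w' p) F" and F: "F \<noteq> bot" for F \<gamma> p
    proof -
      from h obtain y y' where y: "(v \<longlongrightarrow> y) F" "(v' \<longlongrightarrow> y') F" "y * cos \<gamma> + y' * sin \<gamma> = 0" by blast
      have "(w \<longlongrightarrow> y / n) F"
        by (rule Lim_transform_eventually[OF tendsto_divide[OF y(1) tendsto_const]])
           (use ev w n in \<open>auto elim!: eventually_mono\<close>)
      then have 1: "w p = y / n" using lim(1) F tendsto_unique by blast
      have "(w' \<longlongrightarrow> y' / n) F"
        by (rule Lim_transform_eventually[OF tendsto_divide[OF y(2) tendsto_const]])
           (use ev w n in \<open>auto elim!: eventually_mono\<close>)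
      then have 2: "w' p = y' / n" using lim(2) F tendsto_unique by blast
      show ?thesis using y(3) by (simp add: bdry_def 1 2 flip: add_divide_distrib)
    qed
    have "eigen_data a b \<alpha> \<beta> q r x0 A B"
      unfolding eigen_data_def w_def[symmetric] w'_def[symmetric]
    proof (intro conjI impI one intw)
      assume reg: "regular_left a b q"
      show "bdry \<alpha> w w' (real_of_ereal a) = 0"
        by (rule bd[OF bl[rule_format, OF reg] eventually_in_einterval_left[OF ab reg]])
           (simp_all add: w_def w'_def weak_sol_tendsto_left[OF ab wr reg])
    next
      assume reg: "regular_right a b q"
      show "bdry \<beta> w w' (real_of_ereal b) = 0"
        by (rule bd[OF br[rule_format, OF reg] eventually_in_einterval_right[OF ab reg]])
           (simp_all add: w_def w'_def weak_sol_tendsto_right[OF ab wr reg])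
    qed
    then show "\<exists>A B. eigen_data a b \<alpha> \<beta> q r x0 A B" by blast
  }
  {
    assume "\<exists>A B. eigen_data a b \<alpha> \<beta> q r x0 A B"
    then obtain A B where e: "eigen_data a b \<alpha> \<beta> q r x0 A B" by blast
    define w where "w = ivp_sol ?k x0 A B"
    define w' where "w' = ivp_deriv ?k x0 A B"
    note e = e[unfolded eigen_data_def, folded w_def w'_def]
    have w: "weak_sol ?E (\<lambda>x. q x - r) w w'" unfolding w_def w'_def by (rule we)
    have [measurable]: "w \<in> borel_measurable (lebesgue_on ?E)" by (rule borel_measurable_weak_sol[OF w])
    have int: "integrable (lebesgue_on ?E) (\<lambda>x. (w x)\<^sup>2)"
      using e by (simp add: integrable_restrict_space set_integrable_def)
    have L2: "(\<lambda>x. complex_of_real (w x)) \<in> L2 a b"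
      using int by (simp add: L2_def)
    have L2': "(\<lambda>x. complex_of_real r * complex_of_real (w x)) \<in> L2 a b"
      using int by (simp add: L2_def norm_mult power_mult_distrib)
    have bc: "\<exists>ua ua'. ((\<lambda>x. complex_of_real (w x)) \<longlongrightarrow> ua) F \<and> ((\<lambda>x. complex_of_real (w' x)) \<longlongrightarrow> ua') F \<and>
         ua * of_real (cos \<gamma>) + ua' * of_real (sin \<gamma>) = 0"
      if "bdry \<gamma> w w' p = 0" "(w \<longlongrightarrow> w p) F" "(w' \<longlongrightarrow> w' p) F" for F \<gamma> p
    proof (intro exI conjI)
      show "((\<lambda>x. complex_of_real (w x)) \<longlongrightarrow> of_real (w p)) F" "((\<lambda>x. complex_of_real (w' x)) \<longlongrightarrow> of_real (w' p)) F"
        using that by (auto intro: tendsto_of_real)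
      show "complex_of_real (w p) * of_real (cos \<gamma>) + of_real (w' p) * of_real (sin \<gamma>) = 0"
        using that(1) by (simp add: bdry_def flip: of_real_mult of_real_add)
    qed
    have "((\<lambda>x. complex_of_real (w x)), (\<lambda>x. of_real r * complex_of_real (w x))) \<in> sl_operator a b \<alpha> \<beta> q"
      unfolding sl_operator_def mem_Collect_eq prod.case
    proof (intro conjI L2 L2' exI)
      show "sl_eq a b q (\<lambda>x. complex_of_real (w x)) (\<lambda>x. complex_of_real (w' x)) (\<lambda>x. of_real r * complex_of_real (w x))"
        by (rule weak_sol_imp_sl_eq[OF ab q w])
      show "regular_left a b q \<longrightarrow> bc_left a \<alpha> (\<lambda>x. complex_of_real (w x)) (\<lambda>x. complex_of_real (w' x))"
        unfolding bc_left_def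
      proof
        assume reg: "regular_left a b q"
        show "\<exists>ua ua'. ((\<lambda>x. complex_of_real (w x)) \<longlongrightarrow> ua) (at_right (real_of_ereal a)) \<and>
          ((\<lambda>x. complex_of_real (w' x)) \<longlongrightarrow> ua') (at_right (real_of_ereal a)) \<and>
          ua * of_real (cos \<alpha>) + ua' * of_real (sin \<alpha>) = 0"
          by (rule bc[where p="real_of_ereal a"])
            (use e reg in \<open>simp_all add: w_def w'_def weak_sol_tendsto_left[OF ab wr reg]\<close>)
      qed
      show "regular_right a b q \<longrightarrow> bc_right b \<beta> (\<lambda>x. complex_of_real (w x)) (\<lambda>x. complex_of_real (w' x))"
        unfolding bc_right_def
      proof
        assume reg: "regular_right a b q"
        show "\<exists>ua ua'. ((\<lambda>x. complex_of_real (w x)) \<longlongrightarrow> ua) (at_left (real_of_ereal b)) \<and>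
          ((\<lambda>x. complex_of_real (w' x)) \<longlongrightarrow> ua') (at_left (real_of_ereal b)) \<and>
          ua * of_real (cos \<beta>) + ua' * of_real (sin \<beta>) = 0"
          by (rule bc[where p="real_of_ereal b"])
            (use e reg in \<open>simp_all add: w_def w'_def weak_sol_tendsto_right[OF ab wr reg]\<close>)
      qed
    qed simp
    moreover have "\<not> (AE x in lebesgue_on ?E. complex_of_real (w x) = 0)"
    proof
      assume "AE x in lebesgue_on ?E. complex_of_real (w x) = 0"
      then have "AE x in lebesgue_on ?E. w x = 0" by simp
      from weak_sol_AE_zero_imp[OF ab k w this x0] have "A = 0" "B = 0" by (simp_all add: w_def w'_def)
      then show False using e by simp
    qed
    ultimately show "r \<in> point_spectrum a b (sl_operator a b \<alpha> \<beta> q)"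
      unfolding point_spectrum_def by blast
  }
qed

section \<open>Orthogonality of eigenfunctions and countability\<close>

text \<open>Both Cauchy vectors at p are orthogonal to (cos \<gamma>, sin \<gamma>) and hence
  parallel. Multiplied by the cosine or by the sine, the Wronskian is a combination of the two
  boundary forms, and cosine and sine do not vanish together.\<close>

lemma wronskian_zero_of_bdry:
  assumes "bdry \<gamma> u u' p = 0" "bdry \<gamma> w w' p = 0"
  shows "wronskian u u' w w' p = 0"
proof -
  have "wronskian u u' w w' p * cos \<gamma> = bdry \<gamma> u u' p * w' p - u' p * bdry \<gamma> w w' p"
    "wronskian u u' w w' p * sin \<gamma> = u p * bdry \<gamma> w w' p - bdry \<gamma> u u' p * w p"
    by (simp_all add: wronskian_def bdry_def algebra_simps)
  then have "wronskian u u' w w' p * cos \<gamma> = 0" "wronskian u u' w w' p * sin \<gamma> = 0"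
    using assms by simp_all
  then show ?thesis using sin_cos_squared_add[of \<gamma>] by (cases "cos \<gamma> = 0") auto
qed

text \<open>Two solutions with nonzero Wronskian span all solutions, so y is a combination of two
  square integrable functions.\<close>

lemma square_integrable_of_independent:
  assumes k: "loc_int S k" and S: "is_interval S" "z \<in> S" and J: "J \<subseteq> S" "J \<in> sets lebesgue"
    and u: "weak_sol S k u u'" "set_integrable lebesgue J (\<lambda>x. (u x)\<^sup>2)"
    and w: "weak_sol S k w w'" "set_integrable lebesgue J (\<lambda>x. (w x)\<^sup>2)"
    and W: "wronskian u u' w w' z \<noteq> 0"
    and y: "weak_sol S k y y'" "y \<in> borel_measurable (lebesgue_on J)"
  shows "set_integrable lebesgue J (\<lambda>x. (y x)\<^sup>2)"
proof -
  define C where "C = wronskian y y' w w' z / wronskian u u' w w' z"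
  define D where "D = wronskian u u' y y' z / wronskian u u' w w' z"
  have rep: "y x = C * u x + D * w x" if "x \<in> J" for x
    using weak_sol_representation(1)[OF k S(1) _ S(2) y(1) u(1) w(1), of x] that J(1) W
    by (auto simp: C_def D_def field_simps)
  have iff: "set_integrable lebesgue J g \<longleftrightarrow> integrable (lebesgue_on J) g" for g :: "real \<Rightarrow> real"
    using J(2) by (simp add: integrable_restrict_space set_integrable_def)
  show ?thesis unfolding iff
  proof (rule Bochner_Integration.integrable_bound)
    show "integrable (lebesgue_on J) (\<lambda>x. 2 * C\<^sup>2 * (u x)\<^sup>2 + 2 * D\<^sup>2 * (w x)\<^sup>2)"
      using u(2) w(2) unfolding iff by (intro Bochner_Integration.integrable_add integrable_mult_right)
    show "AE x in lebesgue_on J. norm ((y x)\<^sup>2) \<le> norm (2 * C\<^sup>2 * (u x)\<^sup>2 + 2 * D\<^sup>2 * (w x)\<^sup>2)"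
    proof (rule AE_I2)
      fix x assume "x \<in> space (lebesgue_on J)"
      then have "x \<in> J" by simp
      moreover have "(C * u x + D * w x)\<^sup>2 \<le> 2 * C\<^sup>2 * (u x)\<^sup>2 + 2 * D\<^sup>2 * (w x)\<^sup>2"
        using sum_squares_bound[of "C * u x" "D * w x"] by (simp add: power2_sum power_mult_distrib algebra_simps)
      ultimately show "norm ((y x)\<^sup>2) \<le> norm (2 * C\<^sup>2 * (u x)\<^sup>2 + 2 * D\<^sup>2 * (w x)\<^sup>2)"
        using rep by simp
    qed
    show "(\<lambda>x. (y x)\<^sup>2) \<in> borel_measurable (lebesgue_on J)" using y(2) by measurable
  qed
qed

text \<open>With a nonzero Wronskian, u and w would span the real solutions on S, and the real and
  imaginary parts of y would be square integrable on the end piece, contrary to the choice of y. In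
  the application S lies on one side of (c,d), where eigenfunctions of two different operators solve
  the same equation.\<close>

lemma limit_point_wronskian_zero:
  fixes a b :: ereal
  assumes q: "locally_L1 a b q" and S: "is_interval S" "S \<subseteq> einterval a b" "z \<in> S"
    and J: "einterval a' b' \<subseteq> S"
    and y: "sl_eq a b q y y' (\<lambda>x. of_real r * y x)" "y \<notin> L2 a' b'"
    and u: "weak_sol S (\<lambda>x. q x - r) u u'" "set_integrable lebesgue (einterval a' b') (\<lambda>x. (u x)\<^sup>2)"
    and w: "weak_sol S (\<lambda>x. q x - r) w w'" "set_integrable lebesgue (einterval a' b') (\<lambda>x. (w x)\<^sup>2)"
  shows "wronskian u u' w w' z = 0"
proof (rule ccontr)
  assume W: "wronskian u u' w w' z \<noteq> 0"
  let ?J = "einterval a' b'"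
  note k = loc_int_subset[OF locally_L1_loc_int[OF q] S(2), of r]
  note ws = sl_eq_imp_weak_sol[OF y(1), of r, simplified]
  have sub: "?J \<subseteq> einterval a b" using J S(2) by blast
  have [measurable]: "(\<lambda>x. Re (y x)) \<in> borel_measurable (lebesgue_on ?J)" "(\<lambda>x. Im (y x)) \<in> borel_measurable (lebesgue_on ?J)"
    using ws[THEN weak_sol_subset, OF sub] by (auto intro: borel_measurable_weak_sol)
  note sq = square_integrable_of_independent[OF k S(1,3) J _ u w W]
  have "set_integrable lebesgue ?J (\<lambda>x. (Re (y x))\<^sup>2)"
    by (rule sq[OF _ weak_sol_subset[OF ws(1) S(2)]]) simp_all
  moreover have "set_integrable lebesgue ?J (\<lambda>x. (Im (y x))\<^sup>2)"
    by (rule sq[OF _ weak_sol_subset[OF ws(2) S(2)]]) simp_all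
  ultimately have "integrable (lebesgue_on ?J) (\<lambda>x. (Re (y x))\<^sup>2 + (Im (y x))\<^sup>2)"
    by (intro Bochner_Integration.integrable_add) (simp_all add: integrable_restrict_space set_integrable_def)
  then have "integrable (lebesgue_on ?J) (\<lambda>x. (norm (y x))\<^sup>2)" by (simp add: cmod_power2)
  moreover have "y \<in> borel_measurable (lebesgue_on ?J)"
    by (subst borel_measurable_complex_iff) simp
  ultimately show False using y(2) by (simp add: L2_def)
qed

lemma einterval_initial_subset:
  assumes "s \<in> einterval a b"
  shows "einterval a (ereal s) \<subseteq> einterval a b \<inter> {..s}"
proof
  fix x assume "x \<in> einterval a (ereal s)"
  then have "a < ereal x" "ereal x < ereal s" by (auto simp: einterval_iff)
  moreover have "ereal s < b" using assms by (simp add: einterval_iff)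
  ultimately show "x \<in> einterval a b \<inter> {..s}" using less_trans[of "ereal x" "ereal s" b] by (simp add: einterval_iff)
qed

lemma einterval_final_subset:
  assumes "s \<in> einterval a b"
  shows "einterval (ereal s) b \<subseteq> einterval a b \<inter> {s..}"
proof
  fix x assume "x \<in> einterval (ereal s) b"
  then have "ereal x < b" "ereal s < ereal x" by (auto simp: einterval_iff)
  moreover have "a < ereal s" using assms by (simp add: einterval_iff)
  ultimately show "x \<in> einterval a b \<inter> {s..}" using less_trans[of a "ereal s" "ereal x"] by (simp add: einterval_iff)
qed

text \<open>q1 and q2 stand for the potentials at two values of the random coordinate, and \<delta>
  for the difference of these values.\<close>

locale local_perturbation =
  fixes a b :: ereal and q1 q2 f :: "real \<Rightarrow> real" and \<delta> c d :: real
  assumes ab: "a < b" and q1: "locally_L1 a b q1" and q2: "locally_L1 a b q2" and f: "locally_L1 a b f"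
    and q12: "\<And>x. x \<in> einterval a b \<Longrightarrow> q2 x = q1 x + \<delta> * f x"
    and cd: "c < d" "{c..d} \<subseteq> einterval a b"
    and f0: "\<And>x. x \<in> einterval a b - {c<..<d} \<Longrightarrow> f x = 0"
begin

lemma f_integrable:
  assumes "S \<subseteq> einterval a b" "S \<in> sets lebesgue"
  shows "f absolutely_integrable_on S"
proof -
  have "f absolutely_integrable_on {c..d}" using f cd(2) by (simp add: locally_L1_def)
  then have "f absolutely_integrable_on (S \<inter> {c..d})"
    using assms(2) by (rule_tac set_integrable_subset) auto
  moreover have "(\<lambda>x. indicator (S \<inter> {c..d}) x *\<^sub>R f x) = (\<lambda>x. indicator S x *\<^sub>R f x)"
  proof
    fix x
    show "indicator (S \<inter> {c..d}) x *\<^sub>R f x = indicator S x *\<^sub>R f x"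
    proof (cases "x \<in> S - {c..d}")
      case True
      then have "f x = 0" using assms(1) by (intro f0) auto
      then show ?thesis by simp
    qed (auto simp: indicator_def)
  qed
  ultimately show ?thesis unfolding set_integrable_def by metis
qed

lemma q2_integrable:
  assumes "S \<subseteq> einterval a b" "S \<in> sets lebesgue" "q1 absolutely_integrable_on S"
  shows "q2 absolutely_integrable_on S"
proof -
  have "(\<lambda>x. q1 x + \<delta> * f x) absolutely_integrable_on S"
    using assms f_integrable by (intro set_integral_add(1) set_integrable_mult_right) auto
  moreover have "(\<lambda>x. indicator S x *\<^sub>R (q1 x + \<delta> * f x)) = (\<lambda>x. indicator S x *\<^sub>R q2 x)"
    using q12 assms(1) by (auto simp: fun_eq_iff indicator_def)
  ultimately show ?thesis unfolding set_integrable_def by metis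
qed

text \<open>The perturbation vanishes off a compact subinterval, so it is integrable up to the
  endpoint and adding it preserves regularity. Hence at a regular endpoint the boundary condition
  binds both eigenfunctions.\<close>

lemma regular_left_imp: "regular_left a b q1 \<Longrightarrow> regular_left a b q2"
proof -
  assume r: "regular_left a b q1"
  then obtain s where s: "s \<in> einterval a b" "q1 absolutely_integrable_on einterval a (ereal s)"
    by (auto simp: regular_left_def)
  have "einterval a (ereal s) \<subseteq> einterval a b" using einterval_initial_subset[OF s(1)] by blast
  then have "q2 absolutely_integrable_on einterval a (ereal s)" using s(2) by (intro q2_integrable) auto
  then show ?thesis using r s(1) by (auto simp: regular_left_def)
qed

lemma regular_right_imp: "regular_right a b q1 \<Longrightarrow> regular_right a b q2"
proof -
  assume r: "regular_right a b q1"
  then obtain s where s: "s \<in> einterval a b" "q1 absolutely_integrable_on einterval (ereal s) b"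
    by (auto simp: regular_right_def)
  have "einterval (ereal s) b \<subseteq> einterval a b" using einterval_final_subset[OF s(1)] by blast
  then have "q2 absolutely_integrable_on einterval (ereal s) b" using s(2) by (intro q2_integrable) auto
  then show ?thesis using r s(1) by (auto simp: regular_right_def)
qed

lemma eigenfunctions_orthogonal:
  fixes r \<alpha> \<beta> :: real
  assumes left: "regular_left a b q1 \<or> limit_point_left a b q1"
    and right: "regular_right a b q1 \<or> limit_point_right a b q1"
    and x0: "x0 \<in> einterval a b"
    and e1: "eigen_data a b \<alpha> \<beta> q1 r x0 A1 B1" and e2: "eigen_data a b \<alpha> \<beta> q2 r x0 A2 B2"
  defines "u \<equiv> ivp_sol (sol_coeff a b q1 r) x0 A1 B1" and "w \<equiv> ivp_sol (sol_coeff a b q2 r) x0 A2 B2"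
  shows "((\<lambda>x. \<delta> * f x * (u x * w x)) has_integral 0) {c..d}"
proof -
  let ?E = "einterval a b"
  define u' where "u' = ivp_deriv (sol_coeff a b q1 r) x0 A1 B1"
  define w' where "w' = ivp_deriv (sol_coeff a b q2 r) x0 A2 B2"
  note e1 = e1[unfolded eigen_data_def, folded u_def u'_def]
  note e2 = e2[unfolded eigen_data_def, folded w_def w'_def]
  have ur: "weak_sol (sol_region a b q1) (sol_coeff a b q1 r) u u'"
    unfolding u_def u'_def by (rule ivp_sol_weak_sol_region[OF ab q1 x0])
  have wr: "weak_sol (sol_region a b q2) (sol_coeff a b q2 r) w w'"
    unfolding w_def w'_def by (rule ivp_sol_weak_sol_region[OF ab q2 x0])
  have ue: "weak_sol ?E (\<lambda>x. q1 x - r) u u'"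
    unfolding u_def u'_def by (rule ivp_sol_weak_sol_einterval[OF ab q1 x0])
  have we: "weak_sol ?E (\<lambda>x. q2 x - r) w w'"
    unfolding w_def w'_def by (rule ivp_sol_weak_sol_einterval[OF ab q2 x0])
  have same: "q1 x = q2 x" if "x \<in> ?E" "x \<le> c \<or> d \<le> x" for x
    using q12[OF that(1)] f0[of x] that by auto
  have cE: "c \<in> ?E" and dE: "d \<in> ?E" using cd by auto
  \<comment> \<open>To the left of c the potentials coincide, so w solves the equation of u there as
    well. At a regular endpoint the Wronskian is constant on [a, c] and vanishes at a; in the limit
    point case it vanishes because both functions are square integrable near a.\<close>
  have Wc: "wronskian u u' w w' c = 0"
    using left
  proof
    assume reg: "regular_left a b q1"
    let ?a = "real_of_ereal a" and ?S = "{real_of_ereal a..c}"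
    have reg2: "regular_left a b q2" using reg by (rule regular_left_imp)
    have "?a < c" by (rule regular_left_less[OF ab reg cE])
    have S1: "?S \<subseteq> sol_region a b q1" and S2: "?S \<subseteq> sol_region a b q2"
      using Icc_subset_sol_region_left[OF ab _ cE] reg reg2 by blast+
    have "weak_sol ?S (sol_coeff a b q1 r) w w'"
      by (rule weak_sol_cong[OF weak_sol_subset[OF wr S2]]) (use same in \<open>auto simp: sol_coeff_def indicator_def\<close>)
    then have "wronskian u u' w w' c = wronskian u u' w w' ?a"
      using \<open>?a < c\<close>
      by (intro wronskian_constant[OF loc_int_subset[OF loc_int_sol_coeff[OF ab q1] S1] weak_sol_subset[OF ur S1]])
         (simp_all add: is_interval_cc)
    also have "\<dots> = 0" by (rule wronskian_zero_of_bdry[of \<alpha>]) (use e1 e2 reg reg2 in auto)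
    finally show ?thesis .
  next
    assume "limit_point_left a b q1"
    then obtain y y' where y: "sl_eq a b q1 y y' (\<lambda>x. of_real r * y x)" "\<forall>s\<in>?E. y \<notin> L2 a (ereal s)"
      unfolding limit_point_left_def by blast
    let ?S = "?E \<inter> {..c}"
    have J: "einterval a (ereal c) \<subseteq> ?S" "einterval a (ereal c) \<subseteq> ?E"
      using einterval_initial_subset[OF cE] by auto
    show ?thesis
    proof (rule limit_point_wronskian_zero[OF q1 _ _ _ J(1) y(1)])
      show "weak_sol ?S (\<lambda>x. q1 x - r) u u'" by (rule weak_sol_subset[OF ue]) simp
      show "weak_sol ?S (\<lambda>x. q1 x - r) w w'"
        by (rule weak_sol_cong[OF weak_sol_subset[OF we]]) (use same in auto)
      show "set_integrable lebesgue (einterval a (ereal c)) (\<lambda>x. (u x)\<^sup>2)"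
         "set_integrable lebesgue (einterval a (ereal c)) (\<lambda>x. (w x)\<^sup>2)"
        using e1 e2 by (auto intro: set_integrable_subset[OF _ _ J(2)])
    qed (use y(2) cE in \<open>auto intro!: is_interval_Int is_interval_einterval is_interval_ic\<close>)
  qed
  have Wd: "wronskian u u' w w' d = 0"
    using right
  proof
    assume reg: "regular_right a b q1"
    let ?b = "real_of_ereal b" and ?S = "{d..real_of_ereal b}"
    have reg2: "regular_right a b q2" using reg by (rule regular_right_imp)
    have "d < ?b" by (rule regular_right_less[OF ab reg dE])
    have S1: "?S \<subseteq> sol_region a b q1" and S2: "?S \<subseteq> sol_region a b q2"
      using Icc_subset_sol_region_right[OF ab _ dE] reg reg2 by blast+
    have "weak_sol ?S (sol_coeff a b q1 r) w w'"
      by (rule weak_sol_cong[OF weak_sol_subset[OF wr S2]]) (use same in \<open>auto simp: sol_coeff_def indicator_def\<close>)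
    then have "wronskian u u' w w' d = wronskian u u' w w' ?b"
      using \<open>d < ?b\<close>
      by (intro wronskian_constant[OF loc_int_subset[OF loc_int_sol_coeff[OF ab q1] S1] weak_sol_subset[OF ur S1]])
         (simp_all add: is_interval_cc)
    also have "\<dots> = 0" by (rule wronskian_zero_of_bdry[of \<beta>]) (use e1 e2 reg reg2 in auto)
    finally show ?thesis .
  next
    assume "limit_point_right a b q1"
    then obtain y y' where y: "sl_eq a b q1 y y' (\<lambda>x. of_real r * y x)" "\<forall>s\<in>?E. y \<notin> L2 (ereal s) b"
      unfolding limit_point_right_def by blast
    let ?S = "?E \<inter> {d..}"
    have J: "einterval (ereal d) b \<subseteq> ?S" "einterval (ereal d) b \<subseteq> ?E"
      using einterval_final_subset[OF dE] by auto
    show ?thesis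
    proof (rule limit_point_wronskian_zero[OF q1 _ _ _ J(1) y(1)])
      show "weak_sol ?S (\<lambda>x. q1 x - r) u u'" by (rule weak_sol_subset[OF ue]) simp
      show "weak_sol ?S (\<lambda>x. q1 x - r) w w'"
        by (rule weak_sol_cong[OF weak_sol_subset[OF we]]) (use same in auto)
      show "set_integrable lebesgue (einterval (ereal d) b) (\<lambda>x. (u x)\<^sup>2)"
         "set_integrable lebesgue (einterval (ereal d) b) (\<lambda>x. (w x)\<^sup>2)"
        using e1 e2 by (auto intro: set_integrable_subset[OF _ _ J(2)])
    qed (use y(2) dE in \<open>auto intro!: is_interval_Int is_interval_einterval is_interval_ci\<close>)
  qed
  have "((\<lambda>x. ((q2 x - r) - (q1 x - r)) * (u x * w x)) has_integral wronskian u u' w w' d - wronskian u u' w w' c) {c..d}"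
    using cd by (intro wronskian_has_integral[OF _ _ ue we] locally_L1_loc_int q1 q2) auto
  then have "((\<lambda>x. ((q2 x - r) - (q1 x - r)) * (u x * w x)) has_integral 0) {c..d}" using Wc Wd by simp
  then show ?thesis
    by (rule has_integral_eq[rotated]) (use q12 cd(2) in auto)
qed

end

text \<open>Rounding a continuous function at the points of a fine grid yields a code from a countable
  set which determines the function up to a uniformly small error. Orthogonal unit vectors are
  uniformly far apart, hence have different codes.\<close>

definition grid_code :: "real \<Rightarrow> real \<Rightarrow> real \<Rightarrow> nat \<Rightarrow> (real \<Rightarrow> real) \<Rightarrow> int list" where
  "grid_code c d e n g = map (\<lambda>i. \<lfloor>g (c + real i * (d - c) / real n) / e\<rfloor>) [0..<Suc n]"

lemma grid_code_close:
  fixes g h :: "real \<Rightarrow> real"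
  assumes cd: "c < d" and e: "e > 0" and n: "n > 0"
    and osc: "\<And>x y. x \<in> {c..d} \<Longrightarrow> y \<in> {c..d} \<Longrightarrow> \<bar>x - y\<bar> \<le> (d - c) / real n \<Longrightarrow> \<bar>g x - g y\<bar> < e"
      "\<And>x y. x \<in> {c..d} \<Longrightarrow> y \<in> {c..d} \<Longrightarrow> \<bar>x - y\<bar> \<le> (d - c) / real n \<Longrightarrow> \<bar>h x - h y\<bar> < e"
    and code: "grid_code c d e n g = grid_code c d e n h" and x: "x \<in> {c..d}"
  shows "\<bar>g x - h x\<bar> \<le> 3 * e"
proof -
  \<comment> \<open>The point p defined next is the last grid point not exceeding x. The bound 3 * e
    is made up of the oscillations of g and of h between x and p and of their difference at p, which
    equal rounded values keep below e.\<close>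
  define i where "i = nat \<lfloor>(x - c) * real n / (d - c)\<rfloor>"
  define p where "p = c + real i * (d - c) / real n"
  have pos: "(x - c) * real n / (d - c) \<ge> 0" using x cd by simp
  have i1: "real i \<le> (x - c) * real n / (d - c)" and i2: "(x - c) * real n / (d - c) < real i + 1"
    using pos unfolding i_def by linarith+
  have "(x - c) * real n / (d - c) \<le> real n"
    using x cd n by (simp add: pos_divide_le_eq mult.commute mult_right_mono)
  then have "i \<le> n" using i1 by linarith
  then have i: "i < Suc n" by simp
  have "real i * (d - c) / real n \<le> x - c" using i1 cd n by (simp add: field_simps)
  then have px: "p \<le> x" by (simp add: p_def)
  have "(x - c) * real n < (real i + 1) * (d - c)" using i2 cd by (simp add: pos_divide_less_eq)
  then have "x - c < (real i + 1) * (d - c) / real n" using n by (simp add: pos_less_divide_eq)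
  also have "\<dots> = real i * (d - c) / real n + (d - c) / real n"
    by (simp add: distrib_right add_divide_distrib)
  finally have xp: "x - p \<le> (d - c) / real n" by (simp add: p_def)
  have pm: "p \<in> {c..d}" using px x cd by (auto simp: p_def)
  have "\<bar>x - p\<bar> \<le> (d - c) / real n" using px xp by simp
  then have 1: "\<bar>g x - g p\<bar> < e" "\<bar>h x - h p\<bar> < e" using osc x pm by blast+
  have "grid_code c d e n g ! i = grid_code c d e n h ! i" using code by simp
  then have "\<lfloor>g p / e\<rfloor> = \<lfloor>h p / e\<rfloor>"
    using i by (simp add: grid_code_def p_def del: upt_Suc)
  then have "\<bar>g p / e - h p / e\<bar> < 1" by linarith
  then have "\<bar>(g p - h p) / e\<bar> < 1" by (simp add: diff_divide_distrib)
  then have "\<bar>g p - h p\<bar> < e" using e by (simp add: abs_divide)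
  then show ?thesis using 1 by linarith
qed

lemma countable_orthonormal_family:
  fixes v :: "'i \<Rightarrow> real \<Rightarrow> real" and f :: "real \<Rightarrow> real"
  assumes cd: "c < d" and f: "f absolutely_integrable_on {c..d}"
    and v: "\<And>t. t \<in> T \<Longrightarrow> continuous_on {c..d} (v t)"
    and orth: "\<And>s t. s \<in> T \<Longrightarrow> t \<in> T \<Longrightarrow> s \<noteq> t \<Longrightarrow> integral {c..d} (\<lambda>x. f x * (v s x * v t x)) = 0"
    and norm: "\<And>t. t \<in> T \<Longrightarrow> integral {c..d} (\<lambda>x. f x * (v t x * v t x)) = 1"
  shows "countable T"
proof -
  define F where "F = integral {c..d} (\<lambda>x. \<bar>f x\<bar>)"
  have absf: "(\<lambda>x. \<bar>f x\<bar>) integrable_on {c..d}"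
    using set_integrable_abs[OF f] by (rule set_lebesgue_integral_eq_integral(1))
  have F: "F \<ge> 0" unfolding F_def using absf by (intro integral_nonneg) auto
  \<comment> \<open>With this e, two members with the same code have weighted squared distance at
    most F * (3 * e)^2 = F / (F + 1)^2 <= 1, whereas orthonormality makes it 2.\<close>
  define e where "e = 1 / (3 * (F + 1))"
  have e: "e > 0" using F by (simp add: e_def)
  have int: "(\<lambda>x. f x * g x) integrable_on {c..d}" if "continuous_on {c..d} g" for g
    using absolutely_integrable_mult_continuous[OF f that] by (rule set_lebesgue_integral_eq_integral(1))
  have "\<exists>n>0. \<forall>x y. x \<in> {c..d} \<longrightarrow> y \<in> {c..d} \<longrightarrow> \<bar>x - y\<bar> \<le> (d - c) / real n \<longrightarrow> \<bar>v t x - v t y\<bar> < e" if t: "t \<in> T" for t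
  proof -
    have "uniformly_continuous_on {c..d} (v t)" using v[OF t] by (simp add: compact_uniformly_continuous)
    then obtain \<delta> where \<delta>: "\<delta> > 0" "\<And>x y. x \<in> {c..d} \<Longrightarrow> y \<in> {c..d} \<Longrightarrow> dist y x < \<delta> \<Longrightarrow> dist (v t y) (v t x) < e"
      using e unfolding uniformly_continuous_on_def by metis
    obtain n where n: "real n > (d - c) / \<delta>" using reals_Archimedean2 by blast
    then have "n > 0" using cd \<delta>(1) by (metis divide_pos_pos diff_gt_0_iff_gt less_trans of_nat_0_less_iff)
    moreover have "(d - c) / real n < \<delta>" using n \<delta>(1) \<open>n > 0\<close> by (simp add: field_simps)
    ultimately show ?thesis using \<delta>(2) unfolding dist_real_def
      by (intro exI[of _ n]) (meson abs_minus_commute le_less_trans)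
  qed
  then obtain N where N: "\<And>t. t \<in> T \<Longrightarrow> N t > 0"
    "\<And>t x y. t \<in> T \<Longrightarrow> x \<in> {c..d} \<Longrightarrow> y \<in> {c..d} \<Longrightarrow> \<bar>x - y\<bar> \<le> (d - c) / real (N t) \<Longrightarrow> \<bar>v t x - v t y\<bar> < e" by metis
  \<comment> \<open>The mesh needed depends on the modulus of continuity of the member, so it is
    recorded in the code; equal codes then mean equal rounded values on the same grid.\<close>
  define code where "code t = (N t, grid_code c d e (N t) (v t))" for t
  have "inj_on code T"
  proof (rule inj_onI, rule ccontr)
    fix s t assume st: "s \<in> T" "t \<in> T" "code s = code t" "s \<noteq> t"
    then have Ns: "N s = N t" and cc: "grid_code c d e (N t) (v s) = grid_code c d e (N t) (v t)"
      by (auto simp: code_def)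
    have close: "\<bar>v s x - v t x\<bar> \<le> 3 * e" if "x \<in> {c..d}" for x
      by (rule grid_code_close[OF cd e N(1)[OF st(2)] N(2)[OF st(1), unfolded Ns] N(2)[OF st(2)] cc that])
    have I: "(\<lambda>x. f x * (v i x * v j x)) integrable_on {c..d}" if "i \<in> T" "j \<in> T" for i j
      using that by (intro int continuous_on_mult v)
    have "2 = integral {c..d} (\<lambda>x. f x * (v s x * v s x)) - integral {c..d} (\<lambda>x. f x * (v s x * v t x)) -
         integral {c..d} (\<lambda>x. f x * (v s x * v t x)) + integral {c..d} (\<lambda>x. f x * (v t x * v t x))"
      using orth[of s t] norm st by simp
    also have "\<dots> = integral {c..d} (\<lambda>x. f x * (v s x * v s x) - f x * (v s x * v t x) - f x * (v s x * v t x) + f x * (v t x * v t x))"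
      using I st by (simp add: Henstock_Kurzweil_Integration.integral_add Henstock_Kurzweil_Integration.integral_diff
          integrable_diff)
    also have "\<dots> = integral {c..d} (\<lambda>x. f x * (v s x - v t x)\<^sup>2)"
      by (simp add: power2_eq_square algebra_simps)
    also have "\<dots> \<le> integral {c..d} (\<lambda>x. \<bar>f x\<bar> * (3 * e)\<^sup>2)"
    proof (rule integral_le)
      show "(\<lambda>x. f x * (v s x - v t x)\<^sup>2) integrable_on {c..d}"
        using st by (intro int continuous_on_power continuous_on_diff v)
      show "(\<lambda>x. \<bar>f x\<bar> * (3 * e)\<^sup>2) integrable_on {c..d}" using absf by (rule integrable_on_mult_left)
      fix x assume x: "x \<in> {c..d}"
      have "(v s x - v t x)\<^sup>2 \<le> (3 * e)\<^sup>2" using power_mono[OF close[OF x] abs_ge_zero, of 2] by simp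
      then show "f x * (v s x - v t x)\<^sup>2 \<le> \<bar>f x\<bar> * (3 * e)\<^sup>2" by (intro mult_mono) auto
    qed
    also have "\<dots> = F * (3 * e)\<^sup>2" by (simp add: F_def)
    also have "3 * e = 1 / (F + 1)" unfolding e_def using F by (simp add: field_simps)
    also have "F * (1 / (F + 1))\<^sup>2 = F / (F + 1)\<^sup>2" by (simp add: power_divide)
    also have "\<dots> \<le> 1"
    proof -
      have "(F + 1)\<^sup>2 = F * F + 2 * F + 1" by (simp add: power2_eq_square algebra_simps)
      moreover have "F * F \<ge> 0" by simp
      ultimately have "F \<le> (F + 1)\<^sup>2" using F by linarith
      then show ?thesis using F by (intro divide_le_eq_1_pos[THEN iffD2]) auto
    qed
    finally show False by simp
  qed
  then show ?thesis by (rule countable_image_inj_on[rotated]) simp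
qed

theorem countable_eigenparameters:
  fixes a b :: ereal and q :: "real \<Rightarrow> real \<Rightarrow> real" and q0 f :: "real \<Rightarrow> real"
  assumes ab: "a < b" and q: "\<And>t. locally_L1 a b (q t)" and f: "locally_L1 a b f"
    and qt: "\<And>t x. x \<in> einterval a b \<Longrightarrow> q t x = q0 x + t * f x"
    and cd: "c < d" "{c..d} \<subseteq> einterval a b"
    and fpos: "AE x in lebesgue_on {c<..<d}. f x > 0"
    and f0: "\<And>x. x \<in> einterval a b - {c<..<d} \<Longrightarrow> f x = 0"
    and left: "\<And>t. regular_left a b (q t) \<or> limit_point_left a b (q t)"
    and right: "\<And>t. regular_right a b (q t) \<or> limit_point_right a b (q t)"
  shows "countable {t. r \<in> point_spectrum a b (sl_operator a b \<alpha> \<beta> (q t))}"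
proof -
  define T where "T = {t. r \<in> point_spectrum a b (sl_operator a b \<alpha> \<beta> (q t))}"
  have cE: "c \<in> einterval a b" using cd by auto
  have "\<exists>A B. eigen_data a b \<alpha> \<beta> (q t) r c A B" if "t \<in> T" for t
    using that point_spectrum_iff_eigen_data[OF ab q cE] by (simp add: T_def)
  then obtain A B where AB: "\<And>t. t \<in> T \<Longrightarrow> eigen_data a b \<alpha> \<beta> (q t) r c (A t) (B t)" by metis
  define u where "u t = ivp_sol (sol_coeff a b (q t) r) c (A t) (B t)" for t
  define u' where "u' t = ivp_deriv (sol_coeff a b (q t) r) c (A t) (B t)" for t
  have u: "weak_sol (einterval a b) (\<lambda>x. q t x - r) (u t) (u' t)" for t
    unfolding u_def u'_def by (rule ivp_sol_weak_sol_einterval[OF ab q cE])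
  have cu: "continuous_on {c..d} (u t)" for t by (rule weak_sol_continuous[OF u cd(2)])
  have fc: "f absolutely_integrable_on {c..d}" using f cd(2) by (simp add: locally_L1_def)
  define m where "m t = integral {c..d} (\<lambda>x. f x * (u t x * u t x))" for t
  have orth: "integral {c..d} (\<lambda>x. f x * (u s x * u t x)) = 0" if "s \<in> T" "t \<in> T" "s \<noteq> t" for s t
  proof -
    interpret local_perturbation a b "q s" "q t" f "t - s" c d
      by unfold_locales (use ab q f qt cd f0 in \<open>auto simp: algebra_simps\<close>)
    have "((\<lambda>x. (t - s) * f x * (u s x * u t x)) has_integral 0) {c..d}"
      unfolding u_def by (rule eigenfunctions_orthogonal[OF left right cE AB[OF that(1)] AB[OF that(2)]])
    from has_integral_divide[OF this, of "t - s"] that(3)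
    have "((\<lambda>x. f x * (u s x * u t x)) has_integral 0) {c..d}" by simp
    then show ?thesis by (rule integral_unique)
  qed
  \<comment> \<open>Otherwise f * u^2, nonnegative almost everywhere on (c,d), integrates to 0, so u
    vanishes almost everywhere there because f > 0. Uniqueness then gives zero Cauchy data at c,
    against A^2 + B^2 = 1.\<close>
  have m: "m t > 0" if t: "t \<in> T" for t
  proof (rule ccontr)
    assume neg: "\<not> m t > 0"
    let ?M = "lebesgue_on {c<..<d}"
    let ?g = "\<lambda>x. f x * (u t x * u t x)"
    have gc: "?g absolutely_integrable_on {c..d}"
      by (intro absolutely_integrable_mult_continuous fc continuous_on_mult cu)
    from gc have gi: "?g absolutely_integrable_on {c<..<d}" by (rule set_integrable_subset) auto
    then have gi': "integrable ?M ?g" by (simp add: integrable_restrict_space set_integrable_def)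
    have "(?g has_integral m t) {c..d}"
      unfolding m_def using set_lebesgue_integral_eq_integral(1)[OF gc] by (rule integrable_integral)
    then have "m t = integral {c<..<d} ?g" by (simp add: has_integral_Icc_iff_Ioo integral_unique)
    also have "\<dots> = (LINT x|?M. ?g x)"
      using gi by (simp add: set_lebesgue_integral_eq_integral(2)[symmetric] integral_restrict_space set_lebesgue_integral_def)
    finally have le: "(LINT x|?M. ?g x) \<le> 0" using neg by simp
    have nn: "AE x in ?M. 0 \<le> ?g x" using fpos by eventually_elim simp
    have "(LINT x|?M. ?g x) = 0" using le integral_nonneg_AE[OF nn] by simp
    then have "AE x in ?M. ?g x = 0" using integral_nonneg_eq_0_iff_AE[OF gi' nn] by simp
    then have ae: "AE x in lebesgue_on (einterval (ereal c) (ereal d)). u t x = 0"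
      using fpos unfolding einterval_eq by eventually_elim simp
    have sub: "einterval (ereal c) (ereal d) \<subseteq> einterval a b" using cd(2) by auto
    \<comment> \<open>Vanishing is known on the open interval, which does not contain c; the data
      are read off at the midpoint and carried to c by uniqueness.\<close>
    have mid: "(c + d) / 2 \<in> einterval (ereal c) (ereal d)" using cd(1) by simp
    have z: "u t ((c + d) / 2) = 0" "u' t ((c + d) / 2) = 0"
      using weak_sol_AE_zero_imp[OF _ loc_int_subset[OF locally_L1_loc_int[OF q] sub] weak_sol_subset[OF u sub] ae mid] cd(1)
      by auto
    have "u t c = 0 \<and> u' t c = 0"
      using weak_sol_eq_ivp_sol[OF is_interval_einterval subsetD[OF sub mid] locally_L1_loc_int[OF q] u[of t] cE] z by simp
    then have "A t = 0" "B t = 0" by (simp_all add: u_def u'_def)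
    then show False using AB[OF t] by (simp add: eigen_data_def)
  qed
  have "countable T"
  proof (rule countable_orthonormal_family[OF cd(1) fc, where v="\<lambda>t x. u t x / sqrt (m t)"])
    show "continuous_on {c..d} (\<lambda>x. u t x / sqrt (m t))" if "t \<in> T" for t
      using m[OF that] by (intro continuous_on_divide cu continuous_on_const) auto
    have *: "integral {c..d} (\<lambda>x. f x * (u s x / sqrt (m s) * (u t x / sqrt (m t)))) =
       integral {c..d} (\<lambda>x. f x * (u s x * u t x)) / (sqrt (m s) * sqrt (m t))" for s t
      by (subst integral_divide[symmetric]) (simp add: field_simps)
    show "integral {c..d} (\<lambda>x. f x * (u s x / sqrt (m s) * (u t x / sqrt (m t)))) = 0" if "s \<in> T" "t \<in> T" "s \<noteq> t" for s t
      unfolding * using orth[OF that] by simp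
    show "integral {c..d} (\<lambda>x. f x * (u t x / sqrt (m t) * (u t x / sqrt (m t)))) = 1" if "t \<in> T" for t
      unfolding * using m[OF that] by (simp add: m_def[symmetric])
  qed
  then show ?thesis by (simp add: T_def)
qed

section \<open>Measurability of the eigenvalue condition\<close>

lemma sigma_finite_lebesgue: "sigma_finite_measure (lebesgue :: 'a::euclidean_space measure)"
proof
  obtain A :: "'a set set" where A: "countable A" "A \<subseteq> sets lborel" "\<Union>A = space lborel" "\<forall>a\<in>A. emeasure lborel a \<noteq> \<infinity>"
    using lborel.sigma_finite_countable by blast
  show "\<exists>A::'a set set. countable A \<and> A \<subseteq> sets lebesgue \<and> \<Union>A = space lebesgue \<and> (\<forall>a\<in>A. emeasure lebesgue a \<noteq> \<infinity>)"
  proof (intro exI[of _ A] conjI ballI)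
    show "A \<subseteq> sets lebesgue" using A(2) by (meson order_trans sets_completionI_sets subsetI)
    fix x assume x: "x \<in> A"
    then have "x \<in> sets lborel" "emeasure lborel x \<noteq> \<infinity>" using A(2,4) by blast+
    then show "emeasure lebesgue x \<noteq> \<infinity>" by (simp add: sets_completionI_sets)
  qed (simp_all add: A)
qed

lemma borel_measurable_lebesgue_ident: "(\<lambda>x. x) \<in> lebesgue \<rightarrow>\<^sub>M (borel :: 'a::euclidean_space measure)"
  by (rule measurable_completion) simp

text \<open>The coefficient is only Lebesgue measurable in x, while indefinite integrals come out
  Borel measurable in x. Passing back to the Lebesgue side allows the next Picard term to be
  formed.\<close>

lemma measurable_pair_lebesgue:
  assumes "case_prod g \<in> borel_measurable (M \<Otimes>\<^sub>M (borel :: real measure))"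
  shows "case_prod g \<in> borel_measurable (M \<Otimes>\<^sub>M (lebesgue :: real measure))"
proof -
  have "(\<lambda>z. (fst z, snd z)) \<in> M \<Otimes>\<^sub>M lebesgue \<rightarrow>\<^sub>M M \<Otimes>\<^sub>M (borel :: real measure)"
    by (intro measurable_Pair measurable_fst measurable_compose[OF measurable_snd borel_measurable_lebesgue_ident])
  from measurable_compose[OF this assms] show ?thesis by (simp add: case_prod_beta')
qed

lemma measurable_signed_integral:
  assumes g: "case_prod g \<in> borel_measurable (M \<Otimes>\<^sub>M lebesgue)"
  shows "(\<lambda>(w, x). signed_integral x0 (g w) x) \<in> borel_measurable (M \<Otimes>\<^sub>M (borel :: real measure))"
proof -
  interpret L: sigma_finite_measure "lebesgue :: real measure" by (rule sigma_finite_lebesgue)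
  let ?N = "(M \<Otimes>\<^sub>M (borel :: real measure)) \<Otimes>\<^sub>M (lebesgue :: real measure)"
  have y: "(\<lambda>z. snd z) \<in> ?N \<rightarrow>\<^sub>M borel"
    by (rule measurable_compose[OF measurable_snd borel_measurable_lebesgue_ident])
  have x: "(\<lambda>z. snd (fst z)) \<in> ?N \<rightarrow>\<^sub>M borel"
    by (rule measurable_compose[OF measurable_fst measurable_snd])
  have "(\<lambda>z. (fst (fst z), snd z)) \<in> ?N \<rightarrow>\<^sub>M M \<Otimes>\<^sub>M lebesgue"
    by (intro measurable_Pair measurable_compose[OF measurable_fst measurable_fst] measurable_snd)
  from measurable_compose[OF this g] have g': "(\<lambda>z. g (fst (fst z)) (snd z)) \<in> borel_measurable ?N"
    by (simp add: case_prod_beta')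
  note [measurable] = x y g'
  \<comment> \<open>Indicators of intervals with a variable endpoint become comparisons between the
    coordinates of z, which are jointly measurable.\<close>
  have eq: "indicator {x0..snd (fst z)} (snd z) - indicator {snd (fst z)..x0} (snd z) =
     (if x0 \<le> snd z \<and> snd z \<le> snd (fst z) then 1 else 0) - (if snd (fst z) \<le> snd z \<and> snd z \<le> x0 then 1 else (0::real))"
     for z :: "('a \<times> real) \<times> real"
    by (auto simp: indicator_def)
  have "(\<lambda>z. (indicator {x0..snd (fst z)} (snd z) - indicator {snd (fst z)..x0} (snd z)) * g (fst (fst z)) (snd z))
     \<in> borel_measurable ?N"
    unfolding eq by measurable
  then have "(\<lambda>z. LINT y|lebesgue. (indicator {x0..snd z} y - indicator {snd z..x0} y) * g (fst z) y)
     \<in> borel_measurable (M \<Otimes>\<^sub>M (borel :: real measure))"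
    by (intro L.borel_measurable_lebesgue_integral) (simp add: case_prod_beta')
  then show ?thesis by (simp add: signed_integral_def case_prod_beta')
qed

lemma measurable_picard:
  assumes k: "case_prod k \<in> borel_measurable (M \<Otimes>\<^sub>M lebesgue)"
  shows "(\<lambda>(w, x). fst (picard (k w) x0 A B n) x) \<in> borel_measurable (M \<Otimes>\<^sub>M (borel :: real measure)) \<and>
    (\<lambda>(w, x). snd (picard (k w) x0 A B n) x) \<in> borel_measurable (M \<Otimes>\<^sub>M (borel :: real measure))"
proof (induction n)
  case (Suc n)
  have "(\<lambda>(w, x). k w x * fst (picard (k w) x0 A B n) x) \<in> borel_measurable (M \<Otimes>\<^sub>M (lebesgue :: real measure))"
    using borel_measurable_times[OF k measurable_pair_lebesgue[of "\<lambda>w. fst (picard (k w) x0 A B n)"]] Suc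
    by (simp add: case_prod_beta')
  from measurable_signed_integral[OF this, of x0]
    measurable_signed_integral[OF measurable_pair_lebesgue[of "\<lambda>w. snd (picard (k w) x0 A B n)"], of M x0] Suc
  show ?case by simp
qed simp

lemma measurable_ivp_sol:
  assumes k: "case_prod k \<in> borel_measurable (M \<Otimes>\<^sub>M lebesgue)"
  shows "(\<lambda>(w, x). ivp_sol (k w) x0 A B x) \<in> borel_measurable (M \<Otimes>\<^sub>M (borel :: real measure))"
    "(\<lambda>(w, x). ivp_deriv (k w) x0 A B x) \<in> borel_measurable (M \<Otimes>\<^sub>M (borel :: real measure))"
  using measurable_picard[OF k, of x0 A B] unfolding ivp_sol_def ivp_deriv_def case_prod_beta'
  by (auto intro: borel_measurable_suminf)

section \<open>Bounded directions of binary quadratic forms\<close>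

text \<open>On the unit circle M equals M * (A^2 + B^2). After subtracting it, the negated condition
  is Sylvester's criterion for the shifted matrix with rows (\<alpha> - M, \<beta>) and (\<beta>,
  \<gamma> - M) to be positive definite.\<close>

lemma quadratic_form_le_iff:
  fixes \<alpha> \<beta> \<gamma> M :: real
  shows "(\<exists>A B. A\<^sup>2 + B\<^sup>2 = 1 \<and> \<alpha> * A\<^sup>2 + 2 * \<beta> * (A * B) + \<gamma> * B\<^sup>2 \<le> M) \<longleftrightarrow>
    \<not> (\<alpha> > M \<and> (\<alpha> - M) * (\<gamma> - M) - \<beta>\<^sup>2 > 0)"
proof
  assume "\<exists>A B. A\<^sup>2 + B\<^sup>2 = 1 \<and> \<alpha> * A\<^sup>2 + 2 * \<beta> * (A * B) + \<gamma> * B\<^sup>2 \<le> M"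
  then obtain A B where AB: "A\<^sup>2 + B\<^sup>2 = 1" "\<alpha> * A\<^sup>2 + 2 * \<beta> * (A * B) + \<gamma> * B\<^sup>2 \<le> M" by blast
  show "\<not> (\<alpha> > M \<and> (\<alpha> - M) * (\<gamma> - M) - \<beta>\<^sup>2 > 0)"
  proof
    assume pd: "\<alpha> > M \<and> (\<alpha> - M) * (\<gamma> - M) - \<beta>\<^sup>2 > 0"
    \<comment> \<open>Completing the square after multiplication by the positive number \<alpha> -
      M; the determinant appears as the coefficient of B^2.\<close>
    have "(\<alpha> - M) * (\<alpha> * A\<^sup>2 + 2 * \<beta> * (A * B) + \<gamma> * B\<^sup>2 - M * (A\<^sup>2 + B\<^sup>2)) =
       ((\<alpha> - M) * A + \<beta> * B)\<^sup>2 + ((\<alpha> - M) * (\<gamma> - M) - \<beta>\<^sup>2) * B\<^sup>2"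
      by (simp add: power2_eq_square algebra_simps)
    moreover have "(\<alpha> - M) * (\<alpha> * A\<^sup>2 + 2 * \<beta> * (A * B) + \<gamma> * B\<^sup>2 - M * (A\<^sup>2 + B\<^sup>2)) \<le> 0"
      using AB pd by (intro mult_nonneg_nonpos) auto
    ultimately have le: "((\<alpha> - M) * A + \<beta> * B)\<^sup>2 + ((\<alpha> - M) * (\<gamma> - M) - \<beta>\<^sup>2) * B\<^sup>2 \<le> 0" by simp
    have nn: "((\<alpha> - M) * (\<gamma> - M) - \<beta>\<^sup>2) * B\<^sup>2 \<ge> 0" using pd by simp
    have "((\<alpha> - M) * (\<gamma> - M) - \<beta>\<^sup>2) * B\<^sup>2 = 0" using le nn zero_le_power2[of "(\<alpha> - M) * A + \<beta> * B"] by linarith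
    then have B: "B = 0" using pd by simp
    then have "((\<alpha> - M) * A)\<^sup>2 \<le> 0" using le by simp
    then have "A = 0" using pd by simp
    then show False using AB B by simp
  qed
next
  assume npd: "\<not> (\<alpha> > M \<and> (\<alpha> - M) * (\<gamma> - M) - \<beta>\<^sup>2 > 0)"
  show "\<exists>A B. A\<^sup>2 + B\<^sup>2 = 1 \<and> \<alpha> * A\<^sup>2 + 2 * \<beta> * (A * B) + \<gamma> * B\<^sup>2 \<le> M"
  proof (cases "\<alpha> > M")
    case False
    then show ?thesis by (intro exI[of _ 1] exI[of _ 0]) auto
  next
    case True
    \<comment> \<open>The witness is the unit vector along (- \<beta>, \<alpha> - M), orthogonal to
      the first row of the shifted matrix. There the shifted form equals \<alpha> - M times the
      determinant, divided by s.\<close>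
    define s where "s = \<beta>\<^sup>2 + (\<alpha> - M)\<^sup>2"
    have s: "s > 0" using True by (simp add: s_def add_nonneg_pos)
    define A where "A = - \<beta> / sqrt s"
    define B where "B = (\<alpha> - M) / sqrt s"
    have 1: "A\<^sup>2 = \<beta>\<^sup>2 / s" "B\<^sup>2 = (\<alpha> - M)\<^sup>2 / s" "A * B = - \<beta> * (\<alpha> - M) / s"
      using s by (simp_all add: A_def B_def power_divide)
    have one: "A\<^sup>2 + B\<^sup>2 = 1" using s unfolding 1 add_divide_distrib[symmetric] s_def[symmetric] by simp
    have "\<alpha> * A\<^sup>2 + 2 * \<beta> * (A * B) + \<gamma> * B\<^sup>2 - M * (A\<^sup>2 + B\<^sup>2) =
        (\<alpha> * \<beta>\<^sup>2 + 2 * \<beta> * (- \<beta> * (\<alpha> - M)) + \<gamma> * (\<alpha> - M)\<^sup>2 - M * (\<beta>\<^sup>2 + (\<alpha> - M)\<^sup>2)) / s"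
      unfolding 1 by (simp add: add_divide_distrib diff_divide_distrib distrib_left)
    also have "\<alpha> * \<beta>\<^sup>2 + 2 * \<beta> * (- \<beta> * (\<alpha> - M)) + \<gamma> * (\<alpha> - M)\<^sup>2 - M * (\<beta>\<^sup>2 + (\<alpha> - M)\<^sup>2) =
        (\<alpha> - M) * ((\<alpha> - M) * (\<gamma> - M) - \<beta>\<^sup>2)"
      by (simp add: power2_eq_square algebra_simps)
    also have "\<dots> / s \<le> 0"
      using npd True s by (intro divide_nonpos_pos mult_nonneg_nonpos) auto
    finally show ?thesis using one by (intro exI[of _ A] exI[of _ B]) auto
  qed
qed

text \<open>By compactness of the unit circle, the existence of a direction along which an increasing
  sequence of quadratic forms stays bounded can be tested separately for each form.\<close>

lemma bounded_direction_iff: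
  fixes \<alpha> \<beta> \<gamma> :: "nat \<Rightarrow> real"
  defines "Q \<equiv> \<lambda>n A B. \<alpha> n * A\<^sup>2 + 2 * \<beta> n * (A * B) + \<gamma> n * B\<^sup>2"
  assumes mono: "\<And>m n A B. m \<le> n \<Longrightarrow> Q m A B \<le> Q n A B"
  shows "(\<exists>A B. A\<^sup>2 + B\<^sup>2 = 1 \<and> (\<exists>M. \<forall>n. Q n A B \<le> M)) \<longleftrightarrow>
    (\<exists>M::nat. \<forall>n. \<not> (\<alpha> n > M \<and> (\<alpha> n - M) * (\<gamma> n - M) - (\<beta> n)\<^sup>2 > 0))"
proof -
  have "(\<exists>A B. A\<^sup>2 + B\<^sup>2 = 1 \<and> (\<exists>M. \<forall>n. Q n A B \<le> M)) \<longleftrightarrow>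
    (\<exists>M::nat. \<forall>n. \<exists>A B. A\<^sup>2 + B\<^sup>2 = 1 \<and> Q n A B \<le> M)"
  proof
    assume "\<exists>A B. A\<^sup>2 + B\<^sup>2 = 1 \<and> (\<exists>M. \<forall>n. Q n A B \<le> M)"
    then obtain A B M where AB: "A\<^sup>2 + B\<^sup>2 = 1" and M: "\<And>n. Q n A B \<le> M" by blast
    obtain m :: nat where "M \<le> real m" using real_arch_simple by blast
    then show "\<exists>M::nat. \<forall>n. \<exists>A B. A\<^sup>2 + B\<^sup>2 = 1 \<and> Q n A B \<le> M"
      using AB M order_trans by (intro exI[of _ m]) blast
  next
    assume "\<exists>M::nat. \<forall>n. \<exists>A B. A\<^sup>2 + B\<^sup>2 = 1 \<and> Q n A B \<le> M"
    then obtain M :: nat where M: "\<And>n. \<exists>A B. A\<^sup>2 + B\<^sup>2 = 1 \<and> Q n A B \<le> M" by blast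
    \<comment> \<open>Monotonicity in n makes these compact sets decreasing, so that witnesses for
      the single forms yield one common direction.\<close>
    define F where "F n = sphere (0 :: real \<times> real) 1 \<inter> {z. Q n (fst z) (snd z) \<le> M}" for n
    have sphere: "z \<in> sphere (0 :: real \<times> real) 1 \<longleftrightarrow> (fst z)\<^sup>2 + (snd z)\<^sup>2 = 1" for z
      by (simp add: norm_prod_def)
    have "\<Inter>(range F) \<noteq> {}"
    proof (rule compact_nest)
      show "compact (F n)" for n
        unfolding F_def Q_def by (intro compact_Int_closed compact_sphere closed_Collect_le continuous_intros)
      show "F n \<noteq> {}" for n
      proof -
        obtain A B where "A\<^sup>2 + B\<^sup>2 = 1" "Q n A B \<le> M" using M by blast
        then have "(A, B) \<in> F n" unfolding F_def by (simp add: norm_prod_def)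
        then show ?thesis by blast
      qed
      show "F n \<subseteq> F m" if "m \<le> n" for m n
        unfolding F_def using mono[OF that] order_trans by blast
    qed
    then obtain z where z: "\<And>n. z \<in> F n" by auto
    then have "(fst z)\<^sup>2 + (snd z)\<^sup>2 = 1" "\<And>n. Q n (fst z) (snd z) \<le> M"
      using sphere unfolding F_def by blast+
    then show "\<exists>A B. A\<^sup>2 + B\<^sup>2 = 1 \<and> (\<exists>M. \<forall>n. Q n A B \<le> M)" by blast
  qed
  also have "\<dots> \<longleftrightarrow> (\<exists>M::nat. \<forall>n. \<not> (\<alpha> n > M \<and> (\<alpha> n - M) * (\<gamma> n - M) - (\<beta> n)\<^sup>2 > 0))"
    unfolding Q_def quadratic_form_le_iff by simp
  finally show ?thesis .
qed

section \<open>The eigenvalue condition as a countable condition\<close>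

text \<open>By local integrability the fixed point x0 can replace the unspecified point in the
  definition. This removes an uncountable quantifier and makes regularity a measurable condition on
  the parameter.\<close>

lemma regular_left_iff:
  assumes ab: "a < b" and q: "locally_L1 a b q" and x0: "x0 \<in> einterval a b"
  shows "regular_left a b q \<longleftrightarrow> a \<noteq> -\<infinity> \<and> q absolutely_integrable_on einterval a (ereal x0)"
proof
  assume reg: "regular_left a b q"
  let ?J = "einterval a (ereal x0)"
  have "?J \<subseteq> {real_of_ereal a..x0}"
  proof
    fix x assume "x \<in> ?J"
    then show "x \<in> {real_of_ereal a..x0}" using regular_leftD[OF ab reg] unfolding einterval_iff
      by (metis atLeastAtMost_iff less_ereal.simps(1) less_imp_le)
  qed
  then have "sol_coeff a b q 0 absolutely_integrable_on ?J"
    by (intro set_integrable_subset[OF sol_coeff_regular_left[OF ab q reg x0]]) auto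
  moreover have "(\<lambda>x. indicator ?J x *\<^sub>R sol_coeff a b q 0 x) = (\<lambda>x. indicator ?J x *\<^sub>R q x)"
    using einterval_initial_subset[OF x0] by (auto simp: fun_eq_iff indicator_def sol_coeff_def)
  ultimately have "q absolutely_integrable_on ?J" unfolding set_integrable_def by metis
  then show "a \<noteq> -\<infinity> \<and> q absolutely_integrable_on ?J" using reg by (simp add: regular_left_def)
next
  assume "a \<noteq> -\<infinity> \<and> q absolutely_integrable_on einterval a (ereal x0)"
  then show "regular_left a b q" using x0 by (auto simp: regular_left_def)
qed

lemma regular_right_iff:
  assumes ab: "a < b" and q: "locally_L1 a b q" and x0: "x0 \<in> einterval a b"
  shows "regular_right a b q \<longleftrightarrow> b \<noteq> \<infinity> \<and> q absolutely_integrable_on einterval (ereal x0) b"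
proof
  assume reg: "regular_right a b q"
  let ?J = "einterval (ereal x0) b"
  have "?J \<subseteq> {x0..real_of_ereal b}"
  proof
    fix x assume "x \<in> ?J"
    then show "x \<in> {x0..real_of_ereal b}" using regular_rightD[OF ab reg] unfolding einterval_iff
      by (metis atLeastAtMost_iff less_ereal.simps(1) less_imp_le)
  qed
  then have "sol_coeff a b q 0 absolutely_integrable_on ?J"
    by (intro set_integrable_subset[OF sol_coeff_regular_right[OF ab q reg x0]]) auto
  moreover have "(\<lambda>x. indicator ?J x *\<^sub>R sol_coeff a b q 0 x) = (\<lambda>x. indicator ?J x *\<^sub>R q x)"
    using einterval_final_subset[OF x0] by (auto simp: fun_eq_iff indicator_def sol_coeff_def)
  ultimately have "q absolutely_integrable_on ?J" unfolding set_integrable_def by metis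
  then show "b \<noteq> \<infinity> \<and> q absolutely_integrable_on ?J" using reg by (simp add: regular_right_def)
next
  assume "b \<noteq> \<infinity> \<and> q absolutely_integrable_on einterval (ereal x0) b"
  then show "regular_right a b q" using x0 by (auto simp: regular_right_def)
qed

text \<open>Monotone convergence; it replaces integrability over the whole interval by a bound on a
  sequence of integrals over compact intervals.\<close>

lemma set_integrable_nonneg_iff_bounded:
  fixes g :: "real \<Rightarrow> real"
  assumes E: "E = (\<Union>n. {l n..m n})" and mono: "decseq l" "incseq m"
    and g: "\<And>n. g absolutely_integrable_on {l n..m n}" "\<And>x. 0 \<le> g x"
  shows "g absolutely_integrable_on E \<longleftrightarrow> (\<exists>M. \<forall>n. (LINT x|lebesgue. indicator {l n..m n} x * g x) \<le> M)"
proof -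
  define h where "h n x = indicator {l n..m n} x * g x" for n x
  have sub: "{l n..m n} \<subseteq> {l k..m k}" if "n \<le> k" for n k
    using decseqD[OF mono(1) that] incseqD[OF mono(2) that] by auto
  have hi: "integrable lebesgue (h n)" for n
    using g(1)[of n] by (simp add: h_def[abs_def] set_integrable_def)
  have hmono: "h n x \<le> h k x" if "n \<le> k" for n k x
    using sub[OF that] g(2)[of x] by (auto simp: h_def indicator_def)
  have hlim: "(\<lambda>n. h n x) \<longlonglongrightarrow> indicator E x * g x" for x
  proof (cases "x \<in> E")
    case True
    then obtain N where N: "x \<in> {l N..m N}" using E by auto
    have "h n x = g x" if "N \<le> n" for n using sub[OF that] N by (auto simp: h_def indicator_def)
    then show ?thesis using True by (intro tendsto_eventually) (auto simp: eventually_sequentially)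
  next
    case False
    then have "h n x = 0" for n using E by (auto simp: h_def indicator_def)
    then show ?thesis using False by simp
  qed
  show ?thesis
  proof
    assume "g absolutely_integrable_on E"
    then have gE: "integrable lebesgue (\<lambda>x. indicator E x * g x)" by (simp add: set_integrable_def)
    have "(LINT x|lebesgue. h n x) \<le> (LINT x|lebesgue. indicator E x * g x)" for n
      using E g(2) by (intro integral_mono hi gE) (auto simp: h_def indicator_def)
    then show "\<exists>M. \<forall>n. (LINT x|lebesgue. indicator {l n..m n} x * g x) \<le> M" unfolding h_def by blast
  next
    assume "\<exists>M. \<forall>n. (LINT x|lebesgue. indicator {l n..m n} x * g x) \<le> M"
    then obtain M where M: "\<And>n. (LINT x|lebesgue. h n x) \<le> M" unfolding h_def by blast
    have "incseq (\<lambda>n. LINT x|lebesgue. h n x)"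
      by (intro incseq_SucI integral_mono hi hmono) simp
    then obtain L where L: "(\<lambda>n. LINT x|lebesgue. h n x) \<longlonglongrightarrow> L"
      using M incseq_convergent by blast
    have meas: "(\<lambda>x. indicator E x * g x) \<in> borel_measurable lebesgue"
      by (rule borel_measurable_LIMSEQ_real[OF hlim]) (use hi in auto)
    have "integrable lebesgue (\<lambda>x. indicator E x * g x)"
      by (rule integrable_monotone_convergence[OF hi _ _ L meas]) (use hmono hlim in \<open>auto simp: mono_def\<close>)
    then show "g absolutely_integrable_on E" by (simp add: set_integrable_def)
  qed
qed

definition gram :: "(real \<Rightarrow> real) \<Rightarrow> (real \<Rightarrow> real) \<Rightarrow> real \<Rightarrow> real \<Rightarrow> real" where
  "gram u w s t = (LINT x|lebesgue. indicator {s..t} x * (u x * w x))"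

lemma gram_combination:
  assumes "continuous_on {s..t} u" "continuous_on {s..t} w"
  shows "gram (\<lambda>x. A * u x + B * w x) (\<lambda>x. A * u x + B * w x) s t =
    gram u u s t * A\<^sup>2 + 2 * gram u w s t * (A * B) + gram w w s t * B\<^sup>2"
proof -
  have i: "integrable lebesgue (\<lambda>x. indicator {s..t} x * (g x * h x))"
    if "continuous_on {s..t} g" "continuous_on {s..t} h" for g h :: "real \<Rightarrow> real"
    using absolutely_integrable_continuous_on[OF continuous_on_mult[OF that]] by (simp add: set_integrable_def)
  have "gram (\<lambda>x. A * u x + B * w x) (\<lambda>x. A * u x + B * w x) s t =
     (LINT x|lebesgue. A\<^sup>2 * (indicator {s..t} x * (u x * u x)) + 2 * A * B * (indicator {s..t} x * (u x * w x))
       + B\<^sup>2 * (indicator {s..t} x * (w x * w x)))"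
    unfolding gram_def by (intro Bochner_Integration.integral_cong) (auto simp: power2_eq_square algebra_simps)
  also have "\<dots> = A\<^sup>2 * gram u u s t + 2 * A * B * gram u w s t + B\<^sup>2 * gram w w s t"
    unfolding gram_def using i assms by simp
  finally show ?thesis by (simp add: algebra_simps)
qed

text \<open>To be used with p n the integral of the squared solution over the n-th compact interval
  and with x, y the squared boundary values. The factor n enforces exact vanishing and keeps the
  whole expression increasing in n.\<close>

lemma mult_nat_bounded_iff:
  fixes p :: "nat \<Rightarrow> real" and x y :: real
  assumes "\<And>n. 0 \<le> p n" "0 \<le> x" "0 \<le> y"
  shows "(\<exists>M. \<forall>n. p n + real n * (x + y) \<le> M) \<longleftrightarrow> (\<exists>M. \<forall>n. p n \<le> M) \<and> x = 0 \<and> y = 0"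
proof
  assume "\<exists>M. \<forall>n. p n + real n * (x + y) \<le> M"
  then obtain M where M: "\<And>n. p n + real n * (x + y) \<le> M" by blast
  have le: "real n * (x + y) \<le> M" for n using M[of n] assms(1)[of n] by linarith
  have "x + y = 0"
  proof (rule ccontr)
    assume "x + y \<noteq> 0"
    then have "x + y > 0" using assms by linarith
    then obtain n where "M < real n * (x + y)" using reals_Archimedean3 by blast
    then show False using le[of n] by linarith
  qed
  then have xy: "x = 0" "y = 0" using assms by linarith+
  then have "\<forall>n. p n \<le> M" using M by simp
  then show "(\<exists>M. \<forall>n. p n \<le> M) \<and> x = 0 \<and> y = 0" using xy by blast
qed auto

text \<open>The solution depends linearly on (A, B). Hence Q n A B is the integral of its square
  over [l n, m n] plus n times its squared boundary values, expressed through the two fundamental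
  solutions. The factors \<rho> and \<sigma> switch the boundary terms off at an endpoint that is
  not regular.\<close>

theorem eigen_data_iff_bounded:
  fixes a b :: ereal and q :: "real \<Rightarrow> real" and \<alpha> \<beta> r x0 A B :: real and l m :: "nat \<Rightarrow> real"
  defines "k \<equiv> sol_coeff a b q r"
  defines "u1 \<equiv> ivp_sol k x0 1 0" and "u2 \<equiv> ivp_sol k x0 0 1"
    and "u1' \<equiv> ivp_deriv k x0 1 0" and "u2' \<equiv> ivp_deriv k x0 0 1"
    and "a0 \<equiv> real_of_ereal a" and "b0 \<equiv> real_of_ereal b"
  defines "\<rho> \<equiv> of_bool (regular_left a b q)" and "\<sigma> \<equiv> of_bool (regular_right a b q)"
  defines "form \<equiv> \<lambda>g h g' h' n. gram g h (l n) (m n) +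
     real n * (\<rho> * (bdry \<alpha> g g' a0 * bdry \<alpha> h h' a0) + \<sigma> * (bdry \<beta> g g' b0 * bdry \<beta> h h' b0))"
  defines "Q \<equiv> \<lambda>n A B. form u1 u1 u1' u1' n * A\<^sup>2 + 2 * form u1 u2 u1' u2' n * (A * B) + form u2 u2 u2' u2' n * B\<^sup>2"
  assumes ab: "a < b" and q: "locally_L1 a b q" and x0: "x0 \<in> einterval a b"
    and E: "einterval a b = (\<Union>n. {l n..m n})" and lm: "decseq l" "incseq m"
  shows "eigen_data a b \<alpha> \<beta> q r x0 A B \<longleftrightarrow> A\<^sup>2 + B\<^sup>2 = 1 \<and> (\<exists>M. \<forall>n. Q n A B \<le> M)"
    and "i \<le> j \<Longrightarrow> Q i A B \<le> Q j A B"
proof -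
  define w where "w = ivp_sol k x0 A B"
  define w' where "w' = ivp_deriv k x0 A B"
  note kr = loc_int_sol_coeff[OF ab q, of r, folded k_def]
  note xr = subsetD[OF einterval_subset_sol_region x0, of q]
  have w: "w x = A * u1 x + B * u2 x" "w' x = A * u1' x + B * u2' x" if "x \<in> sol_region a b q" for x
    using weak_sol_eq_ivp_sol[OF is_interval_sol_region[OF ab] xr kr ivp_sol_weak_sol_region[OF ab q x0, of r A B, folded k_def] that]
    by (simp_all add: w_def w'_def u1_def u2_def u1'_def u2'_def)
  have sub: "{l n..m n} \<subseteq> einterval a b" for n using E by auto
  have c12: "continuous_on {l n..m n} u1" "continuous_on {l n..m n} u2" for n
    unfolding u1_def u2_def k_def by (rule weak_sol_continuous[OF ivp_sol_weak_sol_einterval[OF ab q x0] sub])+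
  have cw: "continuous_on {l n..m n} w" for n
    unfolding w_def k_def by (rule weak_sol_continuous[OF ivp_sol_weak_sol_einterval[OF ab q x0] sub])
  have gw: "gram w w (l n) (m n) = gram u1 u1 (l n) (m n) * A\<^sup>2 + 2 * gram u1 u2 (l n) (m n) * (A * B) + gram u2 u2 (l n) (m n) * B\<^sup>2" for n
  proof -
    have "gram w w (l n) (m n) = gram (\<lambda>x. A * u1 x + B * u2 x) (\<lambda>x. A * u1 x + B * u2 x) (l n) (m n)"
      unfolding gram_def
    proof (intro Bochner_Integration.integral_cong refl)
      fix x
      show "indicator {l n..m n} x * (w x * w x) =
          indicator {l n..m n} x * ((A * u1 x + B * u2 x) * (A * u1 x + B * u2 x))"
      proof (cases "x \<in> {l n..m n}")
        case True
        then have "x \<in> sol_region a b q" using sub[of n] einterval_subset_sol_region by blast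
        then show ?thesis by (simp add: w(1))
      qed simp
    qed
    then show ?thesis using gram_combination[OF c12] by simp
  qed
  have bl: "\<rho> * (bdry \<alpha> w w' a0)\<^sup>2 = \<rho> * (bdry \<alpha> u1 u1' a0 * A + bdry \<alpha> u2 u2' a0 * B)\<^sup>2"
  proof (cases "regular_left a b q")
    case True
    then have "a0 \<in> sol_region a b q" by (simp add: sol_region_def a0_def)
    from w[OF this] show ?thesis by (simp add: bdry_def algebra_simps)
  qed (simp add: \<rho>_def)
  have br: "\<sigma> * (bdry \<beta> w w' b0)\<^sup>2 = \<sigma> * (bdry \<beta> u1 u1' b0 * A + bdry \<beta> u2 u2' b0 * B)\<^sup>2"
  proof (cases "regular_right a b q")
    case True
    then have "b0 \<in> sol_region a b q" by (simp add: sol_region_def b0_def)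
    from w[OF this] show ?thesis by (simp add: bdry_def algebra_simps)
  qed (simp add: \<sigma>_def)
  have Q: "Q n A B = gram w w (l n) (m n) + real n * (\<rho> * (bdry \<alpha> w w' a0)\<^sup>2 + \<sigma> * (bdry \<beta> w w' b0)\<^sup>2)" for n
    unfolding gw bl br Q_def form_def by (simp add: power2_eq_square algebra_simps)
  have gi: "(\<lambda>x. w x * w x) absolutely_integrable_on {l n..m n}" for n
    by (intro absolutely_integrable_continuous_on continuous_on_mult cw)
  have nn: "0 \<le> gram w w (l n) (m n)" for n
    unfolding gram_def by (intro Bochner_Integration.integral_nonneg) simp
  have gmono: "gram w w (l i) (m i) \<le> gram w w (l j) (m j)" if "i \<le> j" for i j
    unfolding gram_def
  proof (rule integral_mono)
    have *: "integrable lebesgue (\<lambda>x. indicator {l n..m n} x * (w x * w x))" for n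
      using gi[of n] by (simp add: set_integrable_def)
    show "integrable lebesgue (\<lambda>x. indicator {l i..m i} x * (w x * w x))" by (rule *)
    show "integrable lebesgue (\<lambda>x. indicator {l j..m j} x * (w x * w x))" by (rule *)
    show "indicator {l i..m i} x * (w x * w x) \<le> indicator {l j..m j} x * (w x * w x)" for x
      using decseqD[OF lm(1) that] incseqD[OF lm(2) that] by (auto simp: indicator_def)
  qed
  have pos: "0 \<le> \<rho> * (bdry \<alpha> w w' a0)\<^sup>2" "0 \<le> \<sigma> * (bdry \<beta> w w' b0)\<^sup>2" by (simp_all add: \<rho>_def \<sigma>_def)
  show "Q i A B \<le> Q j A B" if "i \<le> j"
    unfolding Q using gmono[OF that] that pos by (intro add_mono mult_right_mono) auto
  have "(\<lambda>x. (w x)\<^sup>2) absolutely_integrable_on einterval a b \<longleftrightarrow> (\<exists>M. \<forall>n. gram w w (l n) (m n) \<le> M)"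
    unfolding gram_def power2_eq_square by (rule set_integrable_nonneg_iff_bounded[OF E lm gi]) simp
  then show "eigen_data a b \<alpha> \<beta> q r x0 A B \<longleftrightarrow> A\<^sup>2 + B\<^sup>2 = 1 \<and> (\<exists>M. \<forall>n. Q n A B \<le> M)"
    unfolding eigen_data_def k_def[symmetric] w_def[symmetric] w'_def[symmetric] a0_def[symmetric] b0_def[symmetric]
      Q mult_nat_bounded_iff[OF nn pos]
    by (auto simp: \<rho>_def \<sigma>_def)
qed

text \<open>By the reductions above, the event says that for some natural number N and all n a
  condition on finitely many measurable functions holds. It is thus a countable union of countable
  intersections, measurable without completing M.\<close>

theorem sets_eigenvalue:
  fixes a b :: ereal and q :: "'w \<Rightarrow> real \<Rightarrow> real" and r :: "'w \<Rightarrow> real"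
  assumes ab: "a < b" and q: "\<And>w. w \<in> space M \<Longrightarrow> locally_L1 a b (q w)"
    and qm: "(\<lambda>(w, x). indicator (einterval a b) x * q w x) \<in> borel_measurable (M \<Otimes>\<^sub>M lebesgue)"
    and r: "r \<in> borel_measurable M"
  shows "{w \<in> space M. r w \<in> point_spectrum a b (sl_operator a b \<alpha> \<beta> (q w))} \<in> sets M"
proof -
  interpret L: sigma_finite_measure "lebesgue :: real measure" by (rule sigma_finite_lebesgue)
  obtain x0 where x0: "x0 \<in> einterval a b" using einterval_nonempty[OF ab] by blast
  obtain m l :: "nat \<Rightarrow> real" where E: "einterval a b = (\<Union>n. {l n..m n})" and lm: "incseq m" "decseq l"
    using einterval_Icc_approximation[OF ab] by metis
  have indm: "(\<lambda>z. indicator S (snd z) :: real) \<in> borel_measurable (M \<Otimes>\<^sub>M lebesgue)" if "S \<in> sets lebesgue" for S :: "real set"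
    using that by (intro measurable_compose[OF measurable_snd] borel_measurable_indicator)
  define k where "k w = sol_coeff a b (q w) (r w)" for w
  have km: "case_prod k \<in> borel_measurable (M \<Otimes>\<^sub>M lebesgue)"
  proof -
    have "(\<lambda>z. indicator (einterval a b) (snd z) * q (fst z) (snd z) - indicator (einterval a b) (snd z) * r (fst z))
        \<in> borel_measurable (M \<Otimes>\<^sub>M lebesgue)"
      by (intro borel_measurable_diff[OF qm[unfolded case_prod_beta'] borel_measurable_times[OF indm]]
          measurable_compose[OF measurable_fst r]) simp
    then show ?thesis by (simp add: k_def sol_coeff_def case_prod_beta' right_diff_distrib)
  qed
  define u1 where "u1 w = ivp_sol (k w) x0 1 0" for w
  define u2 where "u2 w = ivp_sol (k w) x0 0 1" for w
  define u1' where "u1' w = ivp_deriv (k w) x0 1 0" for w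
  define u2' where "u2' w = ivp_deriv (k w) x0 0 1" for w
  have um: "case_prod u1 \<in> borel_measurable (M \<Otimes>\<^sub>M borel)" "case_prod u2 \<in> borel_measurable (M \<Otimes>\<^sub>M borel)"
     "case_prod u1' \<in> borel_measurable (M \<Otimes>\<^sub>M borel)" "case_prod u2' \<in> borel_measurable (M \<Otimes>\<^sub>M borel)"
    unfolding u1_def u2_def u1'_def u2'_def using measurable_ivp_sol[OF km] by simp_all
  have point: "(\<lambda>w. g w x) \<in> borel_measurable M" if "case_prod g \<in> borel_measurable (M \<Otimes>\<^sub>M (borel :: real measure))" for g :: "'w \<Rightarrow> real \<Rightarrow> real" and x
    using measurable_compose[OF measurable_Pair[OF measurable_ident_sets[OF refl] measurable_const[of x]] that] by simp
  have bm: "(\<lambda>w. bdry \<gamma> (g w) (h w) x) \<in> borel_measurable M"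
    if "case_prod g \<in> borel_measurable (M \<Otimes>\<^sub>M borel)" "case_prod h \<in> borel_measurable (M \<Otimes>\<^sub>M borel)"
    for g h :: "'w \<Rightarrow> real \<Rightarrow> real" and x \<gamma>
    unfolding bdry_def by (intro borel_measurable_add borel_measurable_times point that measurable_const) auto
  have gm: "(\<lambda>w. gram (g w) (h w) s t) \<in> borel_measurable M"
    if "case_prod g \<in> borel_measurable (M \<Otimes>\<^sub>M borel)" "case_prod h \<in> borel_measurable (M \<Otimes>\<^sub>M borel)"
    for g h :: "'w \<Rightarrow> real \<Rightarrow> real" and s t
    unfolding gram_def
  proof (rule L.borel_measurable_lebesgue_integral)
    have "(\<lambda>z. indicator {s..t} (snd z) * (case_prod g z * case_prod h z)) \<in> borel_measurable (M \<Otimes>\<^sub>M lebesgue)"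
      by (intro borel_measurable_times indm measurable_pair_lebesgue that) auto
    then show "(\<lambda>(w, x). indicator {s..t} x * (g w x * h w x)) \<in> borel_measurable (M \<Otimes>\<^sub>M lebesgue)"
      by (simp add: case_prod_beta')
  qed
  \<comment> \<open>For a jointly measurable integrand, integrability of the sections depends
    measurably on the parameter; with \<open>regular_left_iff\<close> and
    \<open>regular_right_iff\<close> this makes the switches of the boundary terms
    measurable.\<close>
  have part: "Measurable.pred M (\<lambda>w. q w absolutely_integrable_on J)" if J: "J \<subseteq> einterval a b" "J \<in> sets lebesgue" for J
  proof -
    have "(\<lambda>z. indicator J (snd z) * (indicator (einterval a b) (snd z) * q (fst z) (snd z))) \<in> borel_measurable (M \<Otimes>\<^sub>M lebesgue)"
      using qm by (intro borel_measurable_times[OF indm[OF J(2)]]) (simp add: case_prod_beta')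
    moreover have "indicator J x * (indicator (einterval a b) x * q w x) = indicator J x * q w x" for w x
      using J(1) by (auto simp: indicator_def)
    ultimately have "(\<lambda>(w, x). indicator J x * q w x) \<in> borel_measurable (M \<Otimes>\<^sub>M lebesgue)"
      by (simp add: case_prod_beta')
    then have "Measurable.pred M (\<lambda>w. integrable lebesgue (\<lambda>x. indicator J x * q w x))"
      by (rule L.borel_measurable_lebesgue_integrable)
    then show ?thesis by (simp add: set_integrable_def)
  qed
  have regL: "(\<lambda>w. of_bool (regular_left a b (q w)) :: real) \<in> borel_measurable M"
  proof -
    have "(\<lambda>w. if a \<noteq> -\<infinity> \<and> q w absolutely_integrable_on einterval a (ereal x0) then 1 else 0 :: real) \<in> borel_measurable M"
      using part[of "einterval a (ereal x0)"] einterval_initial_subset[OF x0] by (intro measurable_If) auto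
    then show ?thesis
      by (rule measurable_cong[THEN iffD1, rotated]) (use regular_left_iff[OF ab q x0] in auto)
  qed
  have regR: "(\<lambda>w. of_bool (regular_right a b (q w)) :: real) \<in> borel_measurable M"
  proof -
    have "(\<lambda>w. if b \<noteq> \<infinity> \<and> q w absolutely_integrable_on einterval (ereal x0) b then 1 else 0 :: real) \<in> borel_measurable M"
      using part[of "einterval (ereal x0) b"] einterval_final_subset[OF x0] by (intro measurable_If) auto
    then show ?thesis
      by (rule measurable_cong[THEN iffD1, rotated]) (use regular_right_iff[OF ab q x0] in auto)
  qed
  define form where "form g h g' h' n w = gram (g w) (h w) (l n) (m n) +
     real n * (of_bool (regular_left a b (q w)) * (bdry \<alpha> (g w) (g' w) (real_of_ereal a) * bdry \<alpha> (h w) (h' w) (real_of_ereal a)) +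
       of_bool (regular_right a b (q w)) * (bdry \<beta> (g w) (g' w) (real_of_ereal b) * bdry \<beta> (h w) (h' w) (real_of_ereal b)))"
    for g h g' h' :: "'w \<Rightarrow> real \<Rightarrow> real" and n w
  have fm: "form g h g' h' n \<in> borel_measurable M"
    if "case_prod g \<in> borel_measurable (M \<Otimes>\<^sub>M borel)" "case_prod h \<in> borel_measurable (M \<Otimes>\<^sub>M borel)"
       "case_prod g' \<in> borel_measurable (M \<Otimes>\<^sub>M borel)" "case_prod h' \<in> borel_measurable (M \<Otimes>\<^sub>M borel)"
    for g h g' h' n
    unfolding form_def[abs_def]
    by (intro borel_measurable_add borel_measurable_times gm bm regL regR borel_measurable_const that)
  have [measurable]: "form u1 u1 u1' u1' n \<in> borel_measurable M" "form u1 u2 u1' u2' n \<in> borel_measurable M"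
    "form u2 u2 u2' u2' n \<in> borel_measurable M" for n
    by (intro fm um)+
  have "r w \<in> point_spectrum a b (sl_operator a b \<alpha> \<beta> (q w)) \<longleftrightarrow>
     (\<exists>N::nat. \<forall>n. \<not> (form u1 u1 u1' u1' n w > real N \<and>
        (form u1 u1 u1' u1' n w - real N) * (form u2 u2 u2' u2' n w - real N) - (form u1 u2 u1' u2' n w)\<^sup>2 > 0))"
    if w: "w \<in> space M" for w
  proof -
    note ed = eigen_data_iff_bounded[where \<alpha>=\<alpha> and \<beta>=\<beta> and r="r w", OF ab q[OF w] x0 E lm(2,1),
        folded k_def, folded u1_def u2_def u1'_def u2'_def, folded form_def]
    show ?thesis
      unfolding point_spectrum_iff_eigen_data[OF ab q[OF w] x0] ed(1)
      by (rule bounded_direction_iff) (rule ed(2))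
  qed
  then have "{w \<in> space M. r w \<in> point_spectrum a b (sl_operator a b \<alpha> \<beta> (q w))} =
     {w \<in> space M. \<exists>N::nat. \<forall>n. \<not> (form u1 u1 u1' u1' n w > real N \<and>
        (form u1 u1 u1' u1' n w - real N) * (form u2 u2 u2' u2' n w - real N) - (form u1 u2 u1' u2' n w)\<^sup>2 > 0)}"
    by blast
  also have "\<dots> \<in> sets M" by measurable
  finally show ?thesis .
qed

section \<open>The random family\<close>

text \<open>An unordered sum is a limit along the filter of finite subsets. The symmetric windows
  run through this filter, so the sum is also the limit of a sequence, as measurability arguments
  require.\<close>

lemma infsum_int_LIMSEQ:
  fixes g :: "int \<Rightarrow> real"
  assumes "g summable_on I"
  shows "(\<lambda>m. \<Sum>n\<in>I \<inter> {- int m..int m}. g n) \<longlonglongrightarrow> infsum g I"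
proof -
  have "(sum g \<longlongrightarrow> infsum g I) (finite_subsets_at_top I)"
    using has_sum_infsum[OF assms] by (simp add: has_sum_def)
  moreover have "filterlim (\<lambda>m. I \<inter> {- int m..int m}) (finite_subsets_at_top I) sequentially"
    unfolding filterlim_finite_subsets_at_top
  proof (intro allI impI, elim conjE)
    fix X assume X: "finite X" "X \<subseteq> I"
    obtain N where N: "\<And>x. x \<in> X \<Longrightarrow> nat \<bar>x\<bar> \<le> N"
      using finite_nat_set_iff_bounded_le[of "(\<lambda>x. nat \<bar>x\<bar>) ` X"] X(1) by auto
    have "X \<subseteq> I \<inter> {- int m..int m}" if "m \<ge> N" for m
    proof
      fix x assume x: "x \<in> X"
      then have "nat \<bar>x\<bar> \<le> m" using N[OF x] that by linarith
      then show "x \<in> I \<inter> {- int m..int m}" using x X(2) by auto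
    qed
    then show "\<forall>\<^sub>F m in sequentially. finite (I \<inter> {- int m..int m}) \<and> X \<subseteq> I \<inter> {- int m..int m} \<and> I \<inter> {- int m..int m} \<subseteq> I"
      unfolding eventually_sequentially by (intro exI[of _ N]) auto
  qed
  ultimately show ?thesis by (rule filterlim_compose)
qed

lemma locally_L1_indicator_measurable:
  assumes "locally_L1 a b g"
  shows "(\<lambda>x. indicator (einterval a b) x * g x) \<in> borel_measurable lebesgue"
  using assms borel_measurable_restrict_space_iff[of "einterval a b" lebesgue g] by (simp add: locally_L1_def)

text \<open>The indicator confines everything to the interval, where alone measurability of the
  functions and summability of the series are assumed.\<close>

lemma measurable_random_potential:
  fixes p :: "int \<Rightarrow> real measure"
  assumes sp: "\<And>n. n \<in> I \<Longrightarrow> sets (p n) = sets borel"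
    and v: "locally_L1 a b v" and f: "\<And>n. n \<in> I \<Longrightarrow> locally_L1 a b (f n)"
    and sm: "\<And>w x. w \<in> space (Pi\<^sub>M I p) \<Longrightarrow> x \<in> einterval a b \<Longrightarrow> (\<lambda>n. w n * f n x) summable_on I"
  shows "(\<lambda>(w, x). indicator (einterval a b) x * random_potential I v f w x) \<in> borel_measurable (Pi\<^sub>M I p \<Otimes>\<^sub>M lebesgue)"
proof -
  let ?N = "Pi\<^sub>M I p \<Otimes>\<^sub>M (lebesgue :: real measure)" and ?E = "einterval a b"
  have c: "(\<lambda>z. fst z n) \<in> borel_measurable ?N" if "n \<in> I" for n
    by (intro measurable_compose[OF measurable_fst])
      (use measurable_component_singleton[OF that, of p] sp[OF that] in \<open>simp cong: measurable_cong_sets\<close>)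
  have g: "(\<lambda>z. indicator ?E (snd z) * g (snd z)) \<in> borel_measurable ?N" if "locally_L1 a b g" for g
    by (rule measurable_compose[OF measurable_snd locally_L1_indicator_measurable[OF that]])
  have "(\<lambda>z. indicator ?E (snd z) * random_potential I v f (fst z) (snd z)) \<in> borel_measurable ?N"
  proof (rule borel_measurable_LIMSEQ_real)
    fix z :: "(int \<Rightarrow> real) \<times> real" assume z: "z \<in> space ?N"
    show "(\<lambda>m. indicator ?E (snd z) * v (snd z) + (\<Sum>n\<in>I \<inter> {- int m..int m}. fst z n * (indicator ?E (snd z) * f n (snd z))))
       \<longlonglongrightarrow> indicator ?E (snd z) * random_potential I v f (fst z) (snd z)"
    proof (cases "snd z \<in> ?E")
      case True
      have "(\<lambda>n. fst z n * f n (snd z)) summable_on I" using z True by (intro sm) (auto simp: space_pair_measure)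
      from tendsto_add[OF tendsto_const[of "v (snd z)"] infsum_int_LIMSEQ[OF this]] True show ?thesis
        by (simp add: random_potential_def)
    qed simp
  next
    fix m
    show "(\<lambda>z. indicator ?E (snd z) * v (snd z) + (\<Sum>n\<in>I \<inter> {- int m..int m}. fst z n * (indicator ?E (snd z) * f n (snd z))))
       \<in> borel_measurable ?N"
      by (intro borel_measurable_add g v borel_measurable_sum borel_measurable_times c f) auto
  qed
  then show ?thesis by (simp add: case_prod_beta')
qed

text \<open>The product over I is the image of \<open>p n0\<close> times the product over the other
  indices under (t, X) |-> X(n0 := t). Integrating over t first gives 0, since countable sets are
  null for a law without atoms.\<close>

lemma PiM_null_set_of_countable_sections:
  fixes p :: "int \<Rightarrow> real measure"
  assumes ps: "\<And>n. n \<in> I \<Longrightarrow> prob_space (p n)" and sp: "\<And>n. n \<in> I \<Longrightarrow> sets (p n) = sets borel"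
    and n0: "n0 \<in> I" and atomless: "\<And>t. measure (p n0) {t} = 0"
    and A: "A \<in> sets (Pi\<^sub>M I p)"
    and countable: "\<And>X. X \<in> space (Pi\<^sub>M (I - {n0}) p) \<Longrightarrow> countable {t. X(n0 := t) \<in> A}"
  shows "A \<in> null_sets (Pi\<^sub>M I p)"
proof -
  let ?J = "I - {n0}"
  have ins: "insert n0 ?J = I" using n0 by auto
  interpret p0: prob_space "p n0" by (rule ps[OF n0])
  interpret J: prob_space "Pi\<^sub>M ?J p" using ps by (intro prob_space_PiM) auto
  interpret PP: pair_sigma_finite "p n0" "Pi\<^sub>M ?J p" ..
  have null: "C \<in> null_sets (p n0)" if "countable C" for C
  proof -
    have "{t} \<in> null_sets (p n0)" for t
      using atomless[of t] sp[OF n0] by (simp add: null_sets_def p0.emeasure_eq_measure)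
    then have "(\<Union>t\<in>C. {t}) \<in> null_sets (p n0)" using that by (intro null_sets_UN') auto
    then show ?thesis by simp
  qed
  let ?\<Phi> = "\<lambda>(x, X). X(n0 := x)" and ?N = "p n0 \<Otimes>\<^sub>M Pi\<^sub>M ?J p"
  have distr: "distr ?N (Pi\<^sub>M I p) ?\<Phi> = Pi\<^sub>M I p"
    using distr_pair_PiM_eq_PiM[of ?J p n0] ps n0 unfolding ins by auto
  have meas: "?\<Phi> \<in> ?N \<rightarrow>\<^sub>M Pi\<^sub>M I p"
    using measurable_add_dim[of n0 ?J p] unfolding ins
    by (auto dest: measurable_compose[OF measurable_pair_swap'] simp: case_prod_beta')
  define B where "B = ?\<Phi> -` A \<inter> space ?N"
  have B: "B \<in> sets ?N" unfolding B_def by (rule measurable_sets[OF meas A])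
  have "emeasure (Pi\<^sub>M I p) A = emeasure (distr ?N (Pi\<^sub>M I p) ?\<Phi>) A" unfolding distr ..
  also have "\<dots> = emeasure ?N B" unfolding B_def by (rule emeasure_distr[OF meas A])
  also have "\<dots> = (\<integral>\<^sup>+ X. emeasure (p n0) ((\<lambda>x. (x, X)) -` B) \<partial>Pi\<^sub>M ?J p)"
    by (rule PP.emeasure_pair_measure_alt2[OF B])
  also have "\<dots> = (\<integral>\<^sup>+ X. 0 \<partial>Pi\<^sub>M ?J p)"
  proof (rule nn_integral_cong)
    fix X assume X: "X \<in> space (Pi\<^sub>M ?J p)"
    have "(\<lambda>x. (x, X)) -` B \<subseteq> {t. X(n0 := t) \<in> A}" unfolding B_def by auto
    then have "countable ((\<lambda>x. (x, X)) -` B)" using countable[OF X] by (rule countable_subset)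
    then show "emeasure (p n0) ((\<lambda>x. (x, X)) -` B) = 0" using null by blast
  qed
  finally show ?thesis using A by (simp add: null_sets_def)
qed

lemma random_potential_update:
  assumes n0: "n0 \<in> I" and sm: "(\<lambda>n. (X(n0 := t)) n * f n x) summable_on I"
  shows "random_potential I v f (X(n0 := t)) x = random_potential (I - {n0}) v f X x + t * f n0 x"
proof -
  have "(\<lambda>n. (X(n0 := t)) n * f n x) summable_on (I - {n0})"
    using sm by (rule summable_on_cofin_subset) auto
  then have "(\<Sum>\<^sub>\<infinity>n\<in>insert n0 (I - {n0}). (X(n0 := t)) n * f n x) =
     t * f n0 x + (\<Sum>\<^sub>\<infinity>n\<in>I - {n0}. (X(n0 := t)) n * f n x)"
    by (subst infsum_insert) auto
  also have "(\<Sum>\<^sub>\<infinity>n\<in>I - {n0}. (X(n0 := t)) n * f n x) = (\<Sum>\<^sub>\<infinity>n\<in>I - {n0}. X n * f n x)"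
    by (rule infsum_cong) auto
  finally show ?thesis using n0 by (simp add: random_potential_def insert_absorb)
qed

lemma null_set_eigenvalue:
  fixes a b :: ereal and p :: "int \<Rightarrow> real measure" and v :: "real \<Rightarrow> real"
    and f :: "int \<Rightarrow> real \<Rightarrow> real" and \<alpha> \<beta> c d :: real and n0 :: int and r :: "(int \<Rightarrow> real) \<Rightarrow> real"
  assumes ab: "a < b"
    and ps: "\<And>n. n \<in> I \<Longrightarrow> prob_space (p n)" and sp: "\<And>n. n \<in> I \<Longrightarrow> sets (p n) = sets borel"
    and v: "locally_L1 a b v" and f: "\<And>n. n \<in> I \<Longrightarrow> locally_L1 a b (f n)"
    and sm: "\<And>w x. w \<in> space (Pi\<^sub>M I p) \<Longrightarrow> x \<in> einterval a b \<Longrightarrow> (\<lambda>n. w n * f n x) summable_on I"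
    and q: "\<And>w. w \<in> space (Pi\<^sub>M I p) \<Longrightarrow> locally_L1 a b (random_potential I v f w)"
    and left: "\<And>w. w \<in> space (Pi\<^sub>M I p) \<Longrightarrow>
      regular_left a b (random_potential I v f w) \<or> limit_point_left a b (random_potential I v f w)"
    and right: "\<And>w. w \<in> space (Pi\<^sub>M I p) \<Longrightarrow>
      regular_right a b (random_potential I v f w) \<or> limit_point_right a b (random_potential I v f w)"
    and cd: "c < d" "{c..d} \<subseteq> einterval a b" and n0: "n0 \<in> I"
    and fpos: "AE x in lebesgue_on {c<..<d}. f n0 x > 0"
    and f0: "\<And>x. x \<in> einterval a b - {c<..<d} \<Longrightarrow> f n0 x = 0"
    and atomless: "\<And>t. measure (p n0) {t} = 0"
    and r: "r \<in> borel_measurable (Pi\<^sub>M I p)" and indep: "indep_of_coord I n0 r"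
  shows "{w \<in> space (Pi\<^sub>M I p). r w \<in> point_spectrum a b (sl_operator a b \<alpha> \<beta> (random_potential I v f w))}
    \<in> null_sets (Pi\<^sub>M I p)" (is "?A \<in> _")
proof (rule PiM_null_set_of_countable_sections[where p=p and I=I and ?n0.0=n0, OF ps sp n0 atomless])
  show "?A \<in> sets (Pi\<^sub>M I p)"
    by (rule sets_eigenvalue[OF ab q measurable_random_potential[OF sp v f sm] r])
  fix X assume X: "X \<in> space (Pi\<^sub>M (I - {n0}) p)"
  have space_p: "space (p n) = UNIV" if "n \<in> I" for n
    using sets_eq_imp_space_eq[OF sp[OF that]] by simp
  have sp_I: "space (Pi\<^sub>M I p) = (\<Pi>\<^sub>E n\<in>I. UNIV)"
    unfolding space_PiM by (intro PiE_cong space_p)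
  \<comment> \<open>Each \<open>p n\<close> has the whole line as its space, so every real t is
    admissible and the hypotheses on the potentials hold for all t.\<close>
  have Xt: "X(n0 := t) \<in> space (Pi\<^sub>M I p)" for t
    using X n0 unfolding sp_I space_PiM using space_p[OF n0] by (auto simp: PiE_iff extensional_def)
  \<comment> \<open>The value 0 is an arbitrary reference: with the other coordinates fixed, r is a
    single number, as \<open>countable_eigenparameters\<close> demands.\<close>
  have rX: "r (X(n0 := t)) = r (X(n0 := 0))" for t
    by (rule indep[unfolded indep_of_coord_def, rule_format, OF Xt[unfolded sp_I] Xt[unfolded sp_I]]) simp
  have "countable {t. r (X(n0 := 0)) \<in> point_spectrum a b (sl_operator a b \<alpha> \<beta> (random_potential I v f (X(n0 := t))))}"
    by (rule countable_eigenparameters[OF ab q[OF Xt] f[OF n0] _ cd fpos f0 left[OF Xt] right[OF Xt]])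
      (rule random_potential_update[OF n0 sm[OF Xt]])
  moreover have "{t. X(n0 := t) \<in> ?A} \<subseteq>
      {t. r (X(n0 := 0)) \<in> point_spectrum a b (sl_operator a b \<alpha> \<beta> (random_potential I v f (X(n0 := t))))}"
  proof
    fix t assume "t \<in> {t. X(n0 := t) \<in> ?A}"
    then show "t \<in> {t. r (X(n0 := 0)) \<in> point_spectrum a b (sl_operator a b \<alpha> \<beta> (random_potential I v f (X(n0 := t))))}"
      using rX[of t] by simp
  qed
  ultimately show "countable {t. X(n0 := t) \<in> ?A}" by (rule countable_subset[rotated])
qed

theorem mainTheorem2:
  fixes a b :: ereal and n1 n2 :: "int extended" and I :: "int set"
    and p :: "int \<Rightarrow> real measure" and P :: "(int \<Rightarrow> real) measure"
    and v :: "real \<Rightarrow> real" and f :: "int \<Rightarrow> real \<Rightarrow> real"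
    and q :: "(int \<Rightarrow> real) \<Rightarrow> real \<Rightarrow> real"
    and \<alpha> \<beta> :: real and H :: "(int \<Rightarrow> real) \<Rightarrow> L2_op"
    and c d :: real and n0 :: int
  defines "I \<equiv> index_set n1 n2"
    and "P \<equiv> Pi\<^sub>M I p"
    and "q \<equiv> random_potential I v f"
    and "H \<equiv> (\<lambda>\<omega>. sl_operator a b \<alpha> \<beta> (q \<omega>))"
  assumes "a < b" and "n1 < n2"
    and "\<And>n. n \<in> I \<Longrightarrow> prob_space (p n)"
    and "\<And>n. n \<in> I \<Longrightarrow> sets (p n) = sets borel"
    and "locally_L1 a b v"
    and "\<And>n. n \<in> I \<Longrightarrow> locally_L1 a b (f n)"
    and "\<And>\<omega> x. \<omega> \<in> space P \<Longrightarrow> x \<in> einterval a b \<Longrightarrow> (\<lambda>n. \<omega> n * f n x) summable_on I"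
    and "\<And>\<omega>. \<omega> \<in> space P \<Longrightarrow> locally_L1 a b (q \<omega>)"
    and "\<And>\<omega>. \<omega> \<in> space P \<Longrightarrow> regular_left a b (q \<omega>) \<or> limit_point_left a b (q \<omega>)"
    and "\<And>\<omega>. \<omega> \<in> space P \<Longrightarrow> regular_right a b (q \<omega>) \<or> limit_point_right a b (q \<omega>)"
    and "\<And>\<omega>. \<omega> \<in> space P \<Longrightarrow> selfadjoint_op a b (H \<omega>)"
    and "c < d" and "{c..d} \<subseteq> einterval a b"
    and "n0 \<in> I"
    and "AE x in lebesgue_on {c<..<d}. f n0 x > 0"
    and "\<And>x. x \<in> einterval a b - {c<..<d} \<Longrightarrow> f n0 x = 0"
    and "\<And>t. measure (p n0) {t} = 0"
  shows "(\<forall>(N :: enat) (r :: nat \<Rightarrow> (int \<Rightarrow> real) \<Rightarrow> real).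
            (\<forall>i. 1 \<le> i \<and> enat i \<le> N \<longrightarrow> r i \<in> borel_measurable P \<and> indep_of_coord I n0 (r i)) \<longrightarrow>
            {\<omega> \<in> space P. (\<Union>i\<in>{i. 1 \<le> i \<and> enat i \<le> N}. {r i \<omega>}) \<inter> point_spectrum a b (H \<omega>) \<noteq> {}}
              \<in> null_sets P) \<and>
         (\<forall>r :: (int \<Rightarrow> real) \<Rightarrow> real.
            r \<in> borel_measurable P \<and> indep_of_coord I n0 r \<longrightarrow>
            (AE \<omega> in P. r \<omega> \<notin> point_spectrum a b (H \<omega>)))"
proof -
  note hyps = assms(5,7-14,16-21)[unfolded P_def q_def]
  have null: "{\<omega> \<in> space P. r \<omega> \<in> point_spectrum a b (H \<omega>)} \<in> null_sets P"
    if "r \<in> borel_measurable P" "indep_of_coord I n0 r" for r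
    unfolding P_def q_def H_def
    by (rule null_set_eigenvalue[where v=v and f=f and c=c and d=d, OF hyps that[unfolded P_def]])
  show ?thesis
  proof (intro conjI allI impI, goal_cases)
    case (1 N r)
    let ?J = "{i. 1 \<le> i \<and> enat i \<le> N}"
    \<comment> \<open>The indices are natural numbers, so the union of null sets is countable even
      when N is infinite.\<close>
    have "(\<Union>i\<in>?J. {\<omega> \<in> space P. r i \<omega> \<in> point_spectrum a b (H \<omega>)}) \<in> null_sets P"
      using 1 by (intro null_sets_UN' null) auto
    moreover have "(\<Union>i\<in>?J. {\<omega> \<in> space P. r i \<omega> \<in> point_spectrum a b (H \<omega>)}) =
        {\<omega> \<in> space P. (\<Union>i\<in>?J. {r i \<omega>}) \<inter> point_spectrum a b (H \<omega>) \<noteq> {}}"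
      by blast
    ultimately show ?case by simp
  next
    case (2 r)
    then show ?case by (intro AE_I'[OF null[of r]]) auto
  qed
qed

end
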